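(* Let $p\ge2$, $0<s<1$, $\Lambda\ge1$, and let $\Omega\subset\mathbb{R}^N$ be an open and bounded set. Let $K:\mathbb{R}^N\to[0,+\infty)$ be measurable with $\frac1\Lambda|z|^{N+sp}\le K(z)\le\Lambda|z|^{N+sp}$ for all $z\in\mathbb{R}^N$, let $f\in W^{s,p'}(\Omega)$ and $g\in W^{s,p}(\mathbb{R}^N)$. Let $u\in W^{s,p}(\mathbb{R}^N)$ be the (unique) solution of the problem $$(-\Delta_{p,K})^su=f\ \text{ in }\Omega,\qquad u=g\ \text{ in }\mathbb{R}^N\setminus\Omega .$$ This means that $u=g$ in $\mathbb{R}^N\setminus\Omega$ and $$\int_{\mathbb{R}^N}\int_{\mathbb{R}^N}\frac{|u(x)-u(y)|^{p-2}(u(x)-u(y))}{K(x-y)}(\varphi(x)-\varphi(y))\,dx\,dy=\int_\Omega f\varphi\,dx\qquad\text{for every }\varphi\in\widetilde W^{s,p}_0(\Omega).$$ Then: (i) if $s\le\frac{p-1}{p+1}$, then $u\in W^{\tau,p}_{loc}(\Omega)$ for every $s\le\tau<s\,\frac{p+1}{p-1}$; (ii) if $s>\frac{p-1}{p+1}$, then $u\in W^{1,p}_{loc}(\Omega)$ and $\nabla u\in W^{\tau,p}_{loc}(\Omega)$ for every $0<\tau<s\,\frac{p+1}{p}-\frac{p-1}{p}$.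
   Context: Here $p'=p/(p-1)$. For $0<\alpha<1$ and $1\le q<\infty$, $[\psi]_{W^{\alpha,q}(E)}=\left(\int_E\int_E\frac{|\psi(x)-\psi(y)|^q}{|x-y|^{N+\alpha q}}dx\,dy\right)^{1/q}$; $W^{\alpha,q}(E)$ is the set of $\psi\in L^q(E)$ with $[\psi]_{W^{\alpha,q}(E)}<\infty$; $W^{\alpha,q}_{loc}(\Omega)$ is the corresponding local space. $\widetilde W^{s,p}_0(\Omega)$ is the completion of $C_0^\infty(\Omega)$ with respect to the norm $\psi\mapsto\|\psi\|_{L^p(\Omega)}+[\psi]_{W^{s,p}(\mathbb{R}^N)}$ (functions being extended by $0$ outside $\Omega$). *)

theory Defs
  imports "HOL-Analysis.Analysis"
begin

text \<open>
  Throughout, \<open>'a :: euclidean_space\<close> plays the role of $\mathbb{R}^N$ with \<open>N = DIM('a)\<close>.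
  Elements of Lebesgue and Sobolev spaces are functions rather than a.e.-classes; a function
  belongs to a space over \<open>E\<close> independently of its values outside \<open>E\<close>.
  Norms and seminorms are \<open>ennreal\<close>-valued, so that their finiteness is meaningful.
\<close>

definition ennreal_pow :: "ennreal \<Rightarrow> real \<Rightarrow> ennreal" where
  "ennreal_pow a r = (if a = \<infinity> then \<infinity> else ennreal (enn2real a powr r))"

definition Lp_norm :: "real \<Rightarrow> 'a::euclidean_space set \<Rightarrow> ('a \<Rightarrow> 'b::euclidean_space) \<Rightarrow> ennreal" where
  "Lp_norm q E \<psi> =
     ennreal_pow (\<integral>\<^sup>+ x. ennreal (norm (\<psi> x) powr q) \<partial>lebesgue_on E) (1 / q)"

definition Lp_space :: "real \<Rightarrow> 'a::euclidean_space set \<Rightarrow> ('a \<Rightarrow> 'b::euclidean_space) set" where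
  "Lp_space q E = {\<psi> \<in> borel_measurable (lebesgue_on E). Lp_norm q E \<psi> < \<infinity>}"

text \<open>
  The double integral is taken with respect to Lebesgue measure on the product space.
  On the null set \<open>x = y\<close> the integrand is \<open>0\<close> by the convention \<open>a / 0 = 0\<close>.
\<close>

definition gagliardo :: "real \<Rightarrow> real \<Rightarrow> 'a::euclidean_space set \<Rightarrow> ('a \<Rightarrow> 'b::euclidean_space) \<Rightarrow> ennreal" where
  "gagliardo \<alpha> q E \<psi> =
     ennreal_pow
       (\<integral>\<^sup>+ (x, y). ennreal (norm (\<psi> x - \<psi> y) powr q / norm (x - y) powr (real DIM('a) + \<alpha> * q))
          \<partial>lebesgue_on (E \<times> E)) (1 / q)"

definition frac_sobolev :: "real \<Rightarrow> real \<Rightarrow> 'a::euclidean_space set \<Rightarrow> ('a \<Rightarrow> 'b::euclidean_space) set" where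
  "frac_sobolev \<alpha> q E = {\<psi> \<in> Lp_space q E. gagliardo \<alpha> q E \<psi> < \<infinity>}"

text \<open>
  \<open>loc_space X \<Omega>\<close> is the local version on \<open>\<Omega>\<close> of a family \<open>X\<close> of function spaces: membership
  in \<open>X E\<close> for every open \<open>E\<close> compactly contained in \<open>\<Omega>\<close>.
\<close>

definition loc_space :: "('a::euclidean_space set \<Rightarrow> ('a \<Rightarrow> 'b) set) \<Rightarrow> 'a set \<Rightarrow> ('a \<Rightarrow> 'b) set" where
  "loc_space X \<Omega> = {\<psi>. \<forall>E. open E \<and> compact (closure E) \<and> closure E \<subseteq> \<Omega> \<longrightarrow> \<psi> \<in> X E}"

primrec Ck :: "nat \<Rightarrow> ('a::euclidean_space \<Rightarrow> real) \<Rightarrow> bool" where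
  "Ck 0 f \<longleftrightarrow> continuous_on UNIV f"
| "Ck (Suc k) f \<longleftrightarrow>
     (\<forall>x. f differentiable (at x)) \<and> (\<forall>v. Ck k (\<lambda>x. frechet_derivative f (at x) v))"

text \<open>The space $C_0^\infty(\Omega)$, its elements being extended by \<open>0\<close> to the whole space.\<close>

definition test_functions :: "'a::euclidean_space set \<Rightarrow> ('a \<Rightarrow> real) set" where
  "test_functions \<Omega> =
     {\<phi>. (\<forall>k. Ck k \<phi>) \<and> (\<exists>S. compact S \<and> S \<subseteq> \<Omega> \<and> (\<forall>x. x \<notin> S \<longrightarrow> \<phi> x = 0))}"

text \<open>
  The completion of $C_0^\infty(\Omega)$ with respect to
  $\|\cdot\|_{L^p(\Omega)} + [\cdot]_{W^{s,p}(\mathbb{R}^N)}$, realised as a space of functions on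
  the whole space vanishing outside \<open>\<Omega>\<close>. This is legitimate since a Cauchy sequence of test
  functions converges in $L^p$, its limit is a limit for the full norm by Fatou's lemma, and hence
  is zero only if the sequence tends to zero in the full norm.
\<close>

definition frac_sobolev0 :: "real \<Rightarrow> real \<Rightarrow> 'a::euclidean_space set \<Rightarrow> ('a \<Rightarrow> real) set" where
  "frac_sobolev0 s p \<Omega> =
     {\<phi> \<in> borel_measurable lebesgue.
        (AE x in lebesgue. x \<notin> \<Omega> \<longrightarrow> \<phi> x = 0) \<and>
        (\<exists>\<phi>n. (\<forall>n::nat. \<phi>n n \<in> test_functions \<Omega>) \<and>
           (\<lambda>n. Lp_norm p \<Omega> (\<lambda>x. \<phi>n n x - \<phi> x) + gagliardo s p UNIV (\<lambda>x. \<phi>n n x - \<phi> x))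
             \<longlonglongrightarrow> 0)}"

text \<open>\<open>G\<close> is the distributional gradient \<open>\<nabla>u\<close> of \<open>u\<close> in the open set \<open>\<Omega>\<close>.\<close>

definition weak_gradient :: "'a::euclidean_space set \<Rightarrow> ('a \<Rightarrow> real) \<Rightarrow> ('a \<Rightarrow> 'a) \<Rightarrow> bool" where
  "weak_gradient \<Omega> u G \<longleftrightarrow>
     u \<in> loc_space (Lp_space 1) \<Omega> \<and> G \<in> loc_space (Lp_space 1) \<Omega> \<and>
     (\<forall>\<phi>\<in>test_functions \<Omega>. \<forall>i\<in>Basis.
        (LINT x|lebesgue_on \<Omega>. u x * frechet_derivative \<phi> (at x) i) =
        - (LINT x|lebesgue_on \<Omega>. (G x \<bullet> i) * \<phi> x))"

definition sobolev1 :: "real \<Rightarrow> 'a::euclidean_space set \<Rightarrow> ('a \<Rightarrow> real) set" where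
  "sobolev1 q E = {u \<in> Lp_space q E. \<exists>G \<in> Lp_space q E. weak_gradient E u G}"

text \<open>
  Weak solutions \<open>u\<close> of the Dirichlet problem $(-\Delta_{p,K})^s u = f$ in \<open>\<Omega>\<close>, \<open>u = g\<close> in the
  complement of \<open>\<Omega>\<close>, where \<open>s\<close> enters through the space of admissible \<open>\<phi>\<close>.
\<close>

definition dirichlet_solution ::
  "real \<Rightarrow> real \<Rightarrow> ('a::euclidean_space \<Rightarrow> real) \<Rightarrow> 'a set \<Rightarrow> ('a \<Rightarrow> real) \<Rightarrow> ('a \<Rightarrow> real) \<Rightarrow> ('a \<Rightarrow> real) \<Rightarrow> bool"
where
  "dirichlet_solution s p K \<Omega> f g u \<longleftrightarrow>
     u \<in> frac_sobolev s p UNIV \<and>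
     (AE x in lebesgue. x \<notin> \<Omega> \<longrightarrow> u x = g x) \<and>
     (\<forall>\<phi>\<in>frac_sobolev0 s p \<Omega>.
        (LINT (x, y)|lebesgue.
           \<bar>u x - u y\<bar> powr (p - 2) * (u x - u y) / K (x - y) * (\<phi> x - \<phi> y)) =
        (LINT x|lebesgue_on \<Omega>. f x * \<phi> x))"

end

theory Submission
  imports Defs
begin

text \<open>
  Write $\delta_h u(x)=u(x+h)-u(x)$ and suppose that $\|\delta_h u\|_{L^p}\le C|h|^t$ on compact
  subsets of $\Omega$; for $t=s$ this holds since $u\in W^{s,p}(\mathbb{R}^N)$. Testing the equation
  satisfied by $\delta_h u$ with $\eta^2\delta_h u$, for a cut-off $\eta$, bounds
  $[\delta_h u]_{W^{s,p}}^p$ locally by $C|h|^{s+t}$: the datum contributes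
  $\|\delta_h f\|_{L^{p'}}\|\delta_h u\|_{L^p}$, and in the commutator term one factor
  $\delta_h u$ is localised (size $|h|^t$) while the other one is only controlled globally (size $|h|^s$).
  Hence $\|\delta_k\delta_h u\|_{L^p}^p\le C|k|^{sp}|h|^{s+t}$, and Marchaud's inequality
  replaces $t$ by $s+\frac{s+t}{p}$ as long as this is below $1$. Iterating reaches every exponent below
  $\min(1,s\frac{p+1}{p-1})$. If $s>\frac{p-1}{p+1}$ and $t$ is close to $1$, the same
  mixed second differences have order larger than $1$, so that the dyadic difference quotients converge
  geometrically in $L^p$ to the gradient, which inherits the excess as regularity.
\<close>

section \<open>Real inequalities\<close>

text \<open>The obstacle is nonlocality. The test function has compact support, but in the
  commutator term x and y range over the whole space, and away from compact subsets of \<Omega>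
  nothing better than |h|^s is known for the difference of u. What helps is that \<eta> x - \<eta> y
  vanishes unless x or y lies in the support of \<eta>, so one factor always has size |h|^t. Young's
  inequality with exponents p/(p-2), p, p, after dividing the two factors by |h|^t and |h|^s, leaves
  quantities bounded independently of h, with |h|^(s+t) in front; the remaining factor, a power p-2
  of differences of u and of its translate, is controlled by the energy of u. A datum of fractional
  order s produces the same power of |h|, so it does not slow down the iteration.

  Regularity is measured by bounds on translations (the Nikol'skii scale), because this scale loses
  nothing from step to step; an arbitrarily small loss occurs once, at the end, on the way to
  fractional Sobolev spaces. All estimates are made for Borel representatives, so that Tonelli's
  theorem applies to functions of pairs.\<close>

lemma powr_split_sub1:
  assumes "0 \<le> (a::real)" "1 \<le> r"
  shows "a powr r = a * a powr (r - 1)"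
  using assms by (cases "a = 0") (auto simp: powr_diff)

text \<open>One factor of each power is kept and the rest is enlarged to (a + b)^(r-1), which then
  factors out.\<close>

lemma powr_superadditive:
  fixes a b r :: real
  assumes "0 \<le> a" "0 \<le> b" "1 \<le> r"
  shows "a powr r + b powr r \<le> (a + b) powr r"
proof -
  have "a powr r + b powr r = a * a powr (r - 1) + b * b powr (r - 1)"
    using assms by (simp add: powr_split_sub1)
  also have "\<dots> \<le> a * (a + b) powr (r - 1) + b * (a + b) powr (r - 1)"
    using assms by (intro add_mono mult_left_mono powr_mono2) auto
  also have "\<dots> = (a + b) * (a + b) powr (r - 1)"
    by (simp add: algebra_simps)
  also have "\<dots> = (a + b) powr r"
    using assms by (simp add: powr_split_sub1[of "a + b" r])
  finally show ?thesis .
qed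

lemma one_le_powr_neg:
  fixes l r :: real
  assumes "0 < l" "l < 1" "r \<le> 0"
  shows "1 \<le> l powr r"
proof -
  have "1 powr r \<le> l powr r"
    using assms by (intro powr_mono2') auto
  then show ?thesis by simp
qed

text \<open>Convexity at the combination of |a|/l and |b|/(1-l) with weights l and 1-l. Unlike the
  bound with constant 2^p, the coefficient of |a|^p tends to 1 as l tends to 1; both the absorption
  in Marchaud's inequality and the summation of geometric increments depend on this.\<close>

lemma powr_abs_add_weighted:
  fixes a b l p :: real
  assumes l: "0 < l" "l < 1" and p: "1 \<le> p"
  shows "\<bar>a + b\<bar> powr p \<le> l powr (1 - p) * \<bar>a\<bar> powr p + (1 - l) powr (1 - p) * \<bar>b\<bar> powr p"
proof -
  have le: "\<bar>a + b\<bar> powr p \<le> (\<bar>a\<bar> + \<bar>b\<bar>) powr p"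
    using p by (intro powr_mono2) auto
  \<comment> \<open>Convexity is used on the open half-line, so vanishing arguments are split off;
    there a coefficient of at least 1 suffices.\<close>
  consider "a = 0" | "b = 0" | "a \<noteq> 0" "b \<noteq> 0" by blast
  then have "(\<bar>a\<bar> + \<bar>b\<bar>) powr p \<le> l powr (1 - p) * \<bar>a\<bar> powr p + (1 - l) powr (1 - p) * \<bar>b\<bar> powr p"
  proof cases
    case 1
    have "1 \<le> (1 - l) powr (1 - p)" using l p by (intro one_le_powr_neg) auto
    then show ?thesis using 1 by (simp add: mult_le_cancel_right1)
  next
    case 2
    have "1 \<le> l powr (1 - p)" using l p by (intro one_le_powr_neg) auto
    then show ?thesis using 2 by (simp add: mult_le_cancel_right1)
  next
    case 3
    have conv: "convex_on {0<..} (\<lambda>x::real. x powr p)" using p by (rule powr_convex)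
    have "(l *\<^sub>R (\<bar>a\<bar> / l) + (1 - l) *\<^sub>R (\<bar>b\<bar> / (1 - l))) powr p
        \<le> l * (\<bar>a\<bar> / l) powr p + (1 - l) * (\<bar>b\<bar> / (1 - l)) powr p"
      using 3 l convex_onD[OF conv, of "1 - l" "\<bar>a\<bar> / l" "\<bar>b\<bar> / (1 - l)"] by simp
    then show ?thesis
      using l 3 by (simp add: powr_divide powr_diff)
  qed
  with le show ?thesis by simp
qed

lemma powr_abs_add_le:
  fixes a b p :: real
  assumes "0 \<le> p"
  shows "\<bar>a + b\<bar> powr p \<le> 2 powr p * (\<bar>a\<bar> powr p + \<bar>b\<bar> powr p)"
proof -
  have "\<bar>a + b\<bar> powr p \<le> (2 * max \<bar>a\<bar> \<bar>b\<bar>) powr p"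
    using assms by (intro powr_mono2) auto
  also have "\<dots> = 2 powr p * max \<bar>a\<bar> \<bar>b\<bar> powr p"
    by (simp add: powr_mult)
  also have "\<dots> \<le> 2 powr p * (\<bar>a\<bar> powr p + \<bar>b\<bar> powr p)"
    by (intro mult_left_mono) (auto simp: max_def)
  finally show ?thesis .
qed

lemma powr_abs_diff_le:
  fixes a b p :: real
  assumes "0 \<le> p"
  shows "\<bar>a - b\<bar> powr p \<le> 2 powr p * (\<bar>a\<bar> powr p + \<bar>b\<bar> powr p)"
  using powr_abs_add_le[OF assms, of a "- b"] by simp

text \<open>Young's inequality with exponents p/(p-2), p, p without its constants: the largest of
  the three numbers dominates each factor, and its powers multiply up to p.\<close>

lemma triple_product_le:
  fixes a b c p :: real
  assumes "0 \<le> a" "0 \<le> b" "0 \<le> c" "2 \<le> p"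
  shows "a powr (p - 2) * b * c \<le> a powr p + b powr p + c powr p"
proof -
  define m where "m = max a (max b c)"
  have m: "a \<le> m" "b \<le> m" "c \<le> m" "0 \<le> m" using assms by (auto simp: m_def)
  have "a powr (p - 2) * b * c \<le> m powr (p - 2) * m * m"
    using assms m by (intro mult_mono powr_mono2) auto
  also have "\<dots> = m powr p"
    using m(4) by (cases "m = 0") (auto simp: powr_diff power2_eq_square)
  also have "\<dots> \<le> a powr p + b powr p + c powr p"
    unfolding m_def max_def by auto
  finally show ?thesis .
qed

text \<open>Young's inequality without constants. The two regions are separated by the curve a =
  b^(p-1), on which both powers on the right agree; on each side one of the two summands
  suffices.\<close>

lemma product_le_conjugate:
  fixes a b p :: real
  assumes "0 \<le> a" "0 \<le> b" "1 < p"
  shows "a * b \<le> a powr (p / (p - 1)) + b powr p"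
proof (cases "a \<le> b powr (p - 1)")
  case True
  have "a * b \<le> b powr (p - 1) * b" using True assms by (intro mult_right_mono) auto
  also have "\<dots> = b powr p" using assms by (simp add: powr_split_sub1[of b p])
  finally show ?thesis by (simp add: add_increasing)
next
  case False
  have "b = (b powr (p - 1)) powr (1 / (p - 1))"
    using assms by (simp add: powr_powr)
  also have "\<dots> \<le> a powr (1 / (p - 1))"
    using False assms by (intro powr_mono2) auto
  finally have "a * b \<le> a * a powr (1 / (p - 1))" using assms by (intro mult_left_mono) auto
  also have "\<dots> = a powr (p / (p - 1))"
  proof -
    have "p / (p - 1) - 1 = 1 / (p - 1)" using assms by (simp add: field_simps)
    then show ?thesis using assms powr_split_sub1[of a "p / (p - 1)"] by (simp add: field_simps)
  qed
  finally show ?thesis by (simp add: add_increasing2)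
qed

text \<open>Above the threshold, v = d (v/d) is at most d (v/d)^p. With d free this is a substitute
  for Hoelder's inequality on sets of finite measure: d is fixed first, and smallness in L^p then
  becomes smallness in L^1.\<close>

lemma le_truncation:
  fixes v d p :: real
  assumes "0 \<le> v" "0 < d" "1 \<le> p"
  shows "v \<le> d + d powr (1 - p) * v powr p"
proof (cases "v \<le> d")
  case True
  then show ?thesis by (simp add: add_increasing2)
next
  case False
  have "1 \<le> (v / d) powr (p - 1)" using False assms by (intro ge_one_powr_ge_zero) auto
  then have "v \<le> v * (v / d) powr (p - 1)" using assms by (simp add: mult_le_cancel_left1)
  also have "\<dots> = (v * v powr (p - 1)) * (1 / d powr (p - 1))"
    using assms False by (simp add: powr_divide)
  also have "1 / d powr (p - 1) = d powr (1 - p)"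
    using powr_minus_divide[of d "p - 1"] by simp
  also have "v * v powr (p - 1) = v powr p"
    using assms powr_split_sub1[of v p] by simp
  also have "v powr p * d powr (1 - p) = d powr (1 - p) * v powr p" by simp
  finally show ?thesis using assms by simp
qed

section \<open>Quantitative monotonicity of a -> |a|^(p-2) a, the derivative of |a|^p / p\<close>

definition Jp :: "real \<Rightarrow> real \<Rightarrow> real" where
  "Jp p a = \<bar>a\<bar> powr (p - 2) * a"

lemma Jp_nonneg_eq: "0 \<le> a \<Longrightarrow> 2 \<le> p \<Longrightarrow> Jp p a = a powr (p - 1)"
  using powr_split_sub1[of a "p - 1"] by (simp add: Jp_def mult.commute)

lemma Jp_minus: "Jp p (- a) = - Jp p a"
  by (simp add: Jp_def)

lemma abs_Jp: "2 \<le> p \<Longrightarrow> \<bar>Jp p a\<bar> = \<bar>a\<bar> powr (p - 1)"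
  using Jp_nonneg_eq[of "\<bar>a\<bar>" p] by (simp add: Jp_def abs_mult)

lemma measurable_Jp [measurable]: "Jp p \<in> borel_measurable borel"
  unfolding Jp_def[abs_def] by measurable

text \<open>The order conditions pick the configuration in which A is positive and has the larger
  modulus. The first bound is superadditivity of powers if B is nonnegative, and A \<ge> (A - B)/2
  if B is negative. The second is the mean value theorem for positive B and superadditivity for
  negative B.\<close>

lemma Jp_slope_pos:
  fixes A B p :: real
  assumes p: "2 \<le> p" and AB: "B < A" "0 < A" "\<bar>B\<bar> \<le> A"
  shows "2 powr (1 - p) * (A - B) powr (p - 1) \<le> Jp p A - Jp p B"
    and "Jp p A - Jp p B \<le> (p - 1) * (\<bar>A\<bar> + \<bar>B\<bar>) powr (p - 2) * (A - B)"
proof -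
  have JA: "Jp p A = A powr (p - 1)" using AB p by (simp add: Jp_nonneg_eq)
  have "2 powr (1 - p) * (A - B) powr (p - 1) \<le> Jp p A - Jp p B \<and>
    Jp p A - Jp p B \<le> (p - 1) * (\<bar>A\<bar> + \<bar>B\<bar>) powr (p - 2) * (A - B)"
  proof (cases "0 \<le> B")
    case True
    have JB: "Jp p B = B powr (p - 1)" using True p by (simp add: Jp_nonneg_eq)
    have "(A - B) powr (p - 1) + B powr (p - 1) \<le> A powr (p - 1)"
      using powr_superadditive[of "A - B" B "p - 1"] True AB p by auto
    moreover have "2 powr (1 - p) \<le> 2 powr 0" using p by (intro powr_mono) auto
    then have "2 powr (1 - p) * (A - B) powr (p - 1) \<le> 1 * (A - B) powr (p - 1)"
      by (intro mult_right_mono) auto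
    ultimately have 1: "2 powr (1 - p) * (A - B) powr (p - 1) \<le> Jp p A - Jp p B"
      using JA JB by auto
    have "A powr (p - 1) - B powr (p - 1) \<le> (p - 1) * A powr (p - 2) * (A - B)"
    \<comment> \<open>The derivative of the power is taken at positive points only, hence the
      separate case.\<close>
    proof (cases "B = 0")
      case True
      show ?thesis
      proof -
        have "A powr (p - 1) = 1 * (A * A powr (p - 2))"
          using p AB powr_split_sub1[of A "p - 1"] by simp
        also have "\<dots> \<le> (p - 1) * (A * A powr (p - 2))"
          using p AB by (intro mult_right_mono) auto
        finally show ?thesis using True p by (simp add: mult_ac)
      qed
    next
      case False
      then have B: "0 < B" using True by simp
      have "\<And>x. \<lbrakk>B \<le> x; x \<le> A\<rbrakk> \<Longrightarrow> DERIV (\<lambda>x. x powr (p - 1)) x :> (p - 1) * x powr (p - 1 - 1)"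
        using B by (intro has_real_derivative_powr) auto
      from MVT2[OF AB(1) this] obtain z where z: "B < z" "z < A"
        "A powr (p - 1) - B powr (p - 1) = (A - B) * ((p - 1) * z powr (p - 1 - 1))"
        by auto
      have "z powr (p - 2) \<le> A powr (p - 2)" using z B p by (intro powr_mono2) auto
      then have "(A - B) * ((p - 1) * z powr (p - 2)) \<le> (A - B) * ((p - 1) * A powr (p - 2))"
        using AB p by (intro mult_left_mono) auto
      then show ?thesis using z by (simp add: algebra_simps)
    qed
    also have "\<dots> \<le> (p - 1) * (\<bar>A\<bar> + \<bar>B\<bar>) powr (p - 2) * (A - B)"
      using AB p by (intro mult_right_mono mult_left_mono powr_mono2) auto
    finally show ?thesis using 1 JA JB by simp
  next
    case False
    then have B: "B < 0" by simp
    have JB: "Jp p B = - ((- B) powr (p - 1))"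
      using Jp_nonneg_eq[of "- B" p] B p by (simp add: Jp_minus)
    have "((A - B) / 2) powr (p - 1) \<le> A powr (p - 1)"
      using AB B p by (intro powr_mono2) auto
    moreover have "((A - B) / 2) powr (p - 1) = 2 powr (1 - p) * (A - B) powr (p - 1)"
      using AB by (simp add: powr_divide powr_diff)
    ultimately have 1: "2 powr (1 - p) * (A - B) powr (p - 1) \<le> Jp p A - Jp p B"
      using JA JB by (simp add: add_increasing2)
    have "A powr (p - 1) + (- B) powr (p - 1) \<le> (A + - B) powr (p - 1)"
      using AB B p by (intro powr_superadditive) auto
    also have "\<dots> = 1 * (\<bar>A\<bar> + \<bar>B\<bar>) powr (p - 2) * (A - B)"
      using AB B p powr_split_sub1[of "A - B" "p - 1"] by simp
    also have "\<dots> \<le> (p - 1) * (\<bar>A\<bar> + \<bar>B\<bar>) powr (p - 2) * (A - B)"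
      using AB B p by (intro mult_right_mono) auto
    finally show ?thesis using 1 JA JB by simp
  qed
  then show "2 powr (1 - p) * (A - B) powr (p - 1) \<le> Jp p A - Jp p B"
    "Jp p A - Jp p B \<le> (p - 1) * (\<bar>A\<bar> + \<bar>B\<bar>) powr (p - 2) * (A - B)" by auto
qed

text \<open>M is the divided difference of \<open>Jp p\<close>. It turns the difference of two
  nonlinear equations into an expression linear in A - B with a nonnegative coefficient: the upper
  bound on M controls the commutator, and the lower bound is the coercivity for p \<ge> 2.\<close>

lemma Jp_slope:
  fixes A B p :: real
  assumes p: "2 \<le> p"
  obtains M where "0 \<le> M" "Jp p A - Jp p B = M * (A - B)"
    "M \<le> (p - 1) * (\<bar>A\<bar> + \<bar>B\<bar>) powr (p - 2)"
    "2 powr (1 - p) * \<bar>A - B\<bar> powr p \<le> M * (A - B)\<^sup>2"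
proof -
  have main: "\<exists>M\<ge>0. Jp p A - Jp p B = M * (A - B) \<and>
    M \<le> (p - 1) * (\<bar>A\<bar> + \<bar>B\<bar>) powr (p - 2) \<and>
    2 powr (1 - p) * \<bar>A - B\<bar> powr p \<le> M * (A - B)\<^sup>2"
    if ord: "B < A" "0 < A" "\<bar>B\<bar> \<le> A" for A B
  proof -
    define M where "M = (Jp p A - Jp p B) / (A - B)"
    have eq: "Jp p A - Jp p B = M * (A - B)" using ord by (simp add: M_def)
    note sl = Jp_slope_pos[OF p ord]
    have "0 \<le> 2 powr (1 - p) * (A - B) powr (p - 1)" by simp
    also note sl(1)
    finally have "0 \<le> M" using ord by (simp add: M_def)
    moreover have "M \<le> (p - 1) * (\<bar>A\<bar> + \<bar>B\<bar>) powr (p - 2)"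
      using sl(2) ord by (simp add: M_def divide_le_eq)
    moreover have "2 powr (1 - p) * \<bar>A - B\<bar> powr p \<le> M * (A - B)\<^sup>2"
    proof -
      have "2 powr (1 - p) * \<bar>A - B\<bar> powr p = (2 powr (1 - p) * (A - B) powr (p - 1)) * (A - B)"
        using ord p powr_split_sub1[of "A - B" p] by simp
      also have "\<dots> \<le> (M * (A - B)) * (A - B)"
        using ord sl(1) eq by (intro mult_right_mono) auto
      finally show ?thesis by (simp add: power2_eq_square)
    qed
    ultimately show ?thesis using eq by blast
  qed
  have "\<exists>M\<ge>0. Jp p A - Jp p B = M * (A - B) \<and>
    M \<le> (p - 1) * (\<bar>A\<bar> + \<bar>B\<bar>) powr (p - 2) \<and>
    2 powr (1 - p) * \<bar>A - B\<bar> powr p \<le> M * (A - B)\<^sup>2"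
  proof -
    \<comment> \<open>After exchanging A and B or changing both signs, the number of larger modulus
      is positive and comes first.\<close>
    consider "A = B" | "B < A" "0 < A" "\<bar>B\<bar> \<le> A" | "A < B" "0 < B" "\<bar>A\<bar> \<le> B"
      | "B < A" "B < 0" "\<bar>A\<bar> \<le> - B" | "A < B" "A < 0" "\<bar>B\<bar> \<le> - A"
      by linarith
    then show ?thesis
    proof cases
      case 1
      then show ?thesis using p by (intro exI[of _ 0]) auto
    next
      case 2
      then show ?thesis by (rule main)
    next
      case 3
      from main[OF this] show ?thesis
        by (auto simp: power2_commute abs_minus_commute algebra_simps)
    next
      case 4
      then have "- A < - B" "0 < - B" "\<bar>- A\<bar> \<le> - B" by auto
      from main[OF this] show ?thesis
        by (auto simp: Jp_minus power2_commute abs_minus_commute algebra_simps)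
    next
      case 5
      then have "- B < - A" "0 < - A" "\<bar>- B\<bar> \<le> - A" by auto
      from main[OF this] show ?thesis
        by (auto simp: Jp_minus power2_commute abs_minus_commute algebra_simps)
    qed
  qed
  then show ?thesis using that by blast
qed

text \<open>The identity $(a-b)(a\alpha^2-b\beta^2)=(a\alpha-b\beta)^2-ab(\alpha-\beta)^2$ lets the
  localised monotonicity estimate go through without absorbing any term.\<close>

lemma Jp_localised_monotone:
  fixes A B a b \<alpha> \<beta> p :: real
  assumes p: "2 \<le> p" and ab: "A - B = a - b"
  shows "(if \<alpha> = 1 \<and> \<beta> = 1 then 2 powr (1 - p) * \<bar>a - b\<bar> powr p else 0) \<le>
    (Jp p A - Jp p B) * (a * \<alpha>\<^sup>2 - b * \<beta>\<^sup>2)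
      + (p - 1) * (\<bar>A\<bar> + \<bar>B\<bar>) powr (p - 2) * \<bar>a\<bar> * \<bar>b\<bar> * (\<alpha> - \<beta>)\<^sup>2"
proof -
  obtain M where M: "0 \<le> M" "Jp p A - Jp p B = M * (A - B)"
    "M \<le> (p - 1) * (\<bar>A\<bar> + \<bar>B\<bar>) powr (p - 2)"
    "2 powr (1 - p) * \<bar>A - B\<bar> powr p \<le> M * (A - B)\<^sup>2"
    using Jp_slope[OF p] by blast
  have id: "(a - b) * (a * \<alpha>\<^sup>2 - b * \<beta>\<^sup>2) = (a * \<alpha> - b * \<beta>)\<^sup>2 - a * b * (\<alpha> - \<beta>)\<^sup>2"
    by (simp add: power2_eq_square algebra_simps)
  have "(Jp p A - Jp p B) * (a * \<alpha>\<^sup>2 - b * \<beta>\<^sup>2) = M * ((a - b) * (a * \<alpha>\<^sup>2 - b * \<beta>\<^sup>2))"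
    using M(2) ab by simp
  also have "\<dots> = M * (a * \<alpha> - b * \<beta>)\<^sup>2 - M * (a * b) * (\<alpha> - \<beta>)\<^sup>2"
    unfolding id by (simp add: algebra_simps)
  finally have 1: "(Jp p A - Jp p B) * (a * \<alpha>\<^sup>2 - b * \<beta>\<^sup>2) =
     M * (a * \<alpha> - b * \<beta>)\<^sup>2 - M * (a * b) * (\<alpha> - \<beta>)\<^sup>2" .
  have "M * (a * b) \<le> M * (\<bar>a\<bar> * \<bar>b\<bar>)"
    using M(1) by (intro mult_left_mono) (auto simp flip: abs_mult)
  also have "\<dots> \<le> ((p - 1) * (\<bar>A\<bar> + \<bar>B\<bar>) powr (p - 2)) * (\<bar>a\<bar> * \<bar>b\<bar>)"
    using M(3) by (intro mult_right_mono) auto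
  finally have "M * (a * b) * (\<alpha> - \<beta>)\<^sup>2 \<le>
    ((p - 1) * (\<bar>A\<bar> + \<bar>B\<bar>) powr (p - 2)) * (\<bar>a\<bar> * \<bar>b\<bar>) * (\<alpha> - \<beta>)\<^sup>2"
    by (intro mult_right_mono) auto
  \<comment> \<open>Where both cut-offs are 1 the square is that of A - B by \<open>ab\<close>;
    elsewhere it is only known to be nonnegative and is discarded.\<close>
  moreover have "(if \<alpha> = 1 \<and> \<beta> = 1 then 2 powr (1 - p) * \<bar>a - b\<bar> powr p else 0) \<le> M * (a * \<alpha> - b * \<beta>)\<^sup>2"
    using M(1,4) ab by auto
  ultimately show ?thesis
    unfolding 1 by (simp add: algebra_simps)
qed

section \<open>Radial integrals and translations\<close>

lemma nn_integral_lborel_translate: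
  fixes c :: "'a::euclidean_space"
  assumes [measurable]: "f \<in> borel_measurable borel"
  shows "(\<integral>\<^sup>+x. f (x + c) \<partial>lborel) = (\<integral>\<^sup>+x. f x \<partial>lborel)"
proof -
  have "(\<integral>\<^sup>+x. f x \<partial>lborel) = (\<integral>\<^sup>+x. f x \<partial>distr lborel borel ((+) c))"
    by (simp add: lborel_distr_plus)
  also have "\<dots> = (\<integral>\<^sup>+x. f (c + x) \<partial>lborel)"
    by (rule nn_integral_distr) auto
  finally show ?thesis by (simp add: add.commute)
qed

lemma nn_integral_lborel_reflect:
  fixes c :: "'a::euclidean_space"
  assumes [measurable]: "f \<in> borel_measurable borel"
  shows "(\<integral>\<^sup>+x. f (c - x) \<partial>lborel) = (\<integral>\<^sup>+x. f x \<partial>lborel)"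
proof -
  have "(\<integral>\<^sup>+x. f x \<partial>lborel) = (\<integral>\<^sup>+x. f x \<partial>density (distr lborel borel (\<lambda>x. c + (- 1) *\<^sub>R x)) (\<lambda>_. ennreal (\<bar>- 1\<bar>^DIM('a))))"
    by (subst lborel_affine[of "-1" c]) auto
  also have "\<dots> = (\<integral>\<^sup>+x. f x \<partial>distr lborel borel (\<lambda>x. c + (- 1) *\<^sub>R x))"
    by (subst nn_integral_density) auto
  also have "\<dots> = (\<integral>\<^sup>+x. f (c + (- 1) *\<^sub>R x) \<partial>lborel)"
    by (rule nn_integral_distr) auto
  finally show ?thesis by simp
qed

lemma integral_lborel_translate:
  fixes c :: "'a::euclidean_space" and f :: "'a \<Rightarrow> real"
  assumes [measurable]: "f \<in> borel_measurable borel"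
  shows "(LINT x|lborel. f (x + c)) = (LINT x|lborel. f x)"
proof -
  have "(LINT x|lborel. f x) = (LINT x|distr lborel borel ((+) c). f x)"
    by (simp add: lborel_distr_plus)
  also have "\<dots> = (LINT x|lborel. f (c + x))"
    by (rule integral_distr) auto
  finally show ?thesis by (simp add: add.commute)
qed

text \<open>On a dyadic shell every power is constant up to a factor that does not depend on the
  radius, whatever the sign of the exponent.\<close>

lemma powr_le_of_half_le:
  fixes t r b :: real
  assumes "0 < r" "r / 2 \<le> t" "t \<le> r"
  shows "t powr b \<le> 2 powr \<bar>b\<bar> * r powr b"
proof (cases "0 \<le> b")
  case True
  have "t powr b \<le> 1 * r powr b" using assms True by (auto intro!: powr_mono2)
  also have "\<dots> \<le> 2 powr \<bar>b\<bar> * r powr b"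
    by (intro mult_right_mono ge_one_powr_ge_zero) auto
  finally show ?thesis .
next
  case False
  have "t powr b \<le> (r / 2) powr b" using assms False by (intro powr_mono2') auto
  also have "\<dots> = 2 powr \<bar>b\<bar> * r powr b"
    using assms False by (simp add: powr_divide powr_minus_divide)
  finally show ?thesis .
qed

text \<open>Dyadic shells replace polar coordinates: on the shell of outer radius \<open>r k\<close>
  the integrand is comparable to the power b of that radius, the enclosing ball has volume of order
  its N-th power, and the products are summable. The shells only have to cover S; they may
  overlap.\<close>

lemma radial_integral_finite_aux:
  fixes S :: "'a::euclidean_space set" and r :: "nat \<Rightarrow> real"
  assumes r: "\<And>k. 0 < r k"
    and cover: "\<And>z. z \<in> S \<Longrightarrow> z \<noteq> 0 \<Longrightarrow> \<exists>k. r k / 2 \<le> norm z \<and> norm z < r k"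
    and summ: "summable (\<lambda>k. r k powr (b + real DIM('a)))"
  shows "(\<integral>\<^sup>+z. indicator S z * ennreal (norm z powr b) \<partial>lborel) < \<infinity>"
proof -
  define c where "c = 2 powr \<bar>b\<bar> * unit_ball_vol (real DIM('a))"
  have "(\<integral>\<^sup>+z. indicator S z * ennreal (norm z powr b) \<partial>lborel) \<le>
      (\<integral>\<^sup>+z. (\<Sum>k. ennreal (2 powr \<bar>b\<bar> * r k powr b) * indicator (ball (0::'a) (r k)) z) \<partial>lborel)"
  proof (rule nn_integral_mono)
    fix z :: 'a
    show "indicator S z * ennreal (norm z powr b) \<le>
      (\<Sum>k. ennreal (2 powr \<bar>b\<bar> * r k powr b) * indicator (ball (0::'a) (r k)) z)"
    \<comment> \<open>The origin needs no shell: \<open>0 powr b\<close> is 0, also for negative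
      b.\<close>
    proof (cases "z \<in> S \<and> z \<noteq> 0")
      case True
      then obtain k where k: "r k / 2 \<le> norm z" "norm z < r k" using cover by blast
      have "indicator S z * ennreal (norm z powr b) \<le>
          ennreal (2 powr \<bar>b\<bar> * r k powr b) * indicator (ball (0::'a) (r k)) z"
        using True k powr_le_of_half_le[OF r k(1)] by (auto intro!: ennreal_leI)
      also have "\<dots> \<le> (\<Sum>k. ennreal (2 powr \<bar>b\<bar> * r k powr b) * indicator (ball (0::'a) (r k)) z)"
      proof -
        have "F k \<le> (\<Sum>k. F k)" for F :: "nat \<Rightarrow> ennreal"
          using sum_le_suminf[of F "{k}"] by simp
        then show ?thesis .
      qed
      finally show ?thesis .
    qed (auto simp: indicator_def)
  qed
  also have "\<dots> = (\<Sum>k. \<integral>\<^sup>+z. ennreal (2 powr \<bar>b\<bar> * r k powr b) * indicator (ball (0::'a) (r k)) z \<partial>lborel)"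
    by (intro nn_integral_suminf borel_measurable_times_ennreal borel_measurable_const borel_measurable_indicator) simp
  also have "\<dots> = (\<Sum>k. ennreal (c * r k powr (b + real DIM('a))))"
  proof (rule suminf_cong)
    fix k
    have "(\<integral>\<^sup>+z. ennreal (2 powr \<bar>b\<bar> * r k powr b) * indicator (ball (0::'a) (r k)) z \<partial>lborel) =
       ennreal (2 powr \<bar>b\<bar> * r k powr b) * ennreal (unit_ball_vol (real DIM('a)) * r k ^ DIM('a))"
      using r[of k] by (simp add: nn_integral_cmult_indicator emeasure_ball)
    also have "\<dots> = ennreal (c * r k powr (b + real DIM('a)))"
      using r[of k] by (simp add: c_def ennreal_mult' [symmetric] powr_add powr_realpow mult_ac)
    finally show "(\<integral>\<^sup>+z. ennreal (2 powr \<bar>b\<bar> * r k powr b) * indicator (ball (0::'a) (r k)) z \<partial>lborel) =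
      ennreal (c * r k powr (b + real DIM('a)))" .
  qed
  also have "\<dots> = ennreal (\<Sum>k. c * r k powr (b + real DIM('a)))"
    using summ by (intro suminf_ennreal2) (auto simp: c_def)
  also have "\<dots> < \<infinity>" by simp
  finally show ?thesis .
qed

lemma summable_powr_geometric:
  fixes e :: real
  assumes "e < 0" "0 < R"
  shows "summable (\<lambda>k::nat. (R * 2 ^ k) powr e)"
proof -
  have "(R * 2 ^ k) powr e = R powr e * (2 powr e) ^ k" for k :: nat
  proof -
    have "(2 ^ k) powr e = (2 powr e) ^ k"
      by (simp add: powr_powr powr_realpow[symmetric] mult.commute)
    then show ?thesis using assms by (simp add: powr_mult)
  qed
  moreover have "norm ((2::real) powr e) < 1" using assms powr_less_mono[of e 0 2] by simp
  ultimately show ?thesis by (simp add: summable_geometric)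
qed

text \<open>k is one less than the first n with R / 2^n \<le> t, and that n is positive because t <
  R. Besides covering a punctured ball by shells, this later selects a quotient step comparable to a
  given increment.\<close>

lemma dyadic_scale:
  fixes t R :: real
  assumes t: "0 < t" "t < R"
  obtains k where "R / 2 ^ Suc k \<le> t" "t < R / 2 ^ k"
proof -
  have R: "0 < R" using t by simp
  obtain n where "(1 / 2) ^ n < t / R"
    using t R real_arch_pow_inv[of "t / R" "1 / 2"] by auto
  then have ex: "\<exists>n. R / 2 ^ n \<le> t" using R by (intro exI[of _ n]) (auto simp: field_simps)
  define n where "n = (LEAST n. R / 2 ^ n \<le> t)"
  have n: "R / 2 ^ n \<le> t" using LeastI_ex[OF ex] by (simp add: n_def)
  then obtain k where k: "n = Suc k" using t by (cases n) auto
  have "\<not> R / 2 ^ k \<le> t" using not_less_Least[of k "\<lambda>n. R / 2 ^ n \<le> t"] k by (auto simp: n_def)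
  then show ?thesis using n k that[of k] by simp
qed

lemma radial_integral_near_finite:
  fixes a R :: real
  assumes a: "0 < a" and R: "0 < R"
  shows "(\<integral>\<^sup>+z. indicator (ball (0::'a::euclidean_space) R) z * ennreal (norm z powr (a - real DIM('a))) \<partial>lborel) < \<infinity>"
proof (rule radial_integral_finite_aux[of "\<lambda>k. R / 2 ^ k"])
  fix z :: 'a assume z: "z \<in> ball 0 R" "z \<noteq> 0"
  then have "0 < norm z" "norm z < R" by auto
  then obtain k where "R / 2 ^ Suc k \<le> norm z" "norm z < R / 2 ^ k" by (rule dyadic_scale)
  then show "\<exists>k. R / 2 ^ k / 2 \<le> norm z \<and> norm z < R / 2 ^ k"
    by (intro exI[of _ k]) (auto simp: field_simps)
next
  \<comment> \<open>The shrinking radii are rewritten through growing ones, so that the same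
    geometric series serves near 0 and near infinity.\<close>
  have "(R / 2 ^ k) powr (a - real DIM('a) + real DIM('a)) = R powr a * R powr a * (R * 2 ^ k) powr (- a)" for k :: nat
    using R by (simp add: powr_divide powr_mult powr_minus field_simps)
  then show "summable (\<lambda>k. (R / 2 ^ k) powr (a - real DIM('a) + real DIM('a)))"
    using summable_powr_geometric[of "- a" R] a R by (simp add: summable_mult)
qed (use R in auto)

lemma radial_integral_far_finite:
  fixes a R :: real
  assumes a: "0 < a" and R: "0 < R"
  shows "(\<integral>\<^sup>+z. indicator (- ball (0::'a::euclidean_space) R) z * ennreal (norm z powr (- a - real DIM('a))) \<partial>lborel) < \<infinity>"
proof (rule radial_integral_finite_aux[of "\<lambda>k. 2 * R * 2 ^ k"])
  fix z :: 'a assume z: "z \<in> - ball 0 R" "z \<noteq> 0"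
  have ex: "\<exists>n. norm z < R * 2 ^ n"
  proof -
    obtain n where "norm z / R < 2 ^ n" using real_arch_pow[of 2 "norm z / R"] by auto
    then show ?thesis using R by (intro exI[of _ n]) (auto simp: field_simps)
  qed
  define n where "n = (LEAST n. norm z < R * 2 ^ n)"
  have n: "norm z < R * 2 ^ n" using LeastI_ex[OF ex] by (simp add: n_def)
  have "n \<noteq> 0" using n z by (cases n) auto
  then obtain k where k: "n = Suc k" by (cases n) auto
  have "\<not> norm z < R * 2 ^ k" using not_less_Least[of k "\<lambda>n. norm z < R * 2 ^ n"] k by (auto simp: n_def)
  then show "\<exists>k. 2 * R * 2 ^ k / 2 \<le> norm z \<and> norm z < 2 * R * 2 ^ k"
    using n k by (intro exI[of _ k]) (auto simp: field_simps)
next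
  show "summable (\<lambda>k. (2 * R * 2 ^ k) powr (- a - real DIM('a) + real DIM('a)))"
    using summable_powr_geometric[of "- a" "2 * R"] a R by simp
qed (use R in auto)

text \<open>
  The \<open>q\<close>-th powers of the (semi)norms of \<open>Defs\<close>, restricted to Borel functions so that Tonelli's
  theorem applies.
\<close>

definition gagliardo_int :: "real \<Rightarrow> real \<Rightarrow> 'a::euclidean_space set \<Rightarrow> ('a \<Rightarrow> real) \<Rightarrow> ennreal" where
  "gagliardo_int s q E w = (\<integral>\<^sup>+x. \<integral>\<^sup>+y. indicator E x * indicator E y *
     ennreal (\<bar>w x - w y\<bar> powr q / norm (x - y) powr (real DIM('a) + s * q)) \<partial>lborel \<partial>lborel)"

definition translation_int :: "real \<Rightarrow> 'a::euclidean_space set \<Rightarrow> ('a \<Rightarrow> real) \<Rightarrow> 'a \<Rightarrow> ennreal" where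
  "translation_int q C w h = (\<integral>\<^sup>+x. indicator C x * ennreal (\<bar>w (x + h) - w x\<bar> powr q) \<partial>lborel)"

definition Lp_int :: "real \<Rightarrow> 'a::euclidean_space set \<Rightarrow> ('a \<Rightarrow> real) \<Rightarrow> ennreal" where
  "Lp_int q C w = (\<integral>\<^sup>+x. indicator C x * ennreal (\<bar>w x\<bar> powr q) \<partial>lborel)"

section \<open>Translations controlled by the Gagliardo seminorm\<close>

lemma powr_le_diff_quotient:
  fixes x z :: "'a::euclidean_space" and w :: "'a \<Rightarrow> real"
  assumes "norm (x - z) \<le> D" "0 \<le> e"
  shows "\<bar>w x - w z\<bar> powr q \<le> D powr e * (\<bar>w x - w z\<bar> powr q / norm (x - z) powr e)"
proof (cases "x = z")
  case False
  have "norm (x - z) powr e \<le> D powr e" using assms by (intro powr_mono2) auto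
  then have "\<bar>w x - w z\<bar> powr q * norm (x - z) powr e \<le> \<bar>w x - w z\<bar> powr q * D powr e"
    by (intro mult_left_mono) auto
  then show ?thesis using False by (simp add: field_simps)
qed simp

text \<open>The factors record the proof of \<open>translation_int_le_gagliardo_int\<close>: 2 for
  the two integrals over the intermediate point, 2^q for splitting the difference, 2^(N + s q)
  because all distances are at most 2|k|, and the volume of the unit ball from averaging. The
  \<open>itself\<close> argument carries the dimension.\<close>

definition translation_const :: "'a::euclidean_space itself \<Rightarrow> real \<Rightarrow> real \<Rightarrow> real" where
  "translation_const _ s q = 2 * (2 powr q * 2 powr (real DIM('a) + s * q)) / unit_ball_vol (real DIM('a))"

lemma translation_const_pos: "0 < translation_const TYPE('a::euclidean_space) s q"
  by (simp add: translation_const_def)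

text \<open>The difference is split at an intermediate point z and averaged over z in the ball of
  radius |k| around x. Both x and x + k are within 2|k| of z, so the singular weight can be inserted
  at the cost |k|^(N + s q); dividing by a volume of order |k|^N leaves |k|^(s q). Only the
  |k|-neighbourhood of C enters, which makes the estimate local.\<close>

lemma translation_int_le_gagliardo_int:
  fixes w :: "'a::euclidean_space \<Rightarrow> real" and C E :: "'a set"
  assumes [measurable]: "w \<in> borel_measurable borel" "C \<in> sets borel" "E \<in> sets borel"
    and s: "0 \<le> s" and q: "0 \<le> q"
    and CE: "\<And>x v. x \<in> C \<Longrightarrow> norm v \<le> norm k \<Longrightarrow> x + v \<in> E"
  shows "translation_int q C w k \<le> ennreal (translation_const TYPE('a) s q * norm k powr (s * q)) * gagliardo_int s q E w"
proof (cases "k = 0")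
  case True
  then show ?thesis by (simp add: translation_int_def)
next
  case False
  define e where "e = real DIM('a) + s * q"
  have e: "0 \<le> e" using s q by (simp add: e_def)
  define r where "r = norm k"
  have r: "0 < r" using False by (simp add: r_def)
  define g where "g x z = ennreal (\<bar>w x - w z\<bar> powr q / norm (x - z) powr e)" for x z
  have [measurable]: "case_prod g \<in> borel_measurable (borel \<Otimes>\<^sub>M borel)"
    unfolding g_def[abs_def] by measurable
  define V where "V = unit_ball_vol (real DIM('a)) * r ^ DIM('a)"
  have V: "0 < V" using r by (simp add: V_def)
  define c where "c = 2 powr q * (2 * r) powr e"
  have c: "0 \<le> c" by (simp add: c_def)
  have pt: "ennreal V * (indicator C x * ennreal (\<bar>w (x + k) - w x\<bar> powr q)) \<le>
     ennreal c * (\<integral>\<^sup>+z. indicator E (x + k) * indicator E z * g (x + k) z + indicator E x * indicator E z * g x z \<partial>lborel)" for x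
  proof (cases "x \<in> C")
    case True
    have xE: "x \<in> E" "x + k \<in> E" using CE[OF True, of 0] CE[OF True, of k] by auto
    have "ennreal V * (indicator C x * ennreal (\<bar>w (x + k) - w x\<bar> powr q)) =
        (\<integral>\<^sup>+z. ennreal (\<bar>w (x + k) - w x\<bar> powr q) * indicator (ball x r) z \<partial>lborel)"
      using True r by (subst mult.commute) (simp add: nn_integral_cmult_indicator emeasure_ball V_def)
    also have "\<dots> \<le> (\<integral>\<^sup>+z. ennreal c * (indicator E (x + k) * indicator E z * g (x + k) z + indicator E x * indicator E z * g x z) \<partial>lborel)"
    proof (rule nn_integral_mono)
      fix z
      show "ennreal (\<bar>w (x + k) - w x\<bar> powr q) * indicator (ball x r) z \<le>
        ennreal c * (indicator E (x + k) * indicator E z * g (x + k) z + indicator E x * indicator E z * g x z)"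
      proof (cases "z \<in> ball x r")
        case z: True
        have zE: "z \<in> E"
          using CE[OF True, of "z - x"] z by (auto simp: r_def dist_norm norm_minus_commute)
        have n1: "norm (x - z) \<le> 2 * r" using z r by (auto simp: dist_norm)
        have "norm (x + k - z) \<le> norm k + norm (x - z)"
          using norm_triangle_ineq[of k "x - z"] by (simp add: algebra_simps)
        then have n2: "norm (x + k - z) \<le> 2 * r" using z by (auto simp: dist_norm r_def)
        have "\<bar>w (x + k) - w x\<bar> powr q = \<bar>(w (x + k) - w z) - (w x - w z)\<bar> powr q" by simp
        also have "\<dots> \<le> 2 powr q * (\<bar>w (x + k) - w z\<bar> powr q + \<bar>w x - w z\<bar> powr q)"
          by (rule powr_abs_diff_le[OF q])
        also have "\<dots> \<le> 2 powr q * ((2 * r) powr e * (\<bar>w (x + k) - w z\<bar> powr q / norm (x + k - z) powr e)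
            + (2 * r) powr e * (\<bar>w x - w z\<bar> powr q / norm (x - z) powr e))"
          by (intro mult_left_mono add_mono powr_le_diff_quotient n1 n2 e) auto
        also have "\<dots> = c * (\<bar>w (x + k) - w z\<bar> powr q / norm (x + k - z) powr e
            + \<bar>w x - w z\<bar> powr q / norm (x - z) powr e)"
          by (simp add: c_def algebra_simps)
        finally have "ennreal (\<bar>w (x + k) - w x\<bar> powr q) \<le> ennreal (c * (\<bar>w (x + k) - w z\<bar> powr q / norm (x + k - z) powr e
            + \<bar>w x - w z\<bar> powr q / norm (x - z) powr e))"
          by (rule ennreal_leI)
        also have "\<dots> = ennreal c * (g (x + k) z + g x z)"
          using c by (simp add: g_def ennreal_mult' ennreal_plus[symmetric] del: ennreal_plus)
        finally show ?thesis using xE zE z by simp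
      qed simp
    qed
    also have "\<dots> = ennreal c * (\<integral>\<^sup>+z. (indicator E (x + k) * indicator E z * g (x + k) z + indicator E x * indicator E z * g x z) \<partial>lborel)"
      by (rule nn_integral_cmult) measurable
    finally show ?thesis .
  qed simp
  define G where "G x = (\<integral>\<^sup>+z. indicator E x * indicator E z * g x z \<partial>lborel)" for x
  have [measurable]: "G \<in> borel_measurable borel"
    unfolding G_def[abs_def] by measurable
  have gagG: "(\<integral>\<^sup>+x. G x \<partial>lborel) = gagliardo_int s q E w"
    by (simp add: gagliardo_int_def G_def g_def e_def)
  have "ennreal V * translation_int q C w k = (\<integral>\<^sup>+x. ennreal V * (indicator C x * ennreal (\<bar>w (x + k) - w x\<bar> powr q)) \<partial>lborel)"
    unfolding translation_int_def by (rule nn_integral_cmult[symmetric]) measurable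
  also have "\<dots> \<le> (\<integral>\<^sup>+x. ennreal c * (G (x + k) + G x) \<partial>lborel)"
  proof (rule nn_integral_mono)
    fix x
    have "(\<integral>\<^sup>+z. indicator E (x + k) * indicator E z * g (x + k) z + indicator E x * indicator E z * g x z \<partial>lborel) = G (x + k) + G x"
      unfolding G_def by (rule nn_integral_add) measurable
    then show "ennreal V * (indicator C x * ennreal (\<bar>w (x + k) - w x\<bar> powr q)) \<le> ennreal c * (G (x + k) + G x)"
      using pt[of x] by simp
  qed
  also have "\<dots> = ennreal c * ((\<integral>\<^sup>+x. G (x + k) \<partial>lborel) + (\<integral>\<^sup>+x. G x \<partial>lborel))"
    by (simp add: nn_integral_cmult nn_integral_add)
  also have "\<dots> = ennreal c * (2 * gagliardo_int s q E w)"
    by (simp add: nn_integral_lborel_translate gagG mult_2)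
  finally have "ennreal V * translation_int q C w k \<le> ennreal (2 * c) * gagliardo_int s q E w"
    using c by (simp add: ennreal_mult' mult_ac)
  then have "ennreal (1 / V) * (ennreal V * translation_int q C w k) \<le> ennreal (1 / V) * (ennreal (2 * c) * gagliardo_int s q E w)"
    by (intro mult_left_mono) auto
  also have "ennreal (1 / V) * (ennreal V * translation_int q C w k) = translation_int q C w k"
    using V by (simp add: mult.assoc[symmetric] ennreal_mult'[symmetric])
  also have "ennreal (1 / V) * (ennreal (2 * c) * gagliardo_int s q E w) = ennreal (translation_const TYPE('a) s q * norm k powr (s * q)) * gagliardo_int s q E w"
  proof -
    have "r powr e = r ^ DIM('a) * r powr (s * q)"
      using r by (simp add: e_def powr_add powr_realpow)
    moreover have "translation_const TYPE('a) s q = 2 * (2 powr q * 2 powr e) / unit_ball_vol (real DIM('a))"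
      by (simp add: translation_const_def e_def)
    ultimately have "(1 / V) * (2 * c) = translation_const TYPE('a) s q * norm k powr (s * q)"
      using r by (simp add: V_def c_def powr_mult r_def[symmetric] field_simps)
    then show ?thesis using V c by (simp add: mult.assoc[symmetric] ennreal_mult'[symmetric])
  qed
  finally show ?thesis .
qed

section \<open>Continuity of translations\<close>

text \<open>On a ball exceeding the support by 1, compactness applies. If two points at distance
  below 1 are not both in that ball, neither of them is in the support.\<close>

lemma compact_support_uniformly_continuous:
  fixes f :: "'a::euclidean_space \<Rightarrow> real"
  assumes f: "continuous_on UNIV f" and S: "compact S" "\<And>x. x \<notin> S \<Longrightarrow> f x = 0"
  shows "uniformly_continuous_on UNIV f"
proof -
  obtain R where R: "0 < R" "S \<subseteq> ball 0 R"
    using bounded_subset_ballD[OF compact_imp_bounded[OF S(1)]] by blast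
  have "uniformly_continuous_on (cball 0 (R + 1)) f"
    using f by (intro compact_uniformly_continuous continuous_on_subset[OF f]) auto
  show ?thesis
    unfolding uniformly_continuous_on_def
  proof (intro allI impI)
    fix e :: real assume "0 < e"
    then obtain d where d: "0 < d"
      "\<And>x y. x \<in> cball 0 (R + 1) \<Longrightarrow> y \<in> cball 0 (R + 1) \<Longrightarrow> dist y x < d \<Longrightarrow> dist (f y) (f x) < e"
      using \<open>uniformly_continuous_on (cball 0 (R + 1)) f\<close> unfolding uniformly_continuous_on_def by metis
    show "\<exists>d>0. \<forall>x\<in>UNIV. \<forall>x'\<in>UNIV. dist x' x < d \<longrightarrow> dist (f x') (f x) < e"
    proof (intro exI[of _ "min d 1"] conjI ballI impI)
      fix x y :: 'a assume xy: "dist y x < min d 1"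
      show "dist (f y) (f x) < e"
      proof (cases "x \<in> cball 0 (R + 1) \<and> y \<in> cball 0 (R + 1)")
        case True
        then show ?thesis using d xy by auto
      next
        case False
        have "norm y \<le> norm x + dist y x" "norm x \<le> norm y + dist y x"
          by norm+
        with False xy have "R \<le> norm x" "R \<le> norm y" by auto
        then have "x \<notin> S" "y \<notin> S" using R by auto
        then show ?thesis using S(2) \<open>0 < e\<close> by simp
      qed
    qed (use d in auto)
  qed
qed

lemma compact_neighbourhood:
  fixes C \<Omega> :: "'a::euclidean_space set"
  assumes C: "compact C" "C \<subseteq> \<Omega>" and \<Omega>: "open \<Omega>"
  obtains d D where "0 < d" "compact D" "D \<subseteq> \<Omega>" "\<And>x v. x \<in> C \<Longrightarrow> norm v \<le> d \<Longrightarrow> x + v \<in> D"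
proof -
  obtain d where d: "0 < d" "(\<Union>x\<in>C. cball x d) \<subseteq> \<Omega>"
    using compact_subset_open_imp_cball_epsilon_subset[OF C(1) \<Omega> C(2)] by blast
  define D where "D = {x + y | x y. x \<in> C \<and> y \<in> cball 0 d}"
  show ?thesis
  proof
    show "compact D" unfolding D_def by (intro compact_sums C(1) compact_cball)
    have "D \<subseteq> (\<Union>x\<in>C. cball x d)" unfolding D_def by (auto simp: dist_norm)
    then show "D \<subseteq> \<Omega>" using d(2) by simp
    show "x + v \<in> D" if "x \<in> C" "norm v \<le> d" for x v
      unfolding D_def using that by (intro CollectI exI[of _ x] exI[of _ v]) auto
  qed (rule d)
qed

lemma emeasure_lborel_ball_less_top: "emeasure lborel (ball c r :: 'a::euclidean_space set) < \<infinity>"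
  using emeasure_lborel_ball_finite[of c r] by (simp add: less_top)

section \<open>Sums, multiples and translates in L^p\<close>

lemma Lp_int_add_le:
  assumes [measurable]: "f \<in> borel_measurable borel" "g \<in> borel_measurable borel" "C \<in> sets borel"
    and "0 \<le> p"
  shows "Lp_int p C (\<lambda>x. f x + g x) \<le> ennreal (2 powr p) * (Lp_int p C f + Lp_int p C g)"
proof -
  have "Lp_int p C (\<lambda>x. f x + g x) \<le>
    (\<integral>\<^sup>+x. ennreal (2 powr p) * (indicator C x * ennreal (\<bar>f x\<bar> powr p) + indicator C x * ennreal (\<bar>g x\<bar> powr p)) \<partial>lborel)"
    unfolding Lp_int_def
  proof (rule nn_integral_mono)
    fix x
    have "ennreal (\<bar>f x + g x\<bar> powr p) \<le> ennreal (2 powr p * (\<bar>f x\<bar> powr p + \<bar>g x\<bar> powr p))"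
      by (intro ennreal_leI powr_abs_add_le assms)
    also have "\<dots> = ennreal (2 powr p) * (ennreal (\<bar>f x\<bar> powr p) + ennreal (\<bar>g x\<bar> powr p))"
      by (simp add: ennreal_mult')
    finally show "indicator C x * ennreal (\<bar>f x + g x\<bar> powr p) \<le>
       ennreal (2 powr p) * (indicator C x * ennreal (\<bar>f x\<bar> powr p) + indicator C x * ennreal (\<bar>g x\<bar> powr p))"
      by (auto simp: indicator_def)
  qed
  also have "\<dots> = ennreal (2 powr p) * (Lp_int p C f + Lp_int p C g)"
    unfolding Lp_int_def by (simp add: nn_integral_cmult nn_integral_add)
  finally show ?thesis .
qed

lemma Lp_int_uminus: "Lp_int p C (\<lambda>x. - f x) = Lp_int p C f"
  by (simp add: Lp_int_def)

lemma Lp_int_diff_le: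
  assumes "f \<in> borel_measurable borel" "g \<in> borel_measurable borel" "C \<in> sets borel"
    and "0 \<le> p"
  shows "Lp_int p C (\<lambda>x. f x - g x) \<le> ennreal (2 powr p) * (Lp_int p C f + Lp_int p C g)"
  using Lp_int_add_le[of f "\<lambda>x. - g x" C p] assms by (simp add: Lp_int_uminus)

lemma Lp_int_add_weighted:
  assumes [measurable]: "f \<in> borel_measurable borel" "g \<in> borel_measurable borel" "C \<in> sets borel"
    and "0 < l" "l < 1" "1 \<le> p"
  shows "Lp_int p C (\<lambda>x. f x + g x) \<le> ennreal (l powr (1 - p)) * Lp_int p C f + ennreal ((1 - l) powr (1 - p)) * Lp_int p C g"
proof -
  have "Lp_int p C (\<lambda>x. f x + g x) \<le>
    (\<integral>\<^sup>+x. ennreal (l powr (1 - p)) * (indicator C x * ennreal (\<bar>f x\<bar> powr p))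
       + ennreal ((1 - l) powr (1 - p)) * (indicator C x * ennreal (\<bar>g x\<bar> powr p)) \<partial>lborel)"
    unfolding Lp_int_def
  proof (rule nn_integral_mono)
    fix x
    have "ennreal (\<bar>f x + g x\<bar> powr p) \<le> ennreal (l powr (1 - p) * \<bar>f x\<bar> powr p + (1 - l) powr (1 - p) * \<bar>g x\<bar> powr p)"
      by (intro ennreal_leI powr_abs_add_weighted assms)
    also have "\<dots> = ennreal (l powr (1 - p)) * ennreal (\<bar>f x\<bar> powr p) + ennreal ((1 - l) powr (1 - p)) * ennreal (\<bar>g x\<bar> powr p)"
      by (simp add: ennreal_mult')
    finally show "indicator C x * ennreal (\<bar>f x + g x\<bar> powr p) \<le>
       ennreal (l powr (1 - p)) * (indicator C x * ennreal (\<bar>f x\<bar> powr p))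
       + ennreal ((1 - l) powr (1 - p)) * (indicator C x * ennreal (\<bar>g x\<bar> powr p))"
      by (auto simp: indicator_def)
  qed
  also have "\<dots> = ennreal (l powr (1 - p)) * Lp_int p C f + ennreal ((1 - l) powr (1 - p)) * Lp_int p C g"
    unfolding Lp_int_def by (simp add: nn_integral_cmult nn_integral_add)
  finally show ?thesis .
qed

lemma Lp_int_mono_set: "C \<subseteq> D \<Longrightarrow> Lp_int p C f \<le> Lp_int p D f"
  unfolding Lp_int_def by (intro nn_integral_mono) (auto simp: indicator_def)

lemma Lp_int_cmult:
  assumes [measurable]: "f \<in> borel_measurable borel" "C \<in> sets borel"
  shows "Lp_int p C (\<lambda>x. c * f x) = ennreal (\<bar>c\<bar> powr p) * Lp_int p C f"
  unfolding Lp_int_def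
  by (subst nn_integral_cmult[symmetric]) (auto simp: abs_mult powr_mult ennreal_mult' mult_ac intro!: nn_integral_cong)

lemma Lp_int_translate:
  assumes [measurable]: "f \<in> borel_measurable borel"
  shows "Lp_int p UNIV (\<lambda>x. f (x + z)) = Lp_int p UNIV f"
  unfolding Lp_int_def using nn_integral_lborel_translate[of "\<lambda>x. ennreal (\<bar>f x\<bar> powr p)" z] by simp

lemma dominated_Lp_int_tendsto_0:
  fixes f :: "nat \<Rightarrow> 'a::euclidean_space \<Rightarrow> real"
  assumes [measurable]: "\<And>n. f n \<in> borel_measurable borel" "g \<in> borel_measurable borel" and p: "0 < p"
    and le: "\<And>n x. \<bar>f n x\<bar> \<le> g x"
    and fin: "Lp_int p UNIV g < \<infinity>"
    and lim: "AE x in lborel. (\<lambda>n. f n x) \<longlonglongrightarrow> 0"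
  shows "(\<lambda>n. Lp_int p UNIV (f n)) \<longlonglongrightarrow> 0"
proof -
  have "(\<lambda>n. \<integral>\<^sup>+x. ennreal (\<bar>f n x\<bar> powr p) \<partial>lborel) \<longlonglongrightarrow> (\<integral>\<^sup>+x. 0 \<partial>(lborel::'a measure))"
  proof (rule nn_integral_dominated_convergence)
    show "AE x in lborel. ennreal (\<bar>f n x\<bar> powr p) \<le> ennreal (\<bar>g x\<bar> powr p)" for n
    proof (intro AE_I2 ennreal_leI powr_mono2)
      fix x show "\<bar>f n x\<bar> \<le> \<bar>g x\<bar>" using le[of n x] by auto
    qed (use p in auto)
    show "(\<integral>\<^sup>+x. ennreal (\<bar>g x\<bar> powr p) \<partial>lborel) < \<infinity>"
      using fin by (simp add: Lp_int_def)
    show "AE x in lborel. (\<lambda>n. ennreal (\<bar>f n x\<bar> powr p)) \<longlonglongrightarrow> 0"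
      using lim
    proof eventually_elim
      case (elim x)
      then have "(\<lambda>n. \<bar>f n x\<bar>) \<longlonglongrightarrow> 0" by (rule tendsto_rabs_zero)
      then have "(\<lambda>n. \<bar>f n x\<bar> powr p) \<longlonglongrightarrow> 0 powr p"
        using p by (intro tendsto_powr' tendsto_const) auto
      then have "(\<lambda>n. ennreal (\<bar>f n x\<bar> powr p)) \<longlonglongrightarrow> ennreal 0"
        using p by (intro tendsto_ennrealI) simp
      then show ?case by simp
    qed
  qed auto
  then show ?thesis by (simp add: Lp_int_def)
qed

text \<open>F is an almost everywhere limit of continuous functions \<open>g n\<close>, but without
  domination. Truncating the values of F and cutting it off in space first gives a function within
  the tolerance; the same truncation and cut-off applied to \<open>g n\<close> then yields
  continuous functions dominated by a fixed bounded function that vanishes off a ball.\<close>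

lemma Lp_int_approx_continuous:
  fixes F :: "'a::euclidean_space \<Rightarrow> real"
  assumes F[measurable]: "F \<in> borel_measurable borel" and p: "0 < p" and fin: "Lp_int p UNIV F < \<infinity>"
    and e: "0 < e"
  obtains \<phi> R where "continuous_on UNIV \<phi>" "\<And>x. x \<notin> cball 0 R \<Longrightarrow> \<phi> x = 0"
    "Lp_int p UNIV (\<lambda>x. F x - \<phi> x) < ennreal e"
proof -
  have "F measurable_on UNIV"
    using F by (intro lebesgue_measurable_imp_measurable_on) (auto simp: measurable_completion)
  then obtain N g where N: "negligible N" and g: "\<And>n. continuous_on UNIV (g n)"
    and lim: "\<And>x. x \<notin> N \<Longrightarrow> (\<lambda>n. g n x) \<longlonglongrightarrow> F x"
    unfolding measurable_on_def by auto
  have aeN: "AE x in lborel. x \<notin> N"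
    using AE_not_in[of N lebesgue] N by (simp add: negligible_iff_null_sets AE_completion_iff)
  define T where "T R y = max (- R) (min R y)" for R y :: real
  define X where "X R x = max 0 (min 1 (R + 1 - norm x))" for R and x :: 'a
  have gm[measurable]: "g n \<in> borel_measurable borel" for n
    using g by (rule borel_measurable_continuous_onI)
  have [measurable]: "X R \<in> borel_measurable borel" for R
    unfolding X_def[abs_def] by measurable
  have X01: "0 \<le> X R x" "X R x \<le> 1" for R x by (auto simp: X_def)
  have Tle: "\<bar>T R y\<bar> \<le> \<bar>y\<bar>" "0 \<le> R \<Longrightarrow> \<bar>T R y\<bar> \<le> R" if "0 \<le> R" for R y
    using that by (auto simp: T_def max_def min_def)
  have "(\<lambda>n. Lp_int p UNIV (\<lambda>x. F x - T (real n) (F x) * X (real n) x)) \<longlonglongrightarrow> 0"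
  proof (rule dominated_Lp_int_tendsto_0[where g = "\<lambda>x. 2 * \<bar>F x\<bar>"])
    show "\<bar>F x - T (real n) (F x) * X (real n) x\<bar> \<le> 2 * \<bar>F x\<bar>" for n x
    proof -
      have "\<bar>T (real n) (F x) * X (real n) x\<bar> \<le> \<bar>F x\<bar> * 1"
        unfolding abs_mult using X01[of "real n" x] Tle(1)[of "real n" "F x"] by (intro mult_mono) auto
      then show ?thesis by linarith
    qed
    have "Lp_int p UNIV (\<lambda>x. 2 * \<bar>F x\<bar>) = ennreal (2 powr p) * Lp_int p UNIV F"
      unfolding Lp_int_def by (simp add: abs_mult powr_mult ennreal_mult' nn_integral_cmult)
    then show "Lp_int p UNIV (\<lambda>x. 2 * \<bar>F x\<bar>) < \<infinity>"
      using fin by (simp add: ennreal_mult_less_top)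
    show "AE x in lborel. (\<lambda>n. F x - T (real n) (F x) * X (real n) x) \<longlonglongrightarrow> 0"
    proof (intro AE_I2 tendsto_eventually)
      fix x
      obtain n0 :: nat where n0: "\<bar>F x\<bar> + norm x \<le> real n0" using real_arch_simple by blast
      have "F x - T (real n) (F x) * X (real n) x = 0" if "n0 \<le> n" for n
      proof -
        have "\<bar>F x\<bar> + norm x \<le> real n" using n0 that by linarith
        then have "\<bar>F x\<bar> \<le> real n" "norm x \<le> real n" using norm_ge_zero[of x] abs_ge_zero[of "F x"] by linarith+
        then show ?thesis by (auto simp: T_def X_def)
      qed
      then show "\<forall>\<^sub>F n in sequentially. F x - T (real n) (F x) * X (real n) x = 0"
        unfolding eventually_sequentially by blast
    qed
  qed (use p in \<open>auto simp: T_def\<close>)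
  \<comment> \<open>Two errors of this size are added through \<open>Lp_int_add_le\<close>, whose
    constant is 2^p.\<close>
  then have "\<forall>\<^sub>F n in sequentially. Lp_int p UNIV (\<lambda>x. F x - T (real n) (F x) * X (real n) x) < ennreal (e / (2 * 2 powr p))"
    using e by (intro order_tendstoD) auto
  then obtain R :: nat where R: "Lp_int p UNIV (\<lambda>x. F x - T (real R) (F x) * X (real R) x) < ennreal (e / (2 * 2 powr p))"
    unfolding eventually_sequentially by blast
  have "(\<lambda>n. Lp_int p UNIV (\<lambda>x. T (real R) (F x) * X (real R) x - T (real R) (g n x) * X (real R) x)) \<longlonglongrightarrow> 0"
  proof (rule dominated_Lp_int_tendsto_0[where g = "\<lambda>x. (2 * real R) * indicator (ball 0 (real R + 1)) x"])
    show "\<bar>T (real R) (F x) * X (real R) x - T (real R) (g n x) * X (real R) x\<bar>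
       \<le> 2 * real R * indicator (ball 0 (real R + 1)) x" for n x
    proof (cases "norm x < real R + 1")
      case True
      have "\<bar>T (real R) y * X (real R) x\<bar> \<le> real R * 1" for y
        unfolding abs_mult using X01[of "real R" x] Tle(2)[of "real R" y] by (intro mult_mono) auto
      from this[of "F x"] this[of "g n x"] show ?thesis using True by simp
    next
      case False
      then have "X (real R) x = 0" by (auto simp: X_def)
      then show ?thesis by simp
    qed
    have "Lp_int p UNIV (\<lambda>x::'a. 2 * real R * indicator (ball 0 (real R + 1)) x) =
      (\<integral>\<^sup>+x. ennreal ((2 * real R) powr p) * indicator (ball (0::'a) (real R + 1)) x \<partial>lborel)"
      unfolding Lp_int_def using p by (intro nn_integral_cong) (auto simp: indicator_def)
    also have "\<dots> < \<infinity>"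
      using emeasure_lborel_ball_less_top[of "0::'a" "real R + 1"]
      by (simp add: nn_integral_cmult_indicator ennreal_mult_less_top)
    finally show "Lp_int p UNIV (\<lambda>x::'a. 2 * real R * indicator (ball 0 (real R + 1)) x) < \<infinity>" .
    show "AE x in lborel. (\<lambda>n. T (real R) (F x) * X (real R) x - T (real R) (g n x) * X (real R) x) \<longlonglongrightarrow> 0"
      using aeN
    proof eventually_elim
      case (elim x)
      have "(\<lambda>n. T (real R) (F x) * X (real R) x - T (real R) (g n x) * X (real R) x)
        \<longlonglongrightarrow> T (real R) (F x) * X (real R) x - T (real R) (F x) * X (real R) x"
        unfolding T_def using lim[OF elim] by (intro tendsto_intros)
      then show ?case by simp
    qed
    show "(\<lambda>x::'a. 2 * real R * indicator (ball 0 (real R + 1)) x) \<in> borel_measurable borel"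
      by (intro borel_measurable_times borel_measurable_const borel_measurable_indicator) simp
  qed (use p in \<open>auto simp: T_def\<close>)
  then have "\<forall>\<^sub>F n in sequentially. Lp_int p UNIV (\<lambda>x. T (real R) (F x) * X (real R) x - T (real R) (g n x) * X (real R) x) < ennreal (e / (2 * 2 powr p))"
    using e by (intro order_tendstoD) auto
  then obtain n where n: "Lp_int p UNIV (\<lambda>x. T (real R) (F x) * X (real R) x - T (real R) (g n x) * X (real R) x) < ennreal (e / (2 * 2 powr p))"
    unfolding eventually_sequentially by blast
  define \<phi> where "\<phi> x = T (real R) (g n x) * X (real R) x" for x
  have phi[measurable]: "\<phi> \<in> borel_measurable borel"
    unfolding \<phi>_def[abs_def] T_def by measurable
  show ?thesis
  proof
    show "continuous_on UNIV \<phi>"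
      unfolding \<phi>_def[abs_def] T_def X_def by (intro continuous_intros g)
    show "\<phi> x = 0" if "x \<notin> cball 0 (real R + 1)" for x
      using that by (auto simp: \<phi>_def X_def)
    have "Lp_int p UNIV (\<lambda>x. F x - \<phi> x) = Lp_int p UNIV (\<lambda>x. (F x - T (real R) (F x) * X (real R) x) + (T (real R) (F x) * X (real R) x - \<phi> x))"
      by simp
    also have "\<dots> \<le> ennreal (2 powr p) * (Lp_int p UNIV (\<lambda>x. F x - T (real R) (F x) * X (real R) x) + Lp_int p UNIV (\<lambda>x. T (real R) (F x) * X (real R) x - \<phi> x))"
      using p by (intro Lp_int_add_le) (auto simp: T_def)
    also have "\<dots> < ennreal (2 powr p) * (ennreal (e / (2 * 2 powr p)) + ennreal (e / (2 * 2 powr p)))"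
      using R n by (intro ennreal_mult_strict_left_mono add_strict_mono) (auto simp: \<phi>_def)
    also have "\<dots> = ennreal e"
      using e by (simp add: ennreal_plus[symmetric] ennreal_mult'[symmetric] del: ennreal_plus)
    finally show "Lp_int p UNIV (\<lambda>x. F x - \<phi> x) < ennreal e" .
  qed
qed

lemma translation_int_eq_Lp_int: "translation_int p C w h = Lp_int p C (\<lambda>x. w (x + h) - w x)"
  by (simp add: translation_int_def Lp_int_def)

lemma translation_int_tendsto_0_continuous:
  fixes \<phi> :: "'a::euclidean_space \<Rightarrow> real"
  assumes cont: "continuous_on UNIV \<phi>" and supp: "\<And>x. x \<notin> cball 0 R \<Longrightarrow> \<phi> x = 0"
    and p: "0 < p" and e: "0 < e"
  obtains d where "0 < d" "\<And>z. norm z < d \<Longrightarrow> translation_int p UNIV \<phi> z \<le> ennreal e"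
proof -
  \<comment> \<open>The ball contains the supports of \<phi> and of its translates by less than 1.
    The modulus allows for negative R, and the added 1 makes V positive.\<close>
  define V where "V = measure lborel (ball (0::'a) (\<bar>R\<bar> + 1)) + 1"
  have V: "0 < V" by (simp add: V_def add_nonneg_pos)
  have eV: "emeasure lborel (ball (0::'a) (\<bar>R\<bar> + 1)) \<le> ennreal V"
    using emeasure_lborel_ball_less_top[of "0::'a" "\<bar>R\<bar> + 1"]
    by (subst emeasure_eq_ennreal_measure) (auto simp: V_def less_top intro!: ennreal_leI)
  define \<eta> where "\<eta> = (e / V) powr (1 / p)"
  have \<eta>: "0 < \<eta>" "\<eta> powr p = e / V" using e V p by (auto simp: \<eta>_def powr_powr)
  have "uniformly_continuous_on UNIV \<phi>"
    using compact_support_uniformly_continuous[OF cont, of "cball 0 R"] supp by auto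
  then obtain d where d: "0 < d" "\<And>x y. dist x y < d \<Longrightarrow> dist (\<phi> x) (\<phi> y) < \<eta>"
    using \<eta> unfolding uniformly_continuous_on_def by (metis UNIV_I)
  show ?thesis
  proof
    show "0 < min d 1" using d by simp
    fix z :: 'a assume z: "norm z < min d 1"
    have "translation_int p UNIV \<phi> z \<le> (\<integral>\<^sup>+x. ennreal (e / V) * indicator (ball (0::'a) (\<bar>R\<bar> + 1)) x \<partial>lborel)"
      unfolding translation_int_def
    proof (rule nn_integral_mono)
      fix x :: 'a
      show "indicator UNIV x * ennreal (\<bar>\<phi> (x + z) - \<phi> x\<bar> powr p) \<le> ennreal (e / V) * indicator (ball (0::'a) (\<bar>R\<bar> + 1)) x"
      proof (cases "x \<in> ball 0 (\<bar>R\<bar> + 1)")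
        case True
        have "\<bar>\<phi> (x + z) - \<phi> x\<bar> \<le> \<eta>"
          using d(2)[of "x + z" x] z by (auto simp: dist_norm)
        then have "\<bar>\<phi> (x + z) - \<phi> x\<bar> powr p \<le> e / V"
          using p \<eta>(2) powr_mono2[of p "\<bar>\<phi> (x + z) - \<phi> x\<bar>" \<eta>] by simp
        then show ?thesis using True by (auto intro!: ennreal_leI)
      next
        case False
        have "norm x \<le> norm (x + z) + norm z" by norm
        then have "x \<notin> cball 0 R" "x + z \<notin> cball 0 R" using False z by auto
        then show ?thesis using supp p by simp
      qed
    qed
    also have "\<dots> = ennreal (e / V) * emeasure lborel (ball (0::'a) (\<bar>R\<bar> + 1))"
      by (simp add: nn_integral_cmult_indicator)
    also have "\<dots> \<le> ennreal (e / V) * ennreal V"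
      by (intro mult_left_mono eV) auto
    also have "\<dots> = ennreal e" using V e by (simp add: ennreal_mult'[symmetric])
    finally show "translation_int p UNIV \<phi> z \<le> ennreal e" .
  qed
qed

lemma translation_int_tendsto_0:
  fixes F :: "'a::euclidean_space \<Rightarrow> real"
  assumes F[measurable]: "F \<in> borel_measurable borel" and p: "0 < p" and fin: "Lp_int p UNIV F < \<infinity>"
    and e: "0 < e"
  obtains d where "0 < d" "\<And>z. norm z < d \<Longrightarrow> translation_int p UNIV F z \<le> ennreal e"
proof -
  \<comment> \<open>Chosen so that the total error 2^p (e' + 2^p (e' + e')) below equals e.\<close>
  define e' where "e' = e / (2 powr p * (1 + 2 powr p * 2))"
  have e': "0 < e'" using e by (simp add: e'_def add_pos_pos)
  obtain \<phi> R where \<phi>: "continuous_on UNIV \<phi>" "\<And>x. x \<notin> cball 0 R \<Longrightarrow> \<phi> x = 0"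
    "Lp_int p UNIV (\<lambda>x. F x - \<phi> x) < ennreal e'"
    using Lp_int_approx_continuous[OF F p fin e'] by blast
  have [measurable]: "\<phi> \<in> borel_measurable borel"
    using \<phi>(1) by (rule borel_measurable_continuous_onI)
  obtain d where d: "0 < d" "\<And>z. norm z < d \<Longrightarrow> translation_int p UNIV \<phi> z \<le> ennreal e'"
    using translation_int_tendsto_0_continuous[OF \<phi>(1,2) p e'] by blast
  show ?thesis
  proof
    fix z :: 'a assume z: "norm z < d"
    let ?D = "\<lambda>x. F x - \<phi> x"
    have "translation_int p UNIV F z = Lp_int p UNIV (\<lambda>x. (\<phi> (x + z) - \<phi> x) + (?D (x + z) - ?D x))"
      by (simp add: translation_int_eq_Lp_int)
    also have "\<dots> \<le> ennreal (2 powr p) * (translation_int p UNIV \<phi> z + Lp_int p UNIV (\<lambda>x. ?D (x + z) - ?D x))"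
      unfolding translation_int_eq_Lp_int using p by (intro Lp_int_add_le) auto
    also have "\<dots> \<le> ennreal (2 powr p) * (ennreal e' + ennreal (2 powr p) * (ennreal e' + ennreal e'))"
    proof (intro mult_left_mono add_mono)
      have "Lp_int p UNIV (\<lambda>x. ?D (x + z) - ?D x) \<le> ennreal (2 powr p) * (Lp_int p UNIV (\<lambda>x. ?D (x + z)) + Lp_int p UNIV ?D)"
        using p by (intro Lp_int_diff_le) auto
      also have "Lp_int p UNIV (\<lambda>x. ?D (x + z)) = Lp_int p UNIV ?D"
        by (rule Lp_int_translate) auto
      also have "ennreal (2 powr p) * (Lp_int p UNIV ?D + Lp_int p UNIV ?D) \<le> ennreal (2 powr p) * (ennreal e' + ennreal e')"
        using \<phi>(3) by (intro mult_left_mono add_mono) auto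
      finally show "Lp_int p UNIV (\<lambda>x. ?D (x + z) - ?D x) \<le> ennreal (2 powr p) * (ennreal e' + ennreal e')" .
    qed (use d(2)[OF z] in auto)
    also have "\<dots> = ennreal (2 powr p * (e' + 2 powr p * (e' + e')))"
      using e' by (simp only: ennreal_mult' ennreal_plus add_nonneg_nonneg mult_nonneg_nonneg powr_ge_zero less_imp_le)
    also have "2 powr p * (e' + 2 powr p * (e' + e')) = (2 powr p * (1 + 2 powr p * 2)) * e'"
      by (simp add: algebra_simps)
    also have "\<dots> = e"
    proof -
      have "0 < 2 powr p * (1 + 2 powr p * 2)" by (simp add: add_pos_pos)
      have cancel: "c * (e / c) = e" if "0 < c" for c :: real using that by simp
      show ?thesis unfolding e'_def by (rule cancel) fact
    qed
    finally show "translation_int p UNIV F z \<le> ennreal e" .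
  qed (rule d)
qed

text \<open>Jensen's inequality up to the factor $2^p$, which needs no convexity.\<close>

lemma powr_integral_le:
  fixes g \<rho> :: "'a::euclidean_space \<Rightarrow> real"
  assumes [measurable]: "g \<in> borel_measurable borel" "\<rho> \<in> borel_measurable borel"
    and \<rho>: "\<And>z. 0 \<le> \<rho> z" "(\<integral>\<^sup>+z. ennreal (\<rho> z) \<partial>lborel) = 1" and p: "1 \<le> p"
  shows "ennreal (\<bar>LINT z|lborel. g z * \<rho> z\<bar> powr p) \<le> ennreal (2 powr p) * (\<integral>\<^sup>+z. ennreal (\<bar>g z\<bar> powr p) * ennreal (\<rho> z) \<partial>lborel)"
proof -
  define m where "m = \<bar>LINT z|lborel. g z * \<rho> z\<bar>"
  define I where "I = (\<integral>\<^sup>+z. ennreal (\<bar>g z\<bar> powr p) * ennreal (\<rho> z) \<partial>lborel)"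
  show ?thesis
  proof (cases "m = 0 \<or> I = \<infinity>")
    case True
    then show ?thesis
    proof
      assume "m = 0" then show ?thesis using p by (simp add: m_def)
    next
      assume "I = \<infinity>" then show ?thesis by (simp add: I_def[symmetric] ennreal_mult_top)
    qed
  next
    case False
    then have m: "0 < m" by (simp add: m_def)
    obtain i where i: "I = ennreal i" "0 \<le> i" using False by (cases I) auto
    \<comment> \<open>Truncation at half the mean: of the two terms of \<open>le_truncation\<close>
      the first is half of m and can be absorbed, and the second then bounds d^p by the integral.
      The factor 2^p is the price of the half.\<close>
    define d where "d = m / 2"
    have d: "0 < d" using m by (simp add: d_def)
    have "ennreal m \<le> (\<integral>\<^sup>+z. ennreal (\<bar>g z\<bar>) * ennreal (\<rho> z) \<partial>lborel)"
    proof (cases "integrable lborel (\<lambda>z. g z * \<rho> z)")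
      case True
      from integral_norm_bound_ennreal[OF this] show ?thesis
        by (simp add: m_def abs_mult \<rho> ennreal_mult')
    next
      \<comment> \<open>The Bochner integral of a non-integrable function is 0 by convention, which
        m > 0 excludes.\<close>
      case False
      then show ?thesis using m by (simp add: m_def not_integrable_integral_eq)
    qed
    also have "\<dots> \<le> (\<integral>\<^sup>+z. ennreal d * ennreal (\<rho> z) + ennreal (d powr (1 - p)) * (ennreal (\<bar>g z\<bar> powr p) * ennreal (\<rho> z)) \<partial>lborel)"
    proof (rule nn_integral_mono)
      fix z
      have "\<bar>g z\<bar> * \<rho> z \<le> (d + d powr (1 - p) * \<bar>g z\<bar> powr p) * \<rho> z"
        by (intro mult_right_mono le_truncation d p \<rho>) auto
      then have "ennreal (\<bar>g z\<bar> * \<rho> z) \<le> ennreal (d * \<rho> z + d powr (1 - p) * (\<bar>g z\<bar> powr p * \<rho> z))"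
        by (intro ennreal_leI) (simp add: algebra_simps)
      also have "\<dots> = ennreal d * ennreal (\<rho> z) + ennreal (d powr (1 - p)) * (ennreal (\<bar>g z\<bar> powr p) * ennreal (\<rho> z))"
        using d \<rho>(1)[of z] by (simp add: ennreal_mult')
      finally show "ennreal \<bar>g z\<bar> * ennreal (\<rho> z) \<le> ennreal d * ennreal (\<rho> z) + ennreal (d powr (1 - p)) * (ennreal (\<bar>g z\<bar> powr p) * ennreal (\<rho> z))"
        using \<rho>(1)[of z] by (simp add: ennreal_mult')
    qed
    also have "\<dots> = ennreal d * (\<integral>\<^sup>+z. ennreal (\<rho> z) \<partial>lborel) + ennreal (d powr (1 - p)) * I"
      unfolding I_def by (simp add: nn_integral_add nn_integral_cmult)
    also have "\<dots> = ennreal (d + d powr (1 - p) * i)"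
      using d i by (simp add: \<rho>(2) ennreal_mult')
    finally have "m \<le> d + d powr (1 - p) * i"
      using d i by (subst (asm) ennreal_le_iff) auto
    then have "d \<le> d powr (1 - p) * i" by (simp add: d_def)
    then have "d * d powr (p - 1) \<le> (d powr (1 - p) * i) * d powr (p - 1)"
      by (intro mult_right_mono) auto
    also have "\<dots> = i * (d powr (1 - p) * d powr (p - 1))" by simp
    also have "d powr (1 - p) * d powr (p - 1) = 1" using d by (simp add: powr_add[symmetric])
    finally have "d powr p \<le> i" using d p by (simp add: powr_split_sub1[of d p])
    moreover have "m powr p = 2 powr p * d powr p" using m by (simp add: d_def powr_divide)
    ultimately have "ennreal (m powr p) \<le> ennreal (2 powr p * i)"
      by (intro ennreal_leI) simp
    then show ?thesis using i by (simp add: m_def[symmetric] I_def[symmetric] ennreal_mult')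
  qed
qed

text \<open>The map \<open>L\<close> allows the diagonal translations of functions of two variables.\<close>

lemma Lp_int_mollify_le:
  fixes F :: "'b::euclidean_space \<Rightarrow> real" and \<rho> :: "'a::euclidean_space \<Rightarrow> real" and L :: "'a \<Rightarrow> 'b"
  assumes [measurable]: "F \<in> borel_measurable borel" "\<rho> \<in> borel_measurable borel" "L \<in> borel_measurable borel"
    and \<rho>: "\<And>z. 0 \<le> \<rho> z" "(\<integral>\<^sup>+z. ennreal (\<rho> z) \<partial>lborel) = 1" and p: "1 \<le> p"
    and e: "\<And>z. \<rho> z \<noteq> 0 \<Longrightarrow> translation_int p UNIV F (- L z) \<le> ennreal e"
  shows "Lp_int p UNIV (\<lambda>x. LINT z|lborel. (F (x - L z) - F x) * \<rho> z) \<le> ennreal (2 powr p) * ennreal e"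
proof -
  have "Lp_int p UNIV (\<lambda>x. LINT z|lborel. (F (x - L z) - F x) * \<rho> z) \<le>
    (\<integral>\<^sup>+x. ennreal (2 powr p) * (\<integral>\<^sup>+z. ennreal (\<bar>F (x - L z) - F x\<bar> powr p) * ennreal (\<rho> z) \<partial>lborel) \<partial>lborel)"
    unfolding Lp_int_def
  proof (rule nn_integral_mono)
    fix x
    have [measurable]: "(\<lambda>z. F (x - L z) - F x) \<in> borel_measurable borel" by measurable
    show "indicator UNIV x * ennreal (\<bar>LINT z|lborel. (F (x - L z) - F x) * \<rho> z\<bar> powr p) \<le>
      ennreal (2 powr p) * (\<integral>\<^sup>+z. ennreal (\<bar>F (x - L z) - F x\<bar> powr p) * ennreal (\<rho> z) \<partial>lborel)"
      using powr_integral_le[of "\<lambda>z. F (x - L z) - F x" \<rho> p] \<rho> p by simp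
  qed
  also have "\<dots> = ennreal (2 powr p) * (\<integral>\<^sup>+x. (\<integral>\<^sup>+z. ennreal (\<bar>F (x - L z) - F x\<bar> powr p) * ennreal (\<rho> z) \<partial>lborel) \<partial>lborel)"
    by (rule nn_integral_cmult) measurable
  also have "(\<integral>\<^sup>+x. (\<integral>\<^sup>+z. ennreal (\<bar>F (x - L z) - F x\<bar> powr p) * ennreal (\<rho> z) \<partial>lborel) \<partial>lborel) =
    (\<integral>\<^sup>+z. (\<integral>\<^sup>+x. ennreal (\<bar>F (x - L z) - F x\<bar> powr p) * ennreal (\<rho> z) \<partial>lborel) \<partial>lborel)"
    by (rule lborel_pair.Fubini') measurable
  also have "\<dots> = (\<integral>\<^sup>+z. translation_int p UNIV F (- L z) * ennreal (\<rho> z) \<partial>lborel)"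
    unfolding translation_int_def by (intro nn_integral_cong) (simp add: nn_integral_multc)
  also have "\<dots> \<le> (\<integral>\<^sup>+z. ennreal e * ennreal (\<rho> z) \<partial>lborel)"
  proof (rule nn_integral_mono)
    fix z show "translation_int p UNIV F (- L z) * ennreal (\<rho> z) \<le> ennreal e * ennreal (\<rho> z)"
      using e[of z] by (cases "\<rho> z = 0") (auto intro!: mult_right_mono)
  qed
  also have "\<dots> = ennreal e" using \<rho>(2) by (simp add: nn_integral_cmult)
  finally show ?thesis by (simp add: mult_left_mono)
qed

section \<open>Mollifiers\<close>

text \<open>These are the building blocks of the derivatives of exp(-1/t): up to linear combinations
  the family over n is closed under differentiation, which is what an induction on the order of
  smoothness needs.\<close>

definition flat_exp :: "nat \<Rightarrow> real \<Rightarrow> real" where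
  "flat_exp n t = (if t > 0 then exp (- 1 / t) / t ^ n else 0)"

lemma flat_exp_nonneg: "0 \<le> flat_exp n t"
  by (simp add: flat_exp_def)

text \<open>The term of order n + 1 of the exponential series at 1/t beats t^n and leaves one power
  of t. This linear bound gives the derivative at 0.\<close>

lemma flat_exp_le: "\<bar>flat_exp n t\<bar> \<le> fact (n + 1) * \<bar>t\<bar>"
proof (cases "t > 0")
  case True
  have "(1 / t) ^ (n + 1) / fact (n + 1) \<le> exp (1 / t)"
  proof -
    have s: "summable (\<lambda>k. (1 / t) ^ k /\<^sub>R fact k)" by (rule summable_exp_generic)
    have "(\<Sum>k\<in>{n+1}. (1 / t) ^ k /\<^sub>R fact k) \<le> (\<Sum>k. (1 / t) ^ k /\<^sub>R fact k)"
      using True by (intro sum_le_suminf s) auto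
    then show ?thesis by (simp add: exp_def divide_inverse_commute)
  qed
  then have "1 \<le> exp (1 / t) * (fact (n + 1) * t ^ (n + 1))"
  proof -
    have gen: "1 \<le> E * (c * t ^ m)" if "(1 / t) ^ m / c \<le> E" "0 < c" for E c :: real and m
      using that True by (simp add: field_simps)
    from \<open>(1 / t) ^ (n + 1) / fact (n + 1) \<le> exp (1 / t)\<close> show ?thesis by (rule gen) simp
  qed
  then have "exp (- 1 / t) * 1 \<le> exp (- 1 / t) * (exp (1 / t) * (fact (n + 1) * t ^ (n + 1)))"
    by (intro mult_left_mono) auto
  also have "\<dots> = fact (n + 1) * t ^ (n + 1)"
    by (simp add: mult.assoc[symmetric] exp_add[symmetric])
  finally have "exp (- 1 / t) / t ^ n \<le> fact (n + 1) * t ^ (n + 1) / t ^ n"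
    using True by (intro divide_right_mono) auto
  also have "\<dots> = fact (n + 1) * t" using True by simp
  finally show ?thesis using True by (simp add: flat_exp_def)
next
  case False
  have "0 \<le> fact (n + 1) * \<bar>t\<bar>" by (intro mult_nonneg_nonneg) auto
  then show ?thesis using False by (simp add: flat_exp_def del: fact_Suc)
qed

text \<open>Only t = 0 is delicate: there the difference quotient of \<open>flat_exp n\<close> is
  \<open>flat_exp (n + 1)\<close> itself, which tends to 0 by the linear bound.\<close>

lemma flat_exp_deriv:
  "(flat_exp n has_real_derivative (flat_exp (n + 2) t - real n * flat_exp (n + 1) t)) (at t)"
proof -
  consider "t > 0" | "t < 0" | "t = 0" by linarith
  then show ?thesis
  proof cases
    case 1
    have "((\<lambda>t. exp (- 1 / t) / t ^ n) has_real_derivative (flat_exp (n + 2) t - real n * flat_exp (n + 1) t)) (at t)"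
    proof -
      have D: "((\<lambda>t. exp (- 1 / t) / t ^ n) has_real_derivative
          ((exp (- 1 / t) * (1 / t ^ 2)) * t ^ n - exp (- 1 / t) * (real n * t ^ (n - 1))) / (t ^ n * t ^ n)) (at t)"
        using 1 by (intro DERIV_divide) (auto intro!: derivative_eq_intros simp: power2_eq_square)
      have eq: "((E * (1 / t ^ 2)) * t ^ n - E * (real n * t ^ (n - 1))) / (t ^ n * t ^ n) =
          E / t ^ (n + 2) - real n * (E / t ^ (n + 1))" for E
        using 1 by (cases n) (simp_all add: field_simps power2_eq_square)
      show ?thesis using D unfolding eq using 1 by (simp add: flat_exp_def)
    qed
    moreover have "\<forall>\<^sub>F x in nhds t. flat_exp n x = exp (- 1 / x) / x ^ n"
      using eventually_gt_at_top 1 order_tendstoD(1)[OF filterlim_ident, of 0]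
      by (auto simp: flat_exp_def elim!: eventually_mono intro!: eventually_nhds_in_open[of "{0<..}" t, THEN eventually_mono])
    ultimately show ?thesis by (subst DERIV_cong_ev[OF refl _ refl]) auto
  next
    case 2
    have "((\<lambda>t. 0) has_real_derivative (flat_exp (n + 2) t - real n * flat_exp (n + 1) t)) (at t)"
      using 2 by (simp add: flat_exp_def)
    moreover have "\<forall>\<^sub>F x in nhds t. flat_exp n x = 0"
      using 2 by (auto simp: flat_exp_def intro!: eventually_nhds_in_open[of "{..<0}" t, THEN eventually_mono])
    ultimately show ?thesis by (subst DERIV_cong_ev[OF refl _ refl]) auto
  next
    case 3
    have "((\<lambda>h. flat_exp (n + 1) h) \<longlongrightarrow> 0) (at 0)"
    proof (rule Lim_null_comparison)
      show "\<forall>\<^sub>F h in at 0. norm (flat_exp (n + 1) h) \<le> fact (n + 1 + 1) * \<bar>h\<bar>"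
        using flat_exp_le[of "n + 1"] by (intro always_eventually) simp
      show "((\<lambda>h::real. fact (n + 1 + 1) * \<bar>h\<bar>) \<longlongrightarrow> 0) (at 0)"
        by (auto intro!: tendsto_eq_intros)
    qed
    moreover have "(flat_exp n (0 + h) - flat_exp n 0) / h = flat_exp (n + 1) h" for h
      by (simp add: flat_exp_def)
    ultimately have "(flat_exp n has_real_derivative 0) (at 0)"
      unfolding DERIV_def by simp
    then show ?thesis using 3 by (simp add: flat_exp_def)
  qed
qed

lemma Ck_add: "Ck k f \<Longrightarrow> Ck k g \<Longrightarrow> Ck k (\<lambda>x. f x + g x)"
proof (induction k arbitrary: f g)
  case 0
  then show ?case by (auto intro: continuous_on_add)
next
  case (Suc k)
  have fr: "frechet_derivative (\<lambda>x. f x + g x) (at x) = (\<lambda>v. frechet_derivative f (at x) v + frechet_derivative g (at x) v)" for x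
    using Suc.prems by (intro frechet_derivative_at[symmetric] has_derivative_add) (auto simp: frechet_derivative_works)
  show ?case
    using Suc by (auto simp: fr)
qed

lemma Ck_SucI:
  assumes "\<And>x. (f has_derivative D x) (at x)" "\<And>v. Ck k (\<lambda>x. D x v)"
  shows "Ck (Suc k) f"
proof -
  have "frechet_derivative f (at x) = D x" for x
    using frechet_derivative_at[OF assms(1)] by simp
  then show ?thesis using assms by (auto simp: differentiable_def)
qed

lemma real_polynomial_function_has_derivative:
  assumes "real_polynomial_function P"
  shows "\<exists>D. \<forall>x. (P has_derivative D x) (at x) \<and> (\<forall>v. real_polynomial_function (\<lambda>x. D x v))"
  using assms
proof induction
  case (linear f)
  then show ?case
    by (intro exI[of _ "\<lambda>x. f"]) (auto intro: bounded_linear_imp_has_derivative)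
next
  case (const c)
  then show ?case
    by (intro exI[of _ "\<lambda>x v. 0"]) auto
next
  case (add f g)
  then obtain D1 D2 where "\<forall>x. (f has_derivative D1 x) (at x) \<and> (\<forall>v. real_polynomial_function (\<lambda>x. D1 x v))"
    "\<forall>x. (g has_derivative D2 x) (at x) \<and> (\<forall>v. real_polynomial_function (\<lambda>x. D2 x v))" by blast
  then show ?case
    by (intro exI[of _ "\<lambda>x v. D1 x v + D2 x v"]) (auto intro!: has_derivative_add)
next
  case (mult f g)
  then obtain D1 D2 where D: "\<forall>x. (f has_derivative D1 x) (at x) \<and> (\<forall>v. real_polynomial_function (\<lambda>x. D1 x v))"
    "\<forall>x. (g has_derivative D2 x) (at x) \<and> (\<forall>v. real_polynomial_function (\<lambda>x. D2 x v))" by blast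
  then show ?case
    using mult.hyps
    by (intro exI[of _ "\<lambda>x v. f x * D2 x v + D1 x v * g x"]) (auto intro!: has_derivative_mult real_polynomial_function.intros(3,4))
qed

text \<open>The polynomial factor is there for the induction: a directional derivative is again a
  sum of polynomial multiples of functions \<open>flat_exp\<close>, with n possibly raised. The
  squared norm keeps the argument smooth at the origin.\<close>

lemma Ck_polynomial_flat_exp:
  fixes P :: "'a::euclidean_space \<Rightarrow> real"
  assumes "real_polynomial_function P"
  shows "Ck k (\<lambda>x. P x * flat_exp n (r - x \<bullet> x))"
  using assms
proof (induction k arbitrary: P n)
  case 0
  have "continuous_on UNIV P"
    using 0 continuous_real_polymonial_function by (auto simp: continuous_on_eq_continuous_at)
  moreover have "continuous_on UNIV (flat_exp n)" for n
    using DERIV_continuous[OF flat_exp_deriv] by (auto simp: continuous_on_eq_continuous_at)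
  then have "continuous_on UNIV (\<lambda>x::'a. flat_exp n (r - x \<bullet> x))"
    by (rule continuous_on_compose2) (auto intro!: continuous_intros)
  ultimately show ?case by (auto intro!: continuous_intros)
next
  case (Suc k)
  obtain D where D: "\<And>x. (P has_derivative D x) (at x)" "\<And>v. real_polynomial_function (\<lambda>x. D x v)"
    using real_polynomial_function_has_derivative[OF Suc.prems] by blast
  have th: "((\<lambda>x. flat_exp n (r - x \<bullet> x)) has_derivative
     (\<lambda>v. - (2 * (x \<bullet> v)) * (flat_exp (n + 2) (r - x \<bullet> x) - real n * flat_exp (n + 1) (r - x \<bullet> x)))) (at x)" for x :: 'a
  proof -
    have "((\<lambda>x. r - x \<bullet> x) has_derivative (\<lambda>v. - (2 * (x \<bullet> v)))) (at x)"
      by (auto intro!: derivative_eq_intros simp: inner_commute)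
    from has_derivative_compose[OF this flat_exp_deriv[of n "r - x \<bullet> x", unfolded has_field_derivative_def]]
    show ?thesis by (simp add: mult.commute)
  qed
  show ?case
  proof (rule Ck_SucI)
    show "((\<lambda>x. P x * flat_exp n (r - x \<bullet> x)) has_derivative
      (\<lambda>v. (D x v * flat_exp n (r - x \<bullet> x) + (P x * (- 2 * (v \<bullet> x))) * flat_exp (n + 2) (r - x \<bullet> x))
          + (P x * (2 * real n * (v \<bullet> x))) * flat_exp (n + 1) (r - x \<bullet> x))) (at x)" for x
      using has_derivative_mult[OF D(1) th, of x]
      by (rule has_derivative_eq_rhs) (auto simp: algebra_simps inner_commute)
    have lin: "real_polynomial_function (\<lambda>x::'a. v \<bullet> x)" for v
      by (intro real_polynomial_function.intros(1) bounded_linear_inner_right)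
    show "Ck k (\<lambda>x. (D x v * flat_exp n (r - x \<bullet> x) + (P x * (- 2 * (v \<bullet> x))) * flat_exp (n + 2) (r - x \<bullet> x))
          + (P x * (2 * real n * (v \<bullet> x))) * flat_exp (n + 1) (r - x \<bullet> x))" for v
      by (intro Ck_add Suc.IH D(2) real_polynomial_function.intros(2-4) Suc.prems lin)
  qed
qed

lemma Ck_scale: "Ck k f \<Longrightarrow> Ck k (\<lambda>x. c * f x)"
proof (induction k arbitrary: f)
  case 0
  then show ?case by (auto intro!: continuous_intros)
next
  case (Suc k)
  have fr: "frechet_derivative (\<lambda>x. c * f x) (at x) = (\<lambda>v. c * frechet_derivative f (at x) v)" for x
    using Suc.prems by (intro frechet_derivative_at[symmetric] has_derivative_mult_right) (auto simp: frechet_derivative_works)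
  show ?case
    using Suc by (auto simp: fr)
qed

lemma mollifier_exists:
  assumes r: "0 < r"
  obtains \<rho> :: "'a::euclidean_space \<Rightarrow> real" where "\<And>k. Ck k \<rho>" "\<And>x. 0 \<le> \<rho> x" "\<And>x. x \<notin> cball 0 r \<Longrightarrow> \<rho> x = 0"
    "(\<integral>\<^sup>+x. ennreal (\<rho> x) \<partial>lborel) = 1"
proof -
  define b where "b x = flat_exp 0 (r\<^sup>2 - x \<bullet> x)" for x :: 'a
  have Ckb: "Ck k b" for k
    using Ck_polynomial_flat_exp[of "\<lambda>x. 1" k 0 "r\<^sup>2"] by (simp add: b_def[abs_def] real_polynomial_function.intros(2))
  then have "continuous_on UNIV b" using Ck.simps(1) by blast
  then have [measurable]: "b \<in> borel_measurable borel" by (rule borel_measurable_continuous_onI)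
  have supp: "b x = 0" if "x \<notin> cball 0 r" for x
  proof -
    have "r\<^sup>2 < x \<bullet> x" using that r by (simp add: dot_square_norm power_strict_mono)
    then show ?thesis by (simp add: b_def flat_exp_def)
  qed
  have b1: "b x \<le> 1" for x by (simp add: b_def flat_exp_def)
  have b0: "0 \<le> b x" for x by (simp add: b_def flat_exp_nonneg)
  have bpos: "0 < b x" if "x \<in> ball 0 r" for x
  proof -
    have "x \<bullet> x < r\<^sup>2" using that r by (simp add: dot_square_norm power_strict_mono)
    then show ?thesis by (simp add: b_def flat_exp_def)
  qed
  define I where "I = (\<integral>\<^sup>+x. ennreal (b x) \<partial>lborel)"
  have "I \<le> (\<integral>\<^sup>+x. indicator (cball (0::'a) r) x \<partial>lborel)"
    unfolding I_def using b1 supp by (intro nn_integral_mono) (auto simp: indicator_def)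
  also have "\<dots> < \<infinity>"
    using emeasure_lborel_cball_finite[of "0::'a" r] by (simp add: less_top)
  finally have "I < \<infinity>" .
  \<comment> \<open>Otherwise b would vanish almost everywhere on a ball of positive volume, on
    which it is positive.\<close>
  moreover have "I \<noteq> 0"
  proof
    assume "I = 0"
    then have "AE x in lborel. ennreal (b x) = 0"
      unfolding I_def by (subst (asm) nn_integral_0_iff_AE) auto
    then have "AE x in lborel. b x = 0"
    proof eventually_elim
      case (elim x)
      then show ?case using b0[of x] by (simp add: ennreal_eq_0_iff)
    qed
    then have "AE x in lborel. x \<notin> ball (0::'a) r"
    proof eventually_elim
      case (elim x)
      then show ?case using bpos[of x] by linarith
    qed
    then have "emeasure lborel (ball (0::'a) r) = 0"
    proof -
      have "{x \<in> space lborel. \<not> x \<notin> ball (0::'a) r} = ball 0 r" by auto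
      from AE_iff_measurable[OF _ this] \<open>AE x in lborel. x \<notin> ball (0::'a) r\<close> show ?thesis by simp
    qed
    then show False using r unit_ball_vol_pos[of "real DIM('a)"] by (simp add: emeasure_ball)
  qed
  ultimately obtain c where c: "I = ennreal c" "0 < c" by (cases I) auto
  show ?thesis
  proof
    show "Ck k (\<lambda>x. 1 / c * b x)" for k by (intro Ck_scale Ckb)
    show "0 \<le> 1 / c * b x" for x using b0[of x] c by simp
    show "1 / c * b x = 0" if "x \<notin> cball 0 r" for x using supp[OF that] by simp
    have "(\<integral>\<^sup>+x. ennreal (1 / c * b x) \<partial>lborel) = ennreal (1 / c) * I"
      unfolding I_def using c by (simp add: ennreal_mult' nn_integral_cmult del: times_divide_eq_left mult_1)
    also have "\<dots> = 1" using c by (simp add: ennreal_mult'[symmetric])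
    finally show "(\<integral>\<^sup>+x. ennreal (1 / c * b x) \<partial>lborel) = 1" .
  qed
qed

text \<open>These are the test functions of the whole space. The class is closed under directional
  derivatives, so kernels and their derivatives are handled alike.\<close>

definition smooth_cs :: "('a::euclidean_space \<Rightarrow> real) \<Rightarrow> bool" where
  "smooth_cs \<rho> \<longleftrightarrow> (\<forall>k. Ck k \<rho>) \<and> (\<exists>S. compact S \<and> (\<forall>x. x \<notin> S \<longrightarrow> \<rho> x = 0))"

lemma smooth_cs_has_derivative:
  "smooth_cs \<rho> \<Longrightarrow> (\<rho> has_derivative frechet_derivative \<rho> (at x)) (at x)"
  unfolding smooth_cs_def using Ck.simps(2) frechet_derivative_works by blast

lemma frechet_derivative_outside_support:
  assumes "closed S" "\<And>x. x \<notin> S \<Longrightarrow> \<rho> x = 0" "x \<notin> S"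
  shows "frechet_derivative \<rho> (at x) v = 0"
proof -
  have "((\<lambda>x. 0) has_derivative (\<lambda>v. 0)) (at x)" by simp
  then have "(\<rho> has_derivative (\<lambda>v. 0)) (at x)"
    by (rule has_derivative_transform_within_open[of _ _ _ _ "- S"]) (use assms in auto)
  then show ?thesis using frechet_derivative_at by metis
qed

lemma smooth_cs_deriv:
  assumes "smooth_cs \<rho>"
  shows "smooth_cs (\<lambda>x. frechet_derivative \<rho> (at x) v)"
proof -
  obtain S where S: "compact S" "\<And>x. x \<notin> S \<Longrightarrow> \<rho> x = 0" using assms unfolding smooth_cs_def by blast
  have "\<And>k. Ck (Suc k) \<rho>" using assms unfolding smooth_cs_def by blast
  then have "\<And>k. Ck k (\<lambda>x. frechet_derivative \<rho> (at x) v)" by simp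
  moreover have "frechet_derivative \<rho> (at x) v = 0" if "x \<notin> S" for x
    using compact_imp_closed[OF S(1)] S(2) that by (rule frechet_derivative_outside_support)
  ultimately show ?thesis
    using S(1) unfolding smooth_cs_def by blast
qed

lemma smooth_cs_uniformly_continuous: "smooth_cs \<rho> \<Longrightarrow> uniformly_continuous_on UNIV \<rho>"
  unfolding smooth_cs_def using compact_support_uniformly_continuous Ck.simps(1) by metis

lemma smooth_cs_continuous: "smooth_cs \<rho> \<Longrightarrow> continuous_on UNIV \<rho>"
  using smooth_cs_uniformly_continuous uniformly_continuous_imp_continuous by blast

lemma smooth_cs_measurable: "smooth_cs \<rho> \<Longrightarrow> \<rho> \<in> borel_measurable borel"
  using smooth_cs_continuous borel_measurable_continuous_onI by blast

lemma smooth_cs_bounded: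
  assumes "smooth_cs \<rho>"
  obtains B where "0 \<le> B" "\<And>x. \<bar>\<rho> x\<bar> \<le> B"
proof -
  obtain S where S: "compact S" "\<And>x. x \<notin> S \<Longrightarrow> \<rho> x = 0" using assms unfolding smooth_cs_def by blast
  have "compact (\<rho> ` S)"
    using S(1) continuous_on_subset[OF smooth_cs_continuous[OF assms], of S] by (intro compact_continuous_image) auto
  then obtain B where B: "\<And>x. x \<in> S \<Longrightarrow> norm (\<rho> x) \<le> B"
    using compact_imp_bounded bounded_iff by (metis imageI)
  show ?thesis
  proof
    show "\<bar>\<rho> x\<bar> \<le> max 0 B" for x using B[of x] S(2)[of x] by (cases "x \<in> S") auto
  qed simp
qed

lemma mvt_line:
  fixes \<rho> :: "'a::euclidean_space \<Rightarrow> real"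
  assumes "\<And>x. (\<rho> has_derivative D x) (at x)"
  obtains t where "0 < t" "t < 1" "\<rho> (z + h) - \<rho> z = D (z + t *\<^sub>R h) h"
proof -
  have "\<exists>x\<in>{0<..<1}. (\<rho> \<circ> (\<lambda>t. z + t *\<^sub>R h)) 1 - (\<rho> \<circ> (\<lambda>t. z + t *\<^sub>R h)) 0 = (\<lambda>t v. D (z + t *\<^sub>R h) (v *\<^sub>R h)) x (1 - 0)"
  proof (rule mvt)
    have "((\<rho> \<circ> (\<lambda>t. z + t *\<^sub>R h)) has_derivative (\<lambda>v. D (z + t *\<^sub>R h) (v *\<^sub>R h))) (at t)" for t
    proof -
      have "((\<lambda>t. z + t *\<^sub>R h) has_derivative (\<lambda>v. v *\<^sub>R h)) (at t)"
        by (auto intro!: derivative_eq_intros)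
      from has_derivative_compose[OF this assms, unfolded o_def[symmetric]] show ?thesis by (simp add: o_def)
    qed
    note der = this
    show "((\<rho> \<circ> (\<lambda>t. z + t *\<^sub>R h)) has_derivative (\<lambda>v. D (z + t *\<^sub>R h) (v *\<^sub>R h))) (at t)" for t
      by (rule der)
    show "continuous_on {0..1} (\<rho> \<circ> (\<lambda>t. z + t *\<^sub>R h))"
      using has_derivative_continuous[OF der] by (intro continuous_at_imp_continuous_on) blast
  qed auto
  then obtain t where t: "t \<in> {0<..<1}" "(\<rho> \<circ> (\<lambda>t. z + t *\<^sub>R h)) 1 - (\<rho> \<circ> (\<lambda>t. z + t *\<^sub>R h)) 0 = D (z + t *\<^sub>R h) ((1 - 0) *\<^sub>R h)"
    by blast
  show ?thesis using that[of t] t by simp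
qed

text \<open>The mean value theorem along the segment reduces the remainder to increments of the
  finitely many partial derivatives, which are uniformly continuous. Uniformity in z lets the
  remainder be integrated against an arbitrary integrable function when a convolution is
  differentiated.\<close>

lemma smooth_cs_uniform_differentiability:
  fixes \<rho> :: "'a::euclidean_space \<Rightarrow> real"
  assumes \<rho>: "smooth_cs \<rho>" and e: "0 < e"
  obtains d where "0 < d" "\<And>z h. norm h < d \<Longrightarrow> \<bar>\<rho> (z + h) - \<rho> z - frechet_derivative \<rho> (at z) h\<bar> \<le> e * norm h"
proof -
  define D where "D z = frechet_derivative \<rho> (at z)" for z
  have D: "(\<rho> has_derivative D z) (at z)" for z unfolding D_def by (rule smooth_cs_has_derivative[OF \<rho>])
  have lin: "linear (D z)" for z using D[of z] has_derivative_linear by blast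
  have "\<exists>d>0. \<forall>x y. dist x y < d \<longrightarrow> dist (D x i) (D y i) < e / real DIM('a)" if "i \<in> Basis" for i
  proof -
    have "uniformly_continuous_on UNIV (\<lambda>z. D z i)"
      unfolding D_def by (intro smooth_cs_uniformly_continuous smooth_cs_deriv \<rho>)
    then show ?thesis using e unfolding uniformly_continuous_on_def by (metis DIM_positive UNIV_I divide_pos_pos of_nat_0_less_iff)
  qed
  then obtain d where d: "\<And>i. i \<in> Basis \<Longrightarrow> 0 < d i"
    "\<And>i x y. i \<in> Basis \<Longrightarrow> dist x y < d i \<Longrightarrow> dist (D x i) (D y i) < e / real DIM('a)" by metis
  define d' where "d' = Min (d ` (Basis::'a set))"
  show ?thesis
  proof
    show "0 < d'" using d(1) by (simp add: d'_def)
    fix z h :: 'a assume h: "norm h < d'"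
    obtain t where t: "0 < t" "t < 1" "\<rho> (z + h) - \<rho> z = D (z + t *\<^sub>R h) h" using mvt_line[OF D] by blast
    have sm: "\<bar>D (z + t *\<^sub>R h) i - D z i\<bar> \<le> e / real DIM('a)" if "i \<in> Basis" for i
    proof -
      have "norm (t *\<^sub>R h) \<le> norm h" using t by (simp add: mult_left_le_one_le)
      then have "dist (z + t *\<^sub>R h) z < d i"
        using h that by (simp add: d'_def dist_norm) (meson le_less_trans)
      from d(2)[OF that this] show ?thesis by (simp add: dist_real_def)
    qed
    have ex: "D w h = (\<Sum>i\<in>Basis. (h \<bullet> i) * D w i)" for w
    proof -
      have "D w h = D w (\<Sum>i\<in>Basis. (h \<bullet> i) *\<^sub>R i)" by (simp add: euclidean_representation)
      also have "\<dots> = (\<Sum>i\<in>Basis. (h \<bullet> i) * D w i)" using lin[of w] by (simp add: linear_sum linear_cmul)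
      finally show ?thesis .
    qed
    have "\<bar>\<rho> (z + h) - \<rho> z - D z h\<bar> = \<bar>\<Sum>i\<in>Basis. (h \<bullet> i) * (D (z + t *\<^sub>R h) i - D z i)\<bar>"
      unfolding t(3) ex[of z] ex[of "z + t *\<^sub>R h"] by (simp add: sum_subtractf algebra_simps)
    also have "\<dots> \<le> (\<Sum>i\<in>(Basis::'a set). norm h * (e / real DIM('a)))"
    proof (rule order_trans[OF sum_abs], intro sum_mono)
      fix i :: 'a assume "i \<in> Basis"
      then show "\<bar>(h \<bullet> i) * (D (z + t *\<^sub>R h) i - D z i)\<bar> \<le> norm h * (e / real DIM('a))"
        unfolding abs_mult by (intro mult_mono Basis_le_norm sm) auto
    qed
    also have "\<dots> = e * norm h" by simp
    finally show "\<bar>\<rho> (z + h) - \<rho> z - frechet_derivative \<rho> (at z) h\<bar> \<le> e * norm h" by (simp add: D_def)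
  qed
qed

section \<open>Convolution of an integrable function with a smooth kernel\<close>

definition convolution :: "('a::euclidean_space \<Rightarrow> real) \<Rightarrow> ('a \<Rightarrow> real) \<Rightarrow> 'a \<Rightarrow> real" where
  "convolution f \<rho> x = (LINT y|lborel. f y * \<rho> (x - y))"

lemma integrable_mult_bdd:
  fixes f g :: "'a::euclidean_space \<Rightarrow> real"
  assumes "integrable lborel f" and [measurable]: "g \<in> borel_measurable borel" and B: "\<And>x. \<bar>g x\<bar> \<le> B"
  shows "integrable lborel (\<lambda>x. f x * g x)"
proof (rule Bochner_Integration.integrable_bound)
  show "integrable lborel (\<lambda>x. B * f x)" using assms(1) by simp
  have [measurable]: "f \<in> borel_measurable borel" using assms(1) by auto
  show "(\<lambda>x. f x * g x) \<in> borel_measurable lborel" by measurable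
  show "AE x in lborel. norm (f x * g x) \<le> norm (B * f x)"
  proof (intro AE_I2)
    fix x
    have "\<bar>f x\<bar> * \<bar>g x\<bar> \<le> \<bar>f x\<bar> * \<bar>B\<bar>" using B[of x] by (intro mult_left_mono) auto
    then show "norm (f x * g x) \<le> norm (B * f x)" by (simp add: abs_mult mult.commute)
  qed
qed

text \<open>The uniform remainder of \<rho> is integrated against f, so the error is at most e' |y -
  x| times the L^1 norm m of f.\<close>

lemma convolution_has_derivative:
  fixes f \<rho> :: "'a::euclidean_space \<Rightarrow> real"
  assumes f: "integrable lborel f" and \<rho>: "smooth_cs \<rho>"
  shows "(convolution f \<rho> has_derivative (\<lambda>v. convolution f (\<lambda>z. frechet_derivative \<rho> (at z) v) x)) (at x)"
proof -
  define D where "D z = frechet_derivative \<rho> (at z)" for z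
  have D: "(\<rho> has_derivative D z) (at z)" for z unfolding D_def by (rule smooth_cs_has_derivative[OF \<rho>])
  have lin: "linear (D z)" for z using D[of z] has_derivative_linear by blast
  have int: "integrable lborel (\<lambda>y. f y * \<sigma> (x - y))" if sc: "smooth_cs \<sigma>" for \<sigma> x
  proof -
    obtain B where "\<And>x. \<bar>\<sigma> x\<bar> \<le> B" using smooth_cs_bounded[OF sc] by blast
    moreover have [measurable]: "\<sigma> \<in> borel_measurable borel" by (rule smooth_cs_measurable[OF sc])
    ultimately show ?thesis by (intro integrable_mult_bdd f) auto
  qed
  have scD: "smooth_cs (\<lambda>z. D z v)" for v unfolding D_def by (rule smooth_cs_deriv[OF \<rho>])
  define m where "m = (LINT y|lborel. \<bar>f y\<bar>)"
  have m: "0 \<le> m" by (simp add: m_def)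
  show ?thesis
    unfolding has_derivative_at_alt D_def[symmetric]
  proof (intro conjI allI impI)
    have "linear (\<lambda>v. convolution f (\<lambda>z. D z v) x)"
    proof (rule linearI)
      show "convolution f (\<lambda>z. D z (a + b)) x = convolution f (\<lambda>z. D z a) x + convolution f (\<lambda>z. D z b) x" for a b
        unfolding convolution_def by (subst Bochner_Integration.integral_add[symmetric]) (auto intro!: int scD simp: linear_add[OF lin] algebra_simps)
      show "convolution f (\<lambda>z. D z (c *\<^sub>R a)) x = c *\<^sub>R convolution f (\<lambda>z. D z a) x" for c a
        unfolding convolution_def by (simp add: linear_cmul[OF lin] mult.left_commute)
    qed
    then show "bounded_linear (\<lambda>v. convolution f (\<lambda>z. D z v) x)" by (rule linear_conv_bounded_linear[THEN iffD1])
    fix e :: real assume e: "0 < e"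
    \<comment> \<open>The added 1 covers m = 0.\<close>
    define e' where "e' = e / (m + 1)"
    have e': "0 < e'" using e m by (simp add: e'_def)
    obtain d where d: "0 < d" "\<And>z h. norm h < d \<Longrightarrow> \<bar>\<rho> (z + h) - \<rho> z - D z h\<bar> \<le> e' * norm h"
      using smooth_cs_uniform_differentiability[OF \<rho> e'] unfolding D_def by blast
    show "\<exists>d>0. \<forall>y. norm (y - x) < d \<longrightarrow>
      norm (convolution f \<rho> y - convolution f \<rho> x - convolution f (\<lambda>z. D z (y - x)) x) \<le> e * norm (y - x)"
    proof (intro exI[of _ d] conjI allI impI)
      fix y assume y: "norm (y - x) < d"
      have "convolution f \<rho> y - convolution f \<rho> x - convolution f (\<lambda>z. D z (y - x)) x =
        (LINT t|lborel. f t * \<rho> (y - t) - f t * \<rho> (x - t) - f t * D (x - t) (y - x))"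
        unfolding convolution_def using int[OF \<rho>] int[OF scD]
        by (simp add: Bochner_Integration.integral_diff)
      also have "norm \<dots> \<le> (LINT t|lborel. (e' * norm (y - x)) * \<bar>f t\<bar>)"
      proof (rule Bochner_Integration.integral_norm_bound_integral)
        show "integrable lborel (\<lambda>t. f t * \<rho> (y - t) - f t * \<rho> (x - t) - f t * D (x - t) (y - x))"
          by (intro Bochner_Integration.integrable_diff int \<rho> int[OF scD])
        show "integrable lborel (\<lambda>t. (e' * norm (y - x)) * \<bar>f t\<bar>)" using f by simp
        fix t
        have "\<bar>\<rho> (y - t) - \<rho> (x - t) - D (x - t) (y - x)\<bar> \<le> e' * norm (y - x)"
          using d(2)[OF y, of "x - t"] by simp
        then have "\<bar>f t\<bar> * \<bar>\<rho> (y - t) - \<rho> (x - t) - D (x - t) (y - x)\<bar> \<le> \<bar>f t\<bar> * (e' * norm (y - x))"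
          by (intro mult_left_mono) auto
        then show "norm (f t * \<rho> (y - t) - f t * \<rho> (x - t) - f t * D (x - t) (y - x)) \<le> (e' * norm (y - x)) * \<bar>f t\<bar>"
          by (simp add: abs_mult[symmetric] right_diff_distrib mult.commute)
      qed
      also have "\<dots> = (e' * m) * norm (y - x)" by (simp add: m_def)
      also have "\<dots> \<le> e * norm (y - x)"
        using m e by (intro mult_right_mono) (auto simp: e'_def field_simps)
      finally show "norm (convolution f \<rho> y - convolution f \<rho> x - convolution f (\<lambda>z. D z (y - x)) x) \<le> e * norm (y - x)" .
    qed (rule d)
  qed
qed

lemma Ck_convolution:
  assumes f: "integrable lborel f" and "smooth_cs \<rho>"
  shows "Ck k (convolution f \<rho>)"
  using assms(2)
proof (induction k arbitrary: \<rho>)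
  case 0
  have "continuous_on UNIV (convolution f \<rho>)"
    using has_derivative_continuous[OF convolution_has_derivative[OF f 0]]
    by (auto simp: continuous_on_eq_continuous_at)
  then show ?case by simp
next
  case (Suc k)
  show ?case
    by (rule Ck_SucI[OF convolution_has_derivative[OF f Suc.prems]]) (intro Suc.IH smooth_cs_deriv Suc.prems)
qed

section \<open>Approximation by test functions\<close>

lemma ennreal_pow_less_top: "ennreal_pow a r < \<infinity> \<longleftrightarrow> a < \<infinity>"
  by (auto simp: ennreal_pow_def less_top)

lemma ennreal_pow_le:
  assumes "a \<le> ennreal c" "0 \<le> c" "0 \<le> r"
  shows "ennreal_pow a r \<le> ennreal (c powr r)"
proof -
  have "a \<noteq> \<infinity>" using assms(1) by (auto simp: top_unique)
  moreover have "enn2real a \<le> c" using assms by (metis enn2real_leI)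
  ultimately show ?thesis using assms by (auto simp: ennreal_pow_def intro!: ennreal_leI powr_mono2)
qed

lemma nn_integral_lebesgue_on:
  assumes [measurable]: "f \<in> borel_measurable borel" "E \<in> sets borel"
  shows "(\<integral>\<^sup>+x. f x \<partial>lebesgue_on E) = (\<integral>\<^sup>+x. indicator E x * f x \<partial>lborel)"
proof -
  have "(\<integral>\<^sup>+x. f x \<partial>lebesgue_on E) = (\<integral>\<^sup>+x. f x * indicator E x \<partial>lebesgue)"
    by (rule nn_integral_restrict_space) simp
  also have "\<dots> = (\<integral>\<^sup>+x. f x * indicator E x \<partial>lborel)"
    by (rule nn_integral_completion)
  finally show ?thesis by (simp add: mult.commute)
qed

text \<open>The exceptional pairs lie in the two null strips over N. An integrand on pairs may
  therefore be evaluated on Borel representatives at both points.\<close>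

lemma AE_lborel_pair:
  fixes P :: "'a::euclidean_space \<Rightarrow> bool"
  assumes "AE x in lborel. P x"
  shows "AE z in lborel. P (fst z) \<and> P (snd (z :: 'a \<times> 'a))"
proof -
  obtain N :: "'a set" where N: "N \<in> null_sets lborel" "{x. \<not> P x} \<subseteq> N"
    using assms by (auto elim!: AE_E simp: null_sets_def)
  have "N \<times> UNIV \<in> null_sets (lborel \<Otimes>\<^sub>M lborel)" "UNIV \<times> N \<in> null_sets (lborel \<Otimes>\<^sub>M lborel)"
    using N(1) by (auto intro: lborel.times_in_null_sets1 lborel.times_in_null_sets2)
  then have "AE z in lborel. z \<notin> N \<times> (UNIV::'a set)" "AE z in lborel. z \<notin> (UNIV :: 'a set) \<times> N"
    unfolding lborel_prod by (auto intro: AE_not_in)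
  then show ?thesis
  proof eventually_elim
    case (elim z)
    then show ?case using N(2) by (cases z) auto
  qed
qed

lemma nn_integral_lborel_pair:
  fixes f :: "'a::euclidean_space \<times> 'b::euclidean_space \<Rightarrow> ennreal"
  assumes "f \<in> borel_measurable borel"
  shows "(\<integral>\<^sup>+z. f z \<partial>lborel) = (\<integral>\<^sup>+x. \<integral>\<^sup>+y. f (x, y) \<partial>lborel \<partial>lborel)"
proof -
  have "f \<in> borel_measurable (lborel \<Otimes>\<^sub>M lborel)"
    using assms by (simp add: lborel_prod)
  from lborel.nn_integral_fst[OF this] show ?thesis by (simp add: lborel_prod)
qed

lemma Lp_norm_eq:
  fixes \<psi> g :: "'a::euclidean_space \<Rightarrow> real"
  assumes [measurable]: "g \<in> borel_measurable borel" "E \<in> sets borel"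
    and ae: "AE x in lborel. x \<in> E \<longrightarrow> \<psi> x = g x"
  shows "Lp_norm q E \<psi> = ennreal_pow (Lp_int q E g) (1 / q)"
proof -
  have "AE x in lebesgue_on E. \<psi> x = g x"
    using ae by (simp add: AE_restrict_space_iff AE_completion_iff)
  then have "(\<integral>\<^sup>+x. ennreal (norm (\<psi> x) powr q) \<partial>lebesgue_on E) = (\<integral>\<^sup>+x. ennreal (\<bar>g x\<bar> powr q) \<partial>lebesgue_on E)"
    by (intro nn_integral_cong_AE) auto
  also have "\<dots> = Lp_int q E g"
    unfolding Lp_int_def by (rule nn_integral_lebesgue_on) auto
  finally show ?thesis by (simp add: Lp_norm_def)
qed

lemma nn_integral_gagliardo:
  fixes G :: "'a::euclidean_space \<Rightarrow> 'b::euclidean_space"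
  assumes [measurable]: "G \<in> borel_measurable borel" "E \<in> sets borel"
  shows "(\<integral>\<^sup>+(x, y). ennreal (norm (G x - G y) powr q / norm (x - y) powr e) \<partial>lebesgue_on (E \<times> E)) =
    (\<integral>\<^sup>+x. \<integral>\<^sup>+y. indicator E x * indicator E y * ennreal (norm (G x - G y) powr q / norm (x - y) powr e) \<partial>lborel \<partial>lborel)"
proof -
  have EE: "E \<times> E \<in> sets borel"
    by (simp add: borel_prod[symmetric])
  have m: "(\<lambda>(x, y). ennreal (norm (G x - G y) powr q / norm (x - y) powr e)) \<in> borel_measurable borel"
    unfolding borel_prod[symmetric] by measurable
  have "(\<integral>\<^sup>+(x, y). ennreal (norm (G x - G y) powr q / norm (x - y) powr e) \<partial>lebesgue_on (E \<times> E)) =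
    (\<integral>\<^sup>+z. indicator (E \<times> E) z * (case z of (x, y) \<Rightarrow> ennreal (norm (G x - G y) powr q / norm (x - y) powr e)) \<partial>lborel)"
    by (rule nn_integral_lebesgue_on[OF m EE])
  also have "\<dots> = (\<integral>\<^sup>+x. \<integral>\<^sup>+y. indicator (E \<times> E) (x, y) * ennreal (norm (G x - G y) powr q / norm (x - y) powr e) \<partial>lborel \<partial>lborel)"
    using EE m by (subst nn_integral_lborel_pair) (auto intro!: borel_measurable_times_ennreal borel_measurable_indicator)
  finally show ?thesis by (simp add: indicator_times)
qed

lemma gagliardo_eq:
  fixes \<psi> g :: "'a::euclidean_space \<Rightarrow> real"
  assumes [measurable]: "g \<in> borel_measurable borel" "E \<in> sets borel"
    and ae: "AE x in lborel. x \<in> E \<longrightarrow> \<psi> x = g x"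
  shows "gagliardo s q E \<psi> = ennreal_pow (gagliardo_int s q E g) (1 / q)"
proof -
  let ?e = "real DIM('a) + s * q"
  have "E \<times> E \<in> sets borel"
    by (simp add: borel_prod[symmetric])
  have "AE z in lebesgue_on (E \<times> E). \<psi> (fst z) = g (fst z) \<and> \<psi> (snd z) = g (snd z)"
  proof -
    have "AE z in lborel. z \<in> E \<times> E \<longrightarrow> \<psi> (fst z) = g (fst z) \<and> \<psi> (snd z) = g (snd z)"
      using AE_lborel_pair[OF ae] by eventually_elim auto
    then show ?thesis using \<open>E \<times> E \<in> sets borel\<close>
      by (subst AE_restrict_space_iff) (simp, subst AE_completion_iff, assumption)
  qed
  then have "(\<integral>\<^sup>+(x, y). ennreal (norm (\<psi> x - \<psi> y) powr q / norm (x - y) powr ?e) \<partial>lebesgue_on (E \<times> E)) =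
     (\<integral>\<^sup>+(x, y). ennreal (norm (g x - g y) powr q / norm (x - y) powr ?e) \<partial>lebesgue_on (E \<times> E))"
    by (intro nn_integral_cong_AE, elim eventually_mono) auto
  also have "\<dots> = gagliardo_int s q E g"
    unfolding gagliardo_int_def by (subst nn_integral_gagliardo) simp_all
  finally show ?thesis by (simp add: gagliardo_def)
qed

text \<open>The integral is split at |x - y| = 1. Near the diagonal the Lipschitz bound leaves the
  power p(1-s) - N, integrable because s < 1; away from it the increments of \<zeta> are at most 1
  and the power -sp - N is integrable because s > 0. A majorant depending only on x - y makes the
  bound uniform in x.\<close>

lemma kernel_cutoff_bound:
  fixes \<zeta> :: "'a::euclidean_space \<Rightarrow> real"
  assumes [measurable]: "\<zeta> \<in> borel_measurable borel" and \<zeta>: "\<And>x. 0 \<le> \<zeta> x" "\<And>x. \<zeta> x \<le> 1"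
    and lip: "\<And>x y. \<bar>\<zeta> x - \<zeta> y\<bar> \<le> L * norm (x - y)" "0 \<le> L"
    and s: "0 < s" "s < 1" and p: "1 \<le> p"
  obtains C where "0 \<le> C"
    "\<And>x. (\<integral>\<^sup>+y. ennreal (\<bar>\<zeta> x - \<zeta> y\<bar> powr p / norm (x - y) powr (real DIM('a) + s * p)) \<partial>lborel) \<le> ennreal C"
proof -
  define G where "G z = ennreal (L powr p) * (indicator (ball (0::'a) 1) z * ennreal (norm z powr (p * (1 - s) - real DIM('a))))
      + indicator (- ball (0::'a) 1) z * ennreal (norm z powr (- (s * p) - real DIM('a)))" for z
  have [measurable]: "indicator (ball (0::'a) 1) \<in> borel_measurable borel" "indicator (- ball (0::'a) 1) \<in> borel_measurable borel"
    by (intro borel_measurable_indicator; simp)+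
  have [measurable]: "G \<in> borel_measurable borel" unfolding G_def[abs_def] by measurable
  have "(\<integral>\<^sup>+z. G z \<partial>lborel) < \<infinity>"
    unfolding G_def using s p radial_integral_near_finite[of "p * (1 - s)" 1, where 'a='a] radial_integral_far_finite[of "s * p" 1, where 'a='a]
    by (subst nn_integral_add) (auto simp: nn_integral_cmult ennreal_mult_less_top)
  then obtain C where C: "(\<integral>\<^sup>+z. G z \<partial>lborel) = ennreal C" "0 \<le> C" by (cases "\<integral>\<^sup>+z. G z \<partial>lborel") auto
  show ?thesis
  proof
    fix x
    have "(\<integral>\<^sup>+y. ennreal (\<bar>\<zeta> x - \<zeta> y\<bar> powr p / norm (x - y) powr (real DIM('a) + s * p)) \<partial>lborel) \<le> (\<integral>\<^sup>+y. G (x - y) \<partial>lborel)"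
    proof (rule nn_integral_mono)
      fix y
      let ?n = "norm (x - y)"
      consider "x = y" | "x \<noteq> y" "?n < 1" | "1 \<le> ?n" by linarith
      then show "ennreal (\<bar>\<zeta> x - \<zeta> y\<bar> powr p / ?n powr (real DIM('a) + s * p)) \<le> G (x - y)"
      proof cases
        case 2
        have "\<bar>\<zeta> x - \<zeta> y\<bar> powr p \<le> (L * ?n) powr p" using p lip by (intro powr_mono2) auto
        then have "\<bar>\<zeta> x - \<zeta> y\<bar> powr p / ?n powr (real DIM('a) + s * p) \<le> (L * ?n) powr p / ?n powr (real DIM('a) + s * p)"
          by (intro divide_right_mono) auto
        also have "\<dots> = L powr p * ?n powr (p * (1 - s) - real DIM('a))"
          using 2 lip(2) by (simp add: powr_mult powr_diff[symmetric] algebra_simps flip: times_divide_eq_right)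
        finally have "ennreal (\<bar>\<zeta> x - \<zeta> y\<bar> powr p / ?n powr (real DIM('a) + s * p)) \<le> ennreal (L powr p) * ennreal (?n powr (p * (1 - s) - real DIM('a)))"
          by (simp add: ennreal_mult'[symmetric] ennreal_leI)
        then show ?thesis using 2 by (simp add: G_def)
      next
        case 3
        have "\<bar>\<zeta> x - \<zeta> y\<bar> \<le> 1" using \<zeta>[of x] \<zeta>[of y] by auto
        then have "\<bar>\<zeta> x - \<zeta> y\<bar> powr p \<le> 1" using p by (intro powr_le1) auto
        then have "\<bar>\<zeta> x - \<zeta> y\<bar> powr p / ?n powr (real DIM('a) + s * p) \<le> 1 / ?n powr (real DIM('a) + s * p)"
          by (intro divide_right_mono) auto
        also have "\<dots> = ?n powr (- (s * p) - real DIM('a))"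
          using powr_minus_divide[of ?n "real DIM('a) + s * p"] by (simp add: add.commute)
        finally have "ennreal (\<bar>\<zeta> x - \<zeta> y\<bar> powr p / ?n powr (real DIM('a) + s * p)) \<le> ennreal (?n powr (- (s * p) - real DIM('a)))"
          by (rule ennreal_leI)
        then show ?thesis using 3 by (simp add: G_def)
      qed simp
    qed
    also have "\<dots> = ennreal C" by (simp add: nn_integral_lborel_reflect C)
    finally show "(\<integral>\<^sup>+y. ennreal (\<bar>\<zeta> x - \<zeta> y\<bar> powr p / norm (x - y) powr (real DIM('a) + s * p)) \<partial>lborel) \<le> ennreal C" .
  qed (rule C)
qed

text \<open>Discrete product rule: \<zeta> y multiplies the increment of w, and w x multiplies that
  of \<zeta>. The second part is integrated in y first, by the uniform kernel bound.\<close>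

lemma gagliardo_int_mult_cutoff_finite:
  fixes w \<zeta> :: "'a::euclidean_space \<Rightarrow> real"
  assumes [measurable]: "w \<in> borel_measurable borel" "\<zeta> \<in> borel_measurable borel"
    and \<zeta>: "\<And>x. 0 \<le> \<zeta> x" "\<And>x. \<zeta> x \<le> 1"
    and lip: "\<And>x y. \<bar>\<zeta> x - \<zeta> y\<bar> \<le> L * norm (x - y)" "0 \<le> L"
    and s: "0 < s" "s < 1" and p: "1 \<le> p"
    and w: "Lp_int p UNIV w < \<infinity>" "gagliardo_int s p UNIV w < \<infinity>"
  shows "gagliardo_int s p UNIV (\<lambda>x. w x * \<zeta> x) < \<infinity>"
proof -
  let ?e = "real DIM('a) + s * p"
  obtain C where C: "0 \<le> C" "\<And>x. (\<integral>\<^sup>+y. ennreal (\<bar>\<zeta> x - \<zeta> y\<bar> powr p / norm (x - y) powr ?e) \<partial>lborel) \<le> ennreal C"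
    using kernel_cutoff_bound[OF assms(2) \<zeta> lip s p] by blast
  have "gagliardo_int s p UNIV (\<lambda>x. w x * \<zeta> x) \<le> (\<integral>\<^sup>+x. \<integral>\<^sup>+y. ennreal (2 powr p) * (ennreal (\<bar>w x - w y\<bar> powr p / norm (x - y) powr ?e)
     + ennreal (\<bar>w x\<bar> powr p) * ennreal (\<bar>\<zeta> x - \<zeta> y\<bar> powr p / norm (x - y) powr ?e)) \<partial>lborel \<partial>lborel)"
    unfolding gagliardo_int_def
  proof (intro nn_integral_mono)
    fix x y
    have "\<bar>w x * \<zeta> x - w y * \<zeta> y\<bar> powr p = \<bar>(w x - w y) * \<zeta> y + w x * (\<zeta> x - \<zeta> y)\<bar> powr p"
      by (simp add: algebra_simps)
    also have "\<dots> \<le> 2 powr p * (\<bar>(w x - w y) * \<zeta> y\<bar> powr p + \<bar>w x * (\<zeta> x - \<zeta> y)\<bar> powr p)"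
      using p by (intro powr_abs_add_le) auto
    also have "\<dots> \<le> 2 powr p * (\<bar>w x - w y\<bar> powr p + \<bar>w x\<bar> powr p * \<bar>\<zeta> x - \<zeta> y\<bar> powr p)"
    proof (intro mult_left_mono add_mono)
      have "\<bar>(w x - w y) * \<zeta> y\<bar> \<le> \<bar>w x - w y\<bar>"
        using \<zeta>[of y] by (simp add: abs_mult mult_left_le)
      then show "\<bar>(w x - w y) * \<zeta> y\<bar> powr p \<le> \<bar>w x - w y\<bar> powr p"
        using p by (intro powr_mono2) auto
      show "\<bar>w x * (\<zeta> x - \<zeta> y)\<bar> powr p \<le> \<bar>w x\<bar> powr p * \<bar>\<zeta> x - \<zeta> y\<bar> powr p"
        by (simp add: abs_mult powr_mult)
    qed simp
    finally have "\<bar>w x * \<zeta> x - w y * \<zeta> y\<bar> powr p / norm (x - y) powr ?e \<le>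
        2 powr p * (\<bar>w x - w y\<bar> powr p + \<bar>w x\<bar> powr p * \<bar>\<zeta> x - \<zeta> y\<bar> powr p) / norm (x - y) powr ?e"
      by (intro divide_right_mono) auto
    also have "\<dots> = 2 powr p * (\<bar>w x - w y\<bar> powr p / norm (x - y) powr ?e + \<bar>w x\<bar> powr p * (\<bar>\<zeta> x - \<zeta> y\<bar> powr p / norm (x - y) powr ?e))"
      by (simp add: add_divide_distrib ring_distribs)
    finally have "ennreal (\<bar>w x * \<zeta> x - w y * \<zeta> y\<bar> powr p / norm (x - y) powr ?e) \<le> ennreal \<dots>"
      by (rule ennreal_leI)
    also have "\<dots> = ennreal (2 powr p) * (ennreal (\<bar>w x - w y\<bar> powr p / norm (x - y) powr ?e)
     + ennreal (\<bar>w x\<bar> powr p) * ennreal (\<bar>\<zeta> x - \<zeta> y\<bar> powr p / norm (x - y) powr ?e))"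
      by (simp only: ennreal_mult' ennreal_plus add_nonneg_nonneg mult_nonneg_nonneg powr_ge_zero divide_nonneg_nonneg)
    finally show "indicator UNIV x * indicator UNIV y * ennreal (\<bar>w x * \<zeta> x - w y * \<zeta> y\<bar> powr p / norm (x - y) powr ?e)
      \<le> ennreal (2 powr p) * (ennreal (\<bar>w x - w y\<bar> powr p / norm (x - y) powr ?e)
     + ennreal (\<bar>w x\<bar> powr p) * ennreal (\<bar>\<zeta> x - \<zeta> y\<bar> powr p / norm (x - y) powr ?e))"
      by simp
  qed
  also have "\<dots> = ennreal (2 powr p) * (gagliardo_int s p UNIV w + (\<integral>\<^sup>+x. ennreal (\<bar>w x\<bar> powr p) * (\<integral>\<^sup>+y. ennreal (\<bar>\<zeta> x - \<zeta> y\<bar> powr p / norm (x - y) powr ?e) \<partial>lborel) \<partial>lborel))"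
    unfolding gagliardo_int_def by (simp add: nn_integral_cmult nn_integral_add)
  also have "\<dots> \<le> ennreal (2 powr p) * (gagliardo_int s p UNIV w + (\<integral>\<^sup>+x. ennreal (\<bar>w x\<bar> powr p) * ennreal C \<partial>lborel))"
    by (intro mult_left_mono add_left_mono nn_integral_mono C) auto
  also have "\<dots> = ennreal (2 powr p) * (gagliardo_int s p UNIV w + Lp_int p UNIV w * ennreal C)"
    unfolding Lp_int_def by (simp add: nn_integral_multc)
  also have "\<dots> < \<infinity>" using w by (simp add: ennreal_mult_less_top)
  finally show ?thesis .
qed

text \<open>Reading the seminorm as an L^p norm over pairs makes the triangle inequality and the
  continuity of translations, both on the product space, available for it.\<close>

lemma gagliardo_int_eq_Lp_int:
  fixes w :: "'a::euclidean_space \<Rightarrow> real"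
  assumes [measurable]: "w \<in> borel_measurable borel" and q: "0 < q"
  shows "gagliardo_int s q UNIV w = Lp_int q UNIV (\<lambda>z. (w (fst z) - w (snd z)) / norm (fst z - snd z) powr ((real DIM('a) + s * q) / q))"
proof -
  have m: "(\<lambda>z. ennreal (\<bar>(w (fst z) - w (snd z)) / norm (fst z - snd z) powr ((real DIM('a) + s * q) / q)\<bar> powr q)) \<in> borel_measurable borel"
    unfolding borel_prod[symmetric] by measurable
  have "\<bar>d / n powr (e / q)\<bar> powr q = \<bar>d\<bar> powr q / n powr e" for d n e :: real
    using q by (simp add: abs_divide powr_divide powr_powr)
  then show ?thesis
    unfolding Lp_int_def gagliardo_int_def using nn_integral_lborel_pair[OF m] by simp
qed

lemma integral_lborel_reflect:
  fixes c :: "'a::euclidean_space" and f :: "'a \<Rightarrow> real"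
  assumes [measurable]: "f \<in> borel_measurable borel"
  shows "(LINT x|lborel. f (c - x)) = (LINT x|lborel. f x)"
proof -
  have "lborel = distr lborel borel (\<lambda>x. c - x)"
    using lborel_affine[of "-1" c] by (simp add: density_1)
  then have "(LINT x|lborel. f x) = (LINT x|distr lborel borel (\<lambda>x. c - x). f x)"
    by simp
  also have "\<dots> = (LINT x|lborel. f (c - x))"
    by (rule integral_distr) auto
  finally show ?thesis by simp
qed

lemma integrable_of_Lp_int:
  fixes f :: "'a::euclidean_space \<Rightarrow> real"
  assumes [measurable]: "f \<in> borel_measurable borel" and S: "bounded S" "\<And>x. x \<notin> S \<Longrightarrow> f x = 0"
    and p: "1 \<le> p" and fin: "Lp_int p UNIV f < \<infinity>"
  shows "integrable lborel f"
proof -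
  obtain R where R: "S \<subseteq> ball 0 R" using bounded_subset_ballD[OF S(1)] by blast
  have [measurable]: "indicator (ball (0::'a) R) \<in> borel_measurable borel"
    by (intro borel_measurable_indicator) simp
  have "(\<integral>\<^sup>+x. ennreal (norm (f x)) \<partial>lborel) \<le> (\<integral>\<^sup>+x. indicator (ball (0::'a) R) x + ennreal (\<bar>f x\<bar> powr p) \<partial>lborel)"
  proof (rule nn_integral_mono)
    fix x
    show "ennreal (norm (f x)) \<le> indicator (ball (0::'a) R) x + ennreal (\<bar>f x\<bar> powr p)"
    proof (cases "x \<in> S")
      case True
      have "\<bar>f x\<bar> \<le> 1 + \<bar>f x\<bar> powr p" using le_truncation[of "\<bar>f x\<bar>" 1 p] p by simp
      then have "ennreal (norm (f x)) \<le> ennreal (1 + \<bar>f x\<bar> powr p)" by (intro ennreal_leI) simp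
      then show ?thesis using True R by (simp add: subset_iff)
    qed (simp add: S)
  qed
  also have "\<dots> = emeasure lborel (ball (0::'a) R) + Lp_int p UNIV f"
    unfolding Lp_int_def by (simp add: nn_integral_add)
  also have "\<dots> < \<infinity>" using fin emeasure_lborel_ball_less_top[of "0::'a" R] by simp
  finally show ?thesis by (intro integrableI_bounded) auto
qed

text \<open>The weight depends on x - y only, so the quotient belonging to the mollified function is
  the mollification of F along the diagonal translations (z, z). Continuity of translations over
  pairs therefore gives convergence in the Gagliardo seminorm in the same way as in L^p.\<close>

lemma mollified_approximation:
  fixes \<phi> :: "'a::euclidean_space \<Rightarrow> real"
  assumes \<phi>[measurable]: "\<phi> \<in> borel_measurable borel" and S: "compact S" "S \<subseteq> \<Omega>" "\<And>x. x \<notin> S \<Longrightarrow> \<phi> x = 0"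
    and \<Omega>: "open \<Omega>" and p: "1 \<le> p" and fin: "Lp_int p UNIV \<phi> < \<infinity>" "gagliardo_int s p UNIV \<phi> < \<infinity>"
    and e: "0 < e"
  obtains \<psi> where "\<psi> \<in> test_functions \<Omega>" "\<psi> \<in> borel_measurable borel"
    "Lp_int p UNIV (\<lambda>x. \<psi> x - \<phi> x) \<le> ennreal e" "gagliardo_int s p UNIV (\<lambda>x. \<psi> x - \<phi> x) \<le> ennreal e"
proof -
  define ex where "ex = (real DIM('a) + s * p) / p"
  define F where "F z = (\<phi> (fst z) - \<phi> (snd z)) / norm (fst z - snd z) powr ex" for z
  have [measurable]: "F \<in> borel_measurable borel"
    unfolding F_def[abs_def] borel_prod[symmetric] by measurable
  have finF: "Lp_int p UNIV F < \<infinity>"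
    using fin(2) gagliardo_int_eq_Lp_int[OF \<phi>, of p s] p by (simp add: F_def[abs_def] ex_def)
  define e' where "e' = e / 2 powr p"
  have e': "0 < e'" using e by (simp add: e'_def)
  have p0: "0 < p" using p by simp
  obtain d1 where d1: "0 < d1" "\<And>z. norm z < d1 \<Longrightarrow> translation_int p UNIV \<phi> z \<le> ennreal e'"
    using translation_int_tendsto_0[OF \<phi> p0 fin(1) e'] by blast
  obtain d2 where d2: "0 < d2" "\<And>z. norm z < d2 \<Longrightarrow> translation_int p UNIV F z \<le> ennreal e'"
    using translation_int_tendsto_0[OF \<open>F \<in> borel_measurable borel\<close> p0 finF e'] by blast
  obtain r0 where r0: "0 < r0" "(\<Union>x\<in>S. cball x r0) \<subseteq> \<Omega>"
    using compact_subset_open_imp_cball_epsilon_subset[OF S(1) \<Omega> S(2)] by blast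
  \<comment> \<open>r0 keeps the mollified support inside \<Omega>. The shift (z, z) has norm at
    most 2|z|, so d2 is divided by 4 where d1 is divided by 2; the spare factor 2 yields strict
    inequalities.\<close>
  define r where "r = min r0 (min (d1 / 2) (d2 / 4))"
  have r: "0 < r" "r \<le> r0" "r < d1" "2 * r < d2" using r0 d1 d2 by (auto simp: r_def)
  obtain \<rho> :: "'a \<Rightarrow> real" where \<rho>: "\<And>k. Ck k \<rho>" "\<And>x. 0 \<le> \<rho> x" "\<And>x. x \<notin> cball 0 r \<Longrightarrow> \<rho> x = 0"
    "(\<integral>\<^sup>+x. ennreal (\<rho> x) \<partial>lborel) = 1" using mollifier_exists[OF r(1)] by blast
  have sm: "smooth_cs \<rho>" unfolding smooth_cs_def using \<rho>(1,3) by (auto intro!: exI[of _ "cball 0 r"])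
  have [measurable]: "\<rho> \<in> borel_measurable borel" by (rule smooth_cs_measurable[OF sm])
  have int\<phi>: "integrable lborel \<phi>"
    by (rule integrable_of_Lp_int[OF \<phi> compact_imp_bounded[OF S(1)] S(3) p fin(1)])
  have int\<rho>: "integrable lborel \<rho>"
    using \<rho>(2,4) by (intro integrableI_nonneg) auto
  have I\<rho>: "(LINT z|lborel. \<rho> z) = 1"
    using \<rho>(2,4) by (subst integral_eq_nn_integral) auto
  obtain B where B: "\<And>x. \<bar>\<rho> x\<bar> \<le> B" using smooth_cs_bounded[OF sm] by blast
  have int: "integrable lborel (\<lambda>z. \<phi> (x - z) * \<rho> z)" for x
  proof -
    have "integrable lborel (\<lambda>y. \<phi> y * \<rho> (x - y))"
      by (rule integrable_mult_bdd[OF int\<phi> _ B]) measurable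
    then have "(\<integral>\<^sup>+y. ennreal \<bar>\<phi> y * \<rho> (x - y)\<bar> \<partial>lborel) < \<infinity>"
      by (simp add: integrable_iff_bounded)
    moreover have "(\<integral>\<^sup>+y. ennreal \<bar>\<phi> y * \<rho> (x - y)\<bar> \<partial>lborel) = (\<integral>\<^sup>+z. ennreal \<bar>\<phi> (x - z) * \<rho> z\<bar> \<partial>lborel)"
      using nn_integral_lborel_reflect[of "\<lambda>y. ennreal \<bar>\<phi> y * \<rho> (x - y)\<bar>" x] by simp
    ultimately show ?thesis by (intro integrableI_bounded) auto
  qed
  define \<psi> where "\<psi> = convolution \<phi> \<rho>"
  have \<psi>: "\<psi> x = (LINT z|lborel. \<phi> (x - z) * \<rho> z)" for x
    using integral_lborel_reflect[of "\<lambda>y. \<phi> y * \<rho> (x - y)" x] by (simp add: \<psi>_def convolution_def)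
  have diff: "\<psi> x - \<phi> x = (LINT z|lborel. (\<phi> (x - z) - \<phi> x) * \<rho> z)" for x
    unfolding \<psi> left_diff_distrib using int[of x] int\<rho> I\<rho> by simp
  have Ck\<psi>: "Ck k \<psi>" for k unfolding \<psi>_def by (rule Ck_convolution[OF int\<phi> sm])
  then have [measurable]: "\<psi> \<in> borel_measurable borel"
    using Ck.simps(1) borel_measurable_continuous_onI by blast
  show ?thesis
  proof
    show "\<psi> \<in> test_functions \<Omega>"
      unfolding test_functions_def
    proof (intro CollectI conjI allI exI[of _ "{x + y | x y. x \<in> S \<and> y \<in> cball 0 r}"] impI)
      show "compact {x + y |x y. x \<in> S \<and> y \<in> cball 0 r}" by (intro compact_sums S(1) compact_cball)
      show "{x + y |x y. x \<in> S \<and> y \<in> cball 0 r} \<subseteq> \<Omega>"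
      proof (rule order_trans[OF _ r0(2)], clarify)
        fix x y :: 'a assume "x \<in> S" "y \<in> cball 0 r"
        then show "x + y \<in> (\<Union>x\<in>S. cball x r0)" using r by (auto intro!: bexI[of _ x] simp: dist_norm)
      qed
      fix x assume x: "x \<notin> {x + y |x y. x \<in> S \<and> y \<in> cball 0 r}"
      have z: "\<phi> y * \<rho> (x - y) = 0" for y
      proof (cases "y \<in> S")
        case True
        have "x - y \<notin> cball 0 r"
        proof
          assume "x - y \<in> cball 0 r"
          then have "y + (x - y) \<in> {x + y |x y. x \<in> S \<and> y \<in> cball 0 r}" using True by blast
          then show False using x by simp
        qed
        then show ?thesis using \<rho>(3) by simp
      qed (simp add: S(3))
      show "\<psi> x = 0" by (simp only: \<psi>_def convolution_def z Bochner_Integration.integral_zero)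
    qed (rule Ck\<psi>)
    have two: "ennreal (2 powr p) * ennreal e' = ennreal e"
      by (simp add: e'_def ennreal_mult'[symmetric])
    have "Lp_int p UNIV (\<lambda>x. LINT z|lborel. (\<phi> (x - z) - \<phi> x) * \<rho> z) \<le> ennreal (2 powr p) * ennreal e'"
    proof (rule Lp_int_mollify_le[OF \<phi>, where L = "\<lambda>z. z"])
      show "translation_int p UNIV \<phi> (- z) \<le> ennreal e'" if "\<rho> z \<noteq> 0" for z
      proof (rule d1)
        have "z \<in> cball 0 r" using \<rho>(3) that by blast
        then show "norm (- z) < d1" using r by simp
      qed
    qed (use \<rho> p in auto)
    then show "Lp_int p UNIV (\<lambda>x. \<psi> x - \<phi> x) \<le> ennreal e" by (simp add: diff two)
    have "Lp_int p UNIV (\<lambda>x. LINT z|lborel. (F (x - (z, z)) - F x) * \<rho> z) \<le> ennreal (2 powr p) * ennreal e'"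
    proof (rule Lp_int_mollify_le[where L = "\<lambda>z. (z, z)"])
      show "(\<lambda>z::'a. (z, z)) \<in> borel_measurable borel"
        unfolding borel_prod[symmetric] by measurable
      show "translation_int p UNIV F (- (z, z)) \<le> ennreal e'" if "\<rho> z \<noteq> 0" for z
      proof (rule d2)
        have "norm (- (z, z)) \<le> norm z + norm z"
          unfolding norm_minus_cancel norm_Pair by (rule sqrt_sum_squares_le_sum) auto
        moreover have "z \<in> cball 0 r" using \<rho>(3) that by blast
        ultimately show "norm (- (z, z)) < d2" using r by simp
      qed
    qed (use \<rho> p in auto)
    moreover have "(LINT z|lborel. (F (x - (z, z)) - F x) * \<rho> z) =
       ((\<psi> (fst x) - \<phi> (fst x)) - (\<psi> (snd x) - \<phi> (snd x))) / norm (fst x - snd x) powr ex" for x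
    proof -
      have i: "integrable lborel (\<lambda>z. (\<phi> (x - z) - \<phi> x) * \<rho> z)" for x
        unfolding left_diff_distrib using int[of x] int\<rho> by simp
      have "(F (x - (z, z)) - F x) * \<rho> z =
        ((\<phi> (fst x - z) - \<phi> (fst x)) * \<rho> z - (\<phi> (snd x - z) - \<phi> (snd x)) * \<rho> z) / norm (fst x - snd x) powr ex" for z
        by (simp add: F_def diff_divide_distrib add_divide_distrib algebra_simps)
      then show ?thesis
        unfolding diff using i[of "fst x"] i[of "snd x"] by (simp add: Bochner_Integration.integral_diff)
    qed
    ultimately have "Lp_int p UNIV (\<lambda>x. ((\<psi> (fst x) - \<phi> (fst x)) - (\<psi> (snd x) - \<phi> (snd x))) / norm (fst x - snd x) powr ex) \<le> ennreal e"
      by (simp add: two)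
    then show "gagliardo_int s p UNIV (\<lambda>x. \<psi> x - \<phi> x) \<le> ennreal e"
      using p by (subst gagliardo_int_eq_Lp_int) (auto simp: ex_def)
  qed measurable
qed

text \<open>This is the source of the functions inserted into the equation: cut-off differences of u
  have only Sobolev regularity, and compact support inside \<Omega> leaves room to mollify
  them.\<close>

lemma frac_sobolev0_memI:
  fixes \<phi> :: "'a::euclidean_space \<Rightarrow> real"
  assumes \<phi>[measurable]: "\<phi> \<in> borel_measurable borel" and S: "compact S" "S \<subseteq> \<Omega>" "\<And>x. x \<notin> S \<Longrightarrow> \<phi> x = 0"
    and \<Omega>: "open \<Omega>" and p: "1 \<le> p" and fin: "Lp_int p UNIV \<phi> < \<infinity>" "gagliardo_int s p UNIV \<phi> < \<infinity>"
  shows "\<phi> \<in> frac_sobolev0 s p \<Omega>"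
proof -
  have "\<exists>\<psi>. \<psi> \<in> test_functions \<Omega> \<and> \<psi> \<in> borel_measurable borel \<and>
    Lp_int p UNIV (\<lambda>x. \<psi> x - \<phi> x) \<le> ennreal (1 / real (Suc n)) \<and> gagliardo_int s p UNIV (\<lambda>x. \<psi> x - \<phi> x) \<le> ennreal (1 / real (Suc n))" for n
    using mollified_approximation[OF \<phi> S \<Omega> p fin, of "1 / real (Suc n)"] by (metis of_nat_0_less_iff zero_less_Suc zero_less_divide_1_iff)
  then obtain \<psi> where \<psi>: "\<And>n. \<psi> n \<in> test_functions \<Omega>" "\<And>n. \<psi> n \<in> borel_measurable borel"
    "\<And>n. Lp_int p UNIV (\<lambda>x. \<psi> n x - \<phi> x) \<le> ennreal (1 / real (Suc n))"
    "\<And>n. gagliardo_int s p UNIV (\<lambda>x. \<psi> n x - \<phi> x) \<le> ennreal (1 / real (Suc n))" by metis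
  note [measurable] = \<psi>(2)
  \<comment> \<open>The p-th root converts bounds on the integrals into bounds on the norms.\<close>
  define c where "c n = (1 / real (Suc n)) powr (1 / p)" for n
  have "c \<longlonglongrightarrow> 0 powr (1 / p)"
    unfolding c_def[abs_def] using p by (intro tendsto_powr' tendsto_const LIMSEQ_Suc lim_1_over_n) auto
  then have lim: "(\<lambda>n. ennreal (c n + c n)) \<longlonglongrightarrow> ennreal (0 + 0)"
    using p by (intro tendsto_ennrealI tendsto_add) auto
  have "Lp_norm p \<Omega> (\<lambda>x. \<psi> n x - \<phi> x) + gagliardo s p UNIV (\<lambda>x. \<psi> n x - \<phi> x) \<le> ennreal (c n + c n)" for n
  proof -
    have [measurable]: "\<Omega> \<in> sets borel" using \<Omega> by simp
    have "Lp_int p \<Omega> (\<lambda>x. \<psi> n x - \<phi> x) \<le> Lp_int p UNIV (\<lambda>x. \<psi> n x - \<phi> x)"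
      by (rule Lp_int_mono_set) simp
    then have "Lp_norm p \<Omega> (\<lambda>x. \<psi> n x - \<phi> x) \<le> ennreal (c n)"
      unfolding c_def using \<psi>(3)[of n] p
      by (subst Lp_norm_eq[where g = "\<lambda>x. \<psi> n x - \<phi> x"]) (auto intro!: ennreal_pow_le)
    moreover have "gagliardo s p UNIV (\<lambda>x. \<psi> n x - \<phi> x) \<le> ennreal (c n)"
      unfolding c_def using \<psi>(4)[of n] p
      by (subst gagliardo_eq[where g = "\<lambda>x. \<psi> n x - \<phi> x"]) (auto intro!: ennreal_pow_le)
    moreover have "0 \<le> c n" by (simp add: c_def)
    ultimately show ?thesis by (subst ennreal_plus) (auto intro: add_mono)
  qed
  note le = this
  have "(\<lambda>n. Lp_norm p \<Omega> (\<lambda>x. \<psi> n x - \<phi> x) + gagliardo s p UNIV (\<lambda>x. \<psi> n x - \<phi> x)) \<longlonglongrightarrow> 0"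
  proof (rule tendsto_sandwich[where f = "\<lambda>_. 0" and h = "\<lambda>n. ennreal (c n + c n)"])
    show "(\<lambda>n. ennreal (c n + c n)) \<longlonglongrightarrow> 0" using lim by simp
    show "\<forall>\<^sub>F n in sequentially. Lp_norm p \<Omega> (\<lambda>x. \<psi> n x - \<phi> x) + gagliardo s p UNIV (\<lambda>x. \<psi> n x - \<phi> x) \<le> ennreal (c n + c n)"
      using le by (intro always_eventually) blast
  qed auto
  moreover have "AE x in lebesgue. x \<notin> \<Omega> \<longrightarrow> \<phi> x = 0" using S by (intro AE_I2) auto
  ultimately show ?thesis
    unfolding frac_sobolev0_def using \<psi>(1) by (auto simp: measurable_completion)
qed

section \<open>The equation for differences\<close>

lemma integral_lborel_pair_translate:
  fixes f :: "'a::euclidean_space \<times> 'a \<Rightarrow> real"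
  assumes "f \<in> borel_measurable borel"
  shows "(LINT z|lborel. f (fst z + h, snd z + h)) = (LINT z|lborel. f z)"
  using integral_lborel_translate[OF assms, of "(h, h)"] by (simp add: plus_prod_def)

lemma translation_int_mono_set: "C \<subseteq> D \<Longrightarrow> translation_int q C w h \<le> translation_int q D w h"
  unfolding translation_int_def by (intro nn_integral_mono) (auto simp: indicator_def)

lemma gagliardo_int_translate:
  assumes [measurable]: "w \<in> borel_measurable borel"
  shows "gagliardo_int s q UNIV (\<lambda>x. w (x + h)) = gagliardo_int s q UNIV (w :: 'a::euclidean_space \<Rightarrow> real)"
proof -
  define G where "G x y = ennreal (\<bar>w x - w y\<bar> powr q / norm (x - y) powr (real DIM('a) + s * q))" for x y
  have [measurable]: "case_prod G \<in> borel_measurable (borel \<Otimes>\<^sub>M borel)"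
    unfolding G_def[abs_def] by measurable
  have "gagliardo_int s q UNIV (\<lambda>x. w (x + h)) = (\<integral>\<^sup>+x. \<integral>\<^sup>+y. G (x + h) (y + h) \<partial>lborel \<partial>lborel)"
    by (simp add: gagliardo_int_def G_def)
  also have "\<dots> = (\<integral>\<^sup>+x. \<integral>\<^sup>+y. G (x + h) y \<partial>lborel \<partial>lborel)"
    by (intro nn_integral_cong nn_integral_lborel_translate) measurable
  also have "\<dots> = (\<integral>\<^sup>+x. \<integral>\<^sup>+y. G x y \<partial>lborel \<partial>lborel)"
    by (rule nn_integral_lborel_translate) measurable
  also have "\<dots> = gagliardo_int s q UNIV w" by (simp add: gagliardo_int_def G_def)
  finally show ?thesis .
qed

lemma gagliardo_int_diff_finite:
  fixes v w :: "'a::euclidean_space \<Rightarrow> real"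
  assumes [measurable]: "v \<in> borel_measurable borel" "w \<in> borel_measurable borel" and q: "0 < q"
    and fin: "gagliardo_int s q UNIV v < \<infinity>" "gagliardo_int s q UNIV w < \<infinity>"
  shows "gagliardo_int s q UNIV (\<lambda>x. v x - w x) < \<infinity>"
proof -
  define Q where "Q f z = (f (fst z) - f (snd z)) / norm (fst z - snd z) powr ((real DIM('a) + s * q) / q)" for f :: "'a \<Rightarrow> real" and z
  have Qm: "Q f \<in> borel_measurable borel" if [measurable]: "f \<in> borel_measurable borel" for f
    unfolding Q_def[abs_def] borel_prod[symmetric] by measurable
  have gQ: "gagliardo_int s q UNIV f = Lp_int q UNIV (Q f)" if "f \<in> borel_measurable borel" for f
    using gagliardo_int_eq_Lp_int[OF that q] by (simp add: Q_def[abs_def])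
  have "Q (\<lambda>x. v x - w x) = (\<lambda>z. Q v z - Q w z)"
    by (simp add: Q_def[abs_def] fun_eq_iff diff_divide_distrib)
  then have "gagliardo_int s q UNIV (\<lambda>x. v x - w x) = Lp_int q UNIV (\<lambda>z. Q v z - Q w z)"
    by (simp add: gQ)
  also have "\<dots> \<le> ennreal (2 powr q) * (Lp_int q UNIV (Q v) + Lp_int q UNIV (Q w))"
    using q by (intro Lp_int_diff_le Qm) auto
  also have "\<dots> < \<infinity>" using fin by (simp add: gQ ennreal_mult_less_top)
  finally show ?thesis .
qed

text \<open>A tent over the distance to C, since Lipschitz regularity is what the kernel bound asks
  for. Its radius is half of the room around C in \<Omega>: one half is spent on the support S, the
  other on shifting S by h.\<close>

lemma compact_cutoff:
  fixes C \<Omega> :: "'a::euclidean_space set"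
  assumes C: "compact C" "C \<subseteq> \<Omega>" "C \<noteq> {}" and \<Omega>: "open \<Omega>"
  obtains \<eta> S L r where "0 < r" "compact S" "\<And>x h. x \<in> S \<Longrightarrow> norm h \<le> r \<Longrightarrow> x + h \<in> \<Omega>"
    "continuous_on UNIV \<eta>" "\<And>x. 0 \<le> \<eta> x" "\<And>x. \<eta> x \<le> 1" "\<And>x. x \<in> C \<Longrightarrow> \<eta> x = (1::real)"
    "\<And>x. x \<notin> S \<Longrightarrow> \<eta> x = 0" "0 \<le> L" "\<And>x y. \<bar>\<eta> x - \<eta> y\<bar> \<le> L * norm (x - y)"
proof -
  obtain d where d: "0 < d" "(\<Union>x\<in>C. cball x d) \<subseteq> \<Omega>"
    using compact_subset_open_imp_cball_epsilon_subset[OF C(1) \<Omega> C(2)] by blast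
  define r where "r = d / 2"
  have r: "0 < r" using d by (simp add: r_def)
  define S where "S = {x + y | x y. x \<in> C \<and> y \<in> cball 0 r}"
  define \<eta> where "\<eta> x = max 0 (1 - infdist x C / r)" for x
  show ?thesis
  proof
    show "0 < r" by (rule r)
    show "compact S" unfolding S_def by (intro compact_sums C(1) compact_cball)
    show "x + h \<in> \<Omega>" if xS: "x \<in> S" and hr: "norm h \<le> r" for x h
    proof -
      obtain c y where cy: "x = c + y" "c \<in> C" "norm y \<le> r" using xS by (auto simp: S_def)
      have "norm (y + h) \<le> d" using norm_triangle_ineq[of y h] cy hr by (simp add: r_def)
      moreover have "dist c (x + h) = norm (y + h)"
        using norm_minus_cancel[of "y + h"] by (simp add: cy dist_norm del: norm_minus_cancel)
      ultimately have "x + h \<in> cball c d" by simp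
      then show ?thesis using d(2) cy(2) by blast
    qed
    show "continuous_on UNIV \<eta>" unfolding \<eta>_def[abs_def] using r by (intro continuous_intros) auto
    show "0 \<le> \<eta> x" for x by (simp add: \<eta>_def)
    show "\<eta> x \<le> 1" for x using r by (simp add: \<eta>_def infdist_nonneg)
    show "\<eta> x = 1" if "x \<in> C" for x using that by (simp add: \<eta>_def)
    show "\<eta> x = 0" if "x \<notin> S" for x
    proof (rule ccontr)
      assume "\<eta> x \<noteq> 0"
      then have lt: "infdist x C < r" using r by (auto simp: \<eta>_def max_def split: if_splits)
      obtain c where c: "c \<in> C" "infdist x C = dist x c"
        using infdist_attains_inf[OF compact_imp_closed[OF C(1)] C(3)] by blast
      have "x = c + (x - c)" "norm (x - c) \<le> r" using lt c by (auto simp: dist_norm)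
      then have "x \<in> S" unfolding S_def using c(1) by (intro CollectI exI[of _ c] exI[of _ "x - c"]) simp
      then show False using that by simp
    qed
    show "0 \<le> 1 / r" using r by simp
    show "\<bar>\<eta> x - \<eta> y\<bar> \<le> 1 / r * norm (x - y)" for x y
    proof -
      have "\<bar>\<eta> x - \<eta> y\<bar> \<le> \<bar>infdist x C / r - infdist y C / r\<bar>" by (auto simp: \<eta>_def)
      also have "\<dots> = \<bar>infdist x C - infdist y C\<bar> / r" using r by (simp add: diff_divide_distrib[symmetric])
      also have "\<dots> \<le> dist x y / r" using r infdist_triangle_abs[of x C y] by (intro divide_right_mono) auto
      finally show ?thesis by (simp add: dist_norm)
    qed
  qed
qed

text \<open>
  \<open>K\<close>, \<open>F\<close> and \<open>u\<close> stand for Borel representatives of the kernel, of the datum extended by \<open>0\<close>,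
  and of the solution.
\<close>

locale borel_solution =
  fixes p s \<Lambda> :: real and \<Omega> :: "'a::euclidean_space set" and K F u :: "'a \<Rightarrow> real"
  assumes p2: "2 \<le> p" and s0: "0 < s" and s1: "s < 1" and \<Lambda>1: "1 \<le> \<Lambda>"
    and open_\<Omega>: "open \<Omega>"
    and K_borel[measurable]: "K \<in> borel_measurable borel"
    and K_lower: "\<And>z. 1 / \<Lambda> * norm z powr (real DIM('a) + s * p) \<le> K z"
    and K_upper: "\<And>z. K z \<le> \<Lambda> * norm z powr (real DIM('a) + s * p)"
    and F_borel[measurable]: "F \<in> borel_measurable borel"
    and F_fin: "Lp_int (p / (p - 1)) UNIV F < \<infinity>"
    and F_translation_int: "\<And>C. compact C \<Longrightarrow> C \<subseteq> \<Omega> \<Longrightarrow>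
      \<exists>A\<ge>0. \<exists>r>0. \<forall>h. norm h < r \<longrightarrow> translation_int (p / (p - 1)) C F h \<le> ennreal (A * norm h powr (s * (p / (p - 1))))"
    and u_borel[measurable]: "u \<in> borel_measurable borel"
    and u_fin: "Lp_int p UNIV u < \<infinity>" and u_gagliardo_int: "gagliardo_int s p UNIV u < \<infinity>"
    and weak: "\<And>\<phi>. \<phi> \<in> borel_measurable borel \<Longrightarrow> \<phi> \<in> frac_sobolev0 s p \<Omega> \<Longrightarrow>
      (LINT z|lborel. Jp p (u (fst z) - u (snd z)) / K (fst z - snd z) * (\<phi> (fst z) - \<phi> (snd z))) =
      (LINT x|lborel. F x * \<phi> x)"
begin

abbreviation p' where "p' \<equiv> p / (p - 1)"

lemma K_pos: "z \<noteq> 0 \<Longrightarrow> 0 < K z"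
  using K_lower[of z] \<Lambda>1 by (smt (verit) divide_pos_pos mult_pos_pos norm_eq_zero powr_gt_zero)

lemma inverse_K_bounds:
  assumes "z \<noteq> 0"
  shows "1 / K z \<le> \<Lambda> / norm z powr (real DIM('a) + s * p)" "1 / (\<Lambda> * norm z powr (real DIM('a) + s * p)) \<le> 1 / K z"
proof -
  have n: "0 < norm z powr (real DIM('a) + s * p)" using assms by simp
  have "norm z powr (real DIM('a) + s * p) \<le> \<Lambda> * K z" using K_lower[of z] \<Lambda>1 by (simp add: field_simps)
  then show "1 / K z \<le> \<Lambda> / norm z powr (real DIM('a) + s * p)" using K_pos[OF assms] n by (simp add: field_simps)
  show "1 / (\<Lambda> * norm z powr (real DIM('a) + s * p)) \<le> 1 / K z" using K_pos[OF assms] K_upper[of z] by (intro divide_left_mono) (auto simp: n \<Lambda>1)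
qed

lemma form_measurable:
  assumes [measurable]: "v \<in> borel_measurable borel" "\<phi> \<in> borel_measurable borel"
  shows "(\<lambda>z. Jp p (v (fst z) - v (snd z)) / K (fst z - snd z) * (\<phi> (fst z) - \<phi> (snd z))) \<in> borel_measurable borel"
  unfolding borel_prod[symmetric] by measurable

text \<open>Young's inequality with exponents p' and p separates v from \<phi>. Absolute convergence
  is what allows the forms at u and at its translate to be subtracted under one integral.\<close>

lemma form_integrable:
  assumes [measurable]: "v \<in> borel_measurable borel" "\<phi> \<in> borel_measurable borel"
    and fin: "gagliardo_int s p UNIV v < \<infinity>" "gagliardo_int s p UNIV \<phi> < \<infinity>"
  shows "integrable lborel (\<lambda>z. Jp p (v (fst z) - v (snd z)) / K (fst z - snd z) * (\<phi> (fst z) - \<phi> (snd z)))"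
proof (rule integrableI_bounded)
  let ?f = "\<lambda>z. Jp p (v (fst z) - v (snd z)) / K (fst z - snd z) * (\<phi> (fst z) - \<phi> (snd z))"
  show "?f \<in> borel_measurable lborel" using form_measurable[OF assms(1,2)] by simp
  have [measurable]: "(\<lambda>z. ennreal (norm (?f z))) \<in> borel_measurable borel"
    using form_measurable[OF assms(1,2)] by measurable
  have "(\<integral>\<^sup>+z. ennreal (norm (?f z)) \<partial>lborel) = (\<integral>\<^sup>+x. \<integral>\<^sup>+y. ennreal (norm (?f (x, y))) \<partial>lborel \<partial>lborel)"
    by (rule nn_integral_lborel_pair) measurable
  also have "\<dots> \<le> (\<integral>\<^sup>+x. \<integral>\<^sup>+y. ennreal \<Lambda> * (ennreal (\<bar>v x - v y\<bar> powr p / norm (x - y) powr (real DIM('a) + s * p)) + ennreal (\<bar>\<phi> x - \<phi> y\<bar> powr p / norm (x - y) powr (real DIM('a) + s * p))) \<partial>lborel \<partial>lborel)"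
  proof (intro nn_integral_mono)
    fix x y
    have "norm (?f (x, y)) \<le> \<Lambda> * (\<bar>v x - v y\<bar> powr p / norm (x - y) powr (real DIM('a) + s * p) + \<bar>\<phi> x - \<phi> y\<bar> powr p / norm (x - y) powr (real DIM('a) + s * p))"
    proof (cases "x = y")
      case False
      then have nz: "x - y \<noteq> 0" by simp
      have "norm (?f (x, y)) = (\<bar>v x - v y\<bar> powr (p - 1) * \<bar>\<phi> x - \<phi> y\<bar>) * (1 / K (x - y))"
        using K_pos[OF nz] p2 by (simp add: abs_mult abs_divide abs_Jp)
      also have "\<dots> \<le> (\<bar>v x - v y\<bar> powr (p - 1) * \<bar>\<phi> x - \<phi> y\<bar>) * (\<Lambda> / norm (x - y) powr (real DIM('a) + s * p))"
        by (intro mult_left_mono inverse_K_bounds nz) auto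
      also have "\<dots> \<le> ((\<bar>v x - v y\<bar> powr (p - 1)) powr p' + \<bar>\<phi> x - \<phi> y\<bar> powr p) * (\<Lambda> / norm (x - y) powr (real DIM('a) + s * p))"
        using p2 \<Lambda>1 by (intro mult_right_mono product_le_conjugate) auto
      also have "(\<bar>v x - v y\<bar> powr (p - 1)) powr p' = \<bar>v x - v y\<bar> powr p"
        using p2 by (simp add: powr_powr)
      finally show ?thesis by (simp add: add_divide_distrib algebra_simps)
    qed (simp add: Jp_def)
    then have "ennreal (norm (?f (x, y))) \<le> ennreal (\<Lambda> * (\<bar>v x - v y\<bar> powr p / norm (x - y) powr (real DIM('a) + s * p) + \<bar>\<phi> x - \<phi> y\<bar> powr p / norm (x - y) powr (real DIM('a) + s * p)))"
      by (rule ennreal_leI)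
    also have "\<dots> = ennreal \<Lambda> * (ennreal (\<bar>v x - v y\<bar> powr p / norm (x - y) powr (real DIM('a) + s * p)) + ennreal (\<bar>\<phi> x - \<phi> y\<bar> powr p / norm (x - y) powr (real DIM('a) + s * p)))"
      using \<Lambda>1 by (simp add: ennreal_mult')
    finally show "ennreal (norm (?f (x, y))) \<le> \<dots>" .
  qed
  also have "\<dots> = ennreal \<Lambda> * (gagliardo_int s p UNIV v + gagliardo_int s p UNIV \<phi>)"
    unfolding gagliardo_int_def by (simp add: nn_integral_cmult nn_integral_add)
  also have "\<dots> < \<infinity>" using fin by (simp add: ennreal_mult_less_top)
  finally show "(\<integral>\<^sup>+z. ennreal (norm (?f z)) \<partial>lborel) < \<infinity>" .
qed

definition nikolskii :: "real \<Rightarrow> bool" where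
  "nikolskii t \<longleftrightarrow> (\<forall>C. compact C \<longrightarrow> C \<subseteq> \<Omega> \<longrightarrow> (\<exists>A\<ge>0. \<forall>h. translation_int p C u h \<le> ennreal (A * norm h powr (t * p))))"

lemma global_translation_int: "\<exists>A\<ge>0. \<forall>h. translation_int p UNIV u h \<le> ennreal (A * norm h powr (s * p))"
proof -
  obtain g where g: "gagliardo_int s p UNIV u = ennreal g" "0 \<le> g" using u_gagliardo_int by (cases "gagliardo_int s p UNIV u") auto
  have "translation_int p UNIV u h \<le> ennreal ((translation_const TYPE('a) s p * g) * norm h powr (s * p))" for h
  proof -
    have "translation_int p UNIV u h \<le> ennreal (translation_const TYPE('a) s p * norm h powr (s * p)) * gagliardo_int s p UNIV u"
      using s0 p2 by (intro translation_int_le_gagliardo_int) auto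
    also have "\<dots> = ennreal ((translation_const TYPE('a) s p * g) * norm h powr (s * p))"
      using g translation_const_pos[where 'a='a, of s p] by (simp add: ennreal_mult'[symmetric] mult_ac)
    finally show ?thesis .
  qed
  then show ?thesis
    using g translation_const_pos[where 'a='a, of s p] by (intro exI[of _ "translation_const TYPE('a) s p * g"]) auto
qed

lemma nikolskii_s: "nikolskii s"
proof -
  obtain A where A: "0 \<le> A" "\<And>h. translation_int p UNIV u h \<le> ennreal (A * norm h powr (s * p))" using global_translation_int by blast
  then show ?thesis
    unfolding nikolskii_def using translation_int_mono_set[of _ UNIV p u] by (meson order_trans subset_UNIV)
qed

text \<open>The equation tested with $\varphi(\cdot-h)$ minus the equation tested with $\varphi$.\<close>

lemma translated_difference_equation:
  assumes [measurable]: "\<phi> \<in> borel_measurable borel"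
    and S: "compact S" "\<And>x. x \<notin> S \<Longrightarrow> \<phi> x = 0" "S \<subseteq> \<Omega>" "\<And>x. x \<in> S \<Longrightarrow> x + h \<in> \<Omega>"
    and fin: "Lp_int p UNIV \<phi> < \<infinity>" "gagliardo_int s p UNIV \<phi> < \<infinity>"
  shows "integrable lborel (\<lambda>z. (Jp p (u (fst z + h) - u (snd z + h)) - Jp p (u (fst z) - u (snd z)))
            / K (fst z - snd z) * (\<phi> (fst z) - \<phi> (snd z)))" (is "integrable lborel ?D")
    and "(LINT z|lborel. (Jp p (u (fst z + h) - u (snd z + h)) - Jp p (u (fst z) - u (snd z)))
            / K (fst z - snd z) * (\<phi> (fst z) - \<phi> (snd z))) =
         (LINT x|lborel. (F (x + h) - F x) * \<phi> x)"
    and "integrable lborel (\<lambda>x. (F (x + h) - F x) * \<phi> x)"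
proof -
  define \<psi> where "\<psi> x = \<phi> (x - h)" for x
  have [measurable]: "\<psi> \<in> borel_measurable borel" unfolding \<psi>_def[abs_def] by measurable
  have p1: "1 \<le> p" using p2 by simp
  let ?f = "\<lambda>v \<phi> z. Jp p (v (fst z) - v (snd z)) / K (fst z - snd z) * (\<phi> (fst z) - \<phi> (snd z))"
  have 1: "(LINT z|lborel. ?f u \<phi> z) = (LINT x|lborel. F x * \<phi> x)"
    using frac_sobolev0_memI[OF _ S(1,3,2) open_\<Omega> p1 fin] by (intro weak) auto
  \<comment> \<open>The support of \<psi> is S shifted by h, which is assumed to stay inside
    \<Omega>.\<close>
  have "compact ((+) h ` S)" using S(1) by (rule compact_translation)
  moreover have "(+) h ` S \<subseteq> \<Omega>" using S(4) by (auto simp: add.commute)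
  moreover have "\<psi> x = 0" if "x \<notin> (+) h ` S" for x
  proof -
    have "x - h \<notin> S" using that by (metis add_diff_cancel_left' diff_add_cancel image_eqI add.commute)
    then show ?thesis by (simp add: \<psi>_def S(2))
  qed
  moreover have "Lp_int p UNIV \<psi> < \<infinity>" "gagliardo_int s p UNIV \<psi> < \<infinity>"
    using fin Lp_int_translate[of \<phi> p "- h"] gagliardo_int_translate[of \<phi> s p "- h"] by (simp_all add: \<psi>_def[abs_def])
  ultimately have "\<psi> \<in> frac_sobolev0 s p \<Omega>"
    by (intro frac_sobolev0_memI[OF _ _ _ _ open_\<Omega> p1]) auto
  then have "(LINT z|lborel. ?f u \<psi> z) = (LINT x|lborel. F x * \<psi> x)" by (intro weak) auto
  moreover have "(LINT z|lborel. ?f u \<psi> z) = (LINT z|lborel. ?f (\<lambda>x. u (x + h)) \<phi> z)"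
    using integral_lborel_pair_translate[OF form_measurable, of u \<psi> h] by (simp add: \<psi>_def)
  moreover have "(LINT x|lborel. F x * \<psi> x) = (LINT x|lborel. F (x + h) * \<phi> x)"
    using integral_lborel_translate[of "\<lambda>x. F x * \<psi> x" h] by (simp add: \<psi>_def)
  ultimately have 2: "(LINT z|lborel. ?f (\<lambda>x. u (x + h)) \<phi> z) = (LINT x|lborel. F (x + h) * \<phi> x)" by simp
  have i1: "integrable lborel (?f u \<phi>)" by (intro form_integrable u_gagliardo_int fin) auto
  have i2: "integrable lborel (?f (\<lambda>x. u (x + h)) \<phi>)"
    using gagliardo_int_translate[of u s p h] u_gagliardo_int by (intro form_integrable fin) auto
  \<comment> \<open>Young's inequality once more, for an arbitrary G, so as to cover the datum and
    its translate at once.\<close>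
  have iF: "integrable lborel (\<lambda>x. G x * \<phi> x)" if [measurable]: "G \<in> borel_measurable borel" and G: "Lp_int p' UNIV G < \<infinity>" for G
  proof (rule integrableI_bounded)
    have "(\<integral>\<^sup>+x. ennreal (norm (G x * \<phi> x)) \<partial>lborel) \<le> (\<integral>\<^sup>+x. ennreal (\<bar>G x\<bar> powr p') + ennreal (\<bar>\<phi> x\<bar> powr p) \<partial>lborel)"
    proof (rule nn_integral_mono)
      fix x
      have "\<bar>G x\<bar> * \<bar>\<phi> x\<bar> \<le> \<bar>G x\<bar> powr p' + \<bar>\<phi> x\<bar> powr p" using p2 by (intro product_le_conjugate) auto
      then show "ennreal (norm (G x * \<phi> x)) \<le> ennreal (\<bar>G x\<bar> powr p') + ennreal (\<bar>\<phi> x\<bar> powr p)"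
        by (simp add: abs_mult ennreal_plus[symmetric] ennreal_leI del: ennreal_plus)
    qed
    also have "\<dots> = Lp_int p' UNIV G + Lp_int p UNIV \<phi>" unfolding Lp_int_def by (simp add: nn_integral_add)
    also have "\<dots> < \<infinity>" using G fin by simp
    finally show "(\<integral>\<^sup>+x. ennreal (norm (G x * \<phi> x)) \<partial>lborel) < \<infinity>" .
  qed measurable
  have iF1: "integrable lborel (\<lambda>x. F x * \<phi> x)" by (intro iF F_fin) measurable
  have iF2: "integrable lborel (\<lambda>x. F (x + h) * \<phi> x)"
    using F_fin Lp_int_translate[of F p' h] by (intro iF) auto
  have D: "?D z = ?f (\<lambda>x. u (x + h)) \<phi> z - ?f u \<phi> z" for z
    by (simp add: diff_divide_distrib left_diff_distrib)
  show "integrable lborel ?D" unfolding D using i1 i2 by simp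
  show "integrable lborel (\<lambda>x. (F (x + h) - F x) * \<phi> x)" unfolding left_diff_distrib using iF1 iF2 by simp
  show "(LINT z|lborel. ?D z) = (LINT x|lborel. (F (x + h) - F x) * \<phi> x)"
    unfolding D left_diff_distrib using i1 i2 iF1 iF2 1 2 by (simp add: Bochner_Integration.integral_diff)
qed

end

section \<open>The energy estimate\<close>

text \<open>D carries the equation and has no sign, so only its integral is known. Adding the error
  G makes the sum dominate the nonnegative H pointwise, and the extended integral of H becomes
  comparable with real integrals.\<close>

lemma nn_integral_le_integral_plus:
  fixes D G H :: "'b \<Rightarrow> real"
  assumes D: "integrable M D" and [measurable]: "G \<in> borel_measurable M"
    and G: "\<And>x. 0 \<le> G x" "(\<integral>\<^sup>+x. ennreal (G x) \<partial>M) \<le> ennreal c" "0 \<le> c"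
    and H: "\<And>x. H x \<le> D x + G x" "\<And>x. 0 \<le> H x"
  shows "(\<integral>\<^sup>+x. ennreal (H x) \<partial>M) \<le> ennreal (integral\<^sup>L M D + c)"
proof -
  have iG: "integrable M G" using G by (intro integrableI_nonneg) (auto simp: less_top[symmetric] top_unique)
  have "ennreal (integral\<^sup>L M G) = (\<integral>\<^sup>+x. ennreal (G x) \<partial>M)"
    using iG G(1) by (subst nn_integral_eq_integral) auto
  then have "ennreal (integral\<^sup>L M G) \<le> ennreal c" using G(2) by simp
  then have IG: "integral\<^sup>L M G \<le> c" by (simp add: ennreal_le_iff G(3))
  have "(\<integral>\<^sup>+x. ennreal (H x) \<partial>M) \<le> (\<integral>\<^sup>+x. ennreal (D x + G x) \<partial>M)"
    using H(1) by (intro nn_integral_mono ennreal_leI)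
  also have "\<dots> = ennreal (LINT x|M. D x + G x)"
    using D iG order_trans[OF H(2,1)] by (intro nn_integral_eq_integral) auto
  also have "(LINT x|M. D x + G x) = integral\<^sup>L M D + integral\<^sup>L M G"
    using D iG by (rule Bochner_Integration.integral_add)
  also have "ennreal (integral\<^sup>L M D + integral\<^sup>L M G) \<le> ennreal (integral\<^sup>L M D + c)"
    using IG by (intro ennreal_leI) simp
  finally show ?thesis .
qed

text \<open>The scales \<open>T\<close> and \<open>R\<close> are the expected sizes of \<open>a\<close> and \<open>b\<close>.\<close>

lemma scaled_triple_product_le:
  fixes m a b d T R p :: real
  assumes "0 \<le> m" "0 < T" "0 < R" "2 \<le> p"
  shows "m powr (p - 2) * \<bar>a\<bar> * \<bar>b\<bar> * d\<^sup>2 \<le>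
    T * R * (m powr p + (\<bar>a\<bar> powr p / T powr p + \<bar>b\<bar> powr p / R powr p) * \<bar>d\<bar> powr p)"
proof -
  have "m powr (p - 2) * \<bar>a\<bar> * \<bar>b\<bar> * d\<^sup>2 = T * R * (m powr (p - 2) * (\<bar>a\<bar> * \<bar>d\<bar> / T) * (\<bar>b\<bar> * \<bar>d\<bar> / R))"
    using assms power2_eq_square[of "\<bar>d\<bar>"] by (simp add: field_simps)
  also have "\<dots> \<le> T * R * (m powr p + (\<bar>a\<bar> * \<bar>d\<bar> / T) powr p + (\<bar>b\<bar> * \<bar>d\<bar> / R) powr p)"
    using assms by (intro mult_left_mono triple_product_le) auto
  also have "\<dots> = T * R * (m powr p + (\<bar>a\<bar> powr p / T powr p + \<bar>b\<bar> powr p / R powr p) * \<bar>d\<bar> powr p)"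
    using assms by (simp add: powr_mult powr_divide distrib_right)
  finally show ?thesis .
qed

context borel_solution
begin

text \<open>The weight \<omega> measures w at scale R everywhere and in addition at scale T on S.
  Where \<eta> x and \<eta> y differ, one of the points lies in S; w is scaled by T there and by R
  at the other point, so T R comes out of the commutator although the second point is
  unrestricted.\<close>

lemma energy_pointwise:
  fixes h x y :: 'a and \<eta> :: "'a \<Rightarrow> real" and T R :: real and S C :: "'a set"
  defines "w \<equiv> \<lambda>x. u (x + h) - u x"
  defines "\<omega> \<equiv> \<lambda>x. \<bar>w x\<bar> powr p * (indicator S x / T powr p + 1 / R powr p)"
  assumes \<eta>: "\<And>x. x \<in> C \<Longrightarrow> \<eta> x = 1" "\<And>x. x \<notin> S \<Longrightarrow> \<eta> x = 0" and TR: "0 < T" "0 < R"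
  shows "indicator C x * indicator C y * (2 powr (1 - p) / \<Lambda> * (\<bar>w x - w y\<bar> powr p / norm (x - y) powr (real DIM('a) + s * p))) \<le>
    (Jp p (u (x + h) - u (y + h)) - Jp p (u x - u y)) / K (x - y) * (w x * (\<eta> x)\<^sup>2 - w y * (\<eta> y)\<^sup>2)
    + T * R * ((p - 1) * \<Lambda>) * (2 powr p * (\<bar>u (x + h) - u (y + h)\<bar> powr p + \<bar>u x - u y\<bar> powr p) / norm (x - y) powr (real DIM('a) + s * p)
        + (\<omega> x + \<omega> y) * (\<bar>\<eta> x - \<eta> y\<bar> powr p / norm (x - y) powr (real DIM('a) + s * p)))"
proof (cases "x = y")
  case False
  then have nz: "x - y \<noteq> 0" by simp
  define n where "n = norm (x - y) powr (real DIM('a) + s * p)"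
  define k where "k = K (x - y)"
  define A where "A = u (x + h) - u (y + h)"
  define B where "B = u x - u y"
  have n: "0 < n" using False by (simp add: n_def)
  have k: "0 < k" using K_pos[OF nz] by (simp add: k_def)
  have kb: "1 / k \<le> \<Lambda> / n" "1 / (\<Lambda> * n) \<le> 1 / k"
    using inverse_K_bounds[OF nz] by (simp_all add: k_def n_def)
  have AB: "A - B = w x - w y" by (simp add: A_def B_def w_def)
  define m where "m = \<bar>A\<bar> + \<bar>B\<bar>"
  have m: "0 \<le> m" by (simp add: m_def)
  have \<omega>0: "0 \<le> \<omega> x" for x using TR by (simp add: \<omega>_def)
  define E where "E = m powr (p - 2) * \<bar>w x\<bar> * \<bar>w y\<bar> * (\<eta> x - \<eta> y)\<^sup>2"
  have E0: "0 \<le> E" by (simp add: E_def)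
  define G where "G = 2 powr p * (\<bar>A\<bar> powr p + \<bar>B\<bar> powr p) + (\<omega> x + \<omega> y) * \<bar>\<eta> x - \<eta> y\<bar> powr p"
  have G0: "0 \<le> G" using \<omega>0 by (simp add: G_def)
  have mp: "m powr p \<le> 2 powr p * (\<bar>A\<bar> powr p + \<bar>B\<bar> powr p)"
    using powr_abs_add_le[of p "\<bar>A\<bar>" "\<bar>B\<bar>"] p2 by (simp add: m_def)
  have EG: "E \<le> T * R * G"
  proof -
    \<comment> \<open>Which factor is scaled by T depends on which point lies in S; if neither does,
      both cut-offs vanish.\<close>
    consider "x \<in> S" | "x \<notin> S" "y \<in> S" | "x \<notin> S" "y \<notin> S" by blast
    then show ?thesis
    proof cases
      case 1
      have "E \<le> T * R * (m powr p + (\<bar>w x\<bar> powr p / T powr p + \<bar>w y\<bar> powr p / R powr p) * \<bar>\<eta> x - \<eta> y\<bar> powr p)"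
        unfolding E_def by (rule scaled_triple_product_le[OF m TR p2])
      also have "\<dots> \<le> T * R * G"
        unfolding G_def
      proof (intro mult_left_mono add_mono mp mult_right_mono)
        show "\<bar>w x\<bar> powr p / T powr p \<le> \<omega> x" using 1 TR by (simp add: \<omega>_def ring_distribs)
        show "\<bar>w y\<bar> powr p / R powr p \<le> \<omega> y" using TR by (simp add: \<omega>_def ring_distribs)
      qed (use TR in auto)
      finally show ?thesis .
    next
      case 2
      have "E = m powr (p - 2) * \<bar>w y\<bar> * \<bar>w x\<bar> * (\<eta> x - \<eta> y)\<^sup>2" by (simp add: E_def)
      also have "\<dots> \<le> T * R * (m powr p + (\<bar>w y\<bar> powr p / T powr p + \<bar>w x\<bar> powr p / R powr p) * \<bar>\<eta> x - \<eta> y\<bar> powr p)"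
        by (rule scaled_triple_product_le[OF m TR p2])
      also have "\<dots> \<le> T * R * (2 powr p * (\<bar>A\<bar> powr p + \<bar>B\<bar> powr p) + (\<omega> y + \<omega> x) * \<bar>\<eta> x - \<eta> y\<bar> powr p)"
      proof (intro mult_left_mono add_mono mp mult_right_mono)
        show "\<bar>w y\<bar> powr p / T powr p \<le> \<omega> y" using 2 TR by (simp add: \<omega>_def ring_distribs)
        show "\<bar>w x\<bar> powr p / R powr p \<le> \<omega> x" using TR by (simp add: \<omega>_def ring_distribs)
      qed (use TR in auto)
      finally show ?thesis by (simp add: G_def add.commute)
    next
      case 3
      then have "E = 0" using \<eta>(2) by (simp add: E_def)
      then show ?thesis using G0 TR by simp
    qed
  qed
  define J where "J = (Jp p A - Jp p B) * (w x * (\<eta> x)\<^sup>2 - w y * (\<eta> y)\<^sup>2)"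
  define X where "X = (if \<eta> x = 1 \<and> \<eta> y = 1 then 2 powr (1 - p) * \<bar>w x - w y\<bar> powr p else 0)"
  have X0: "0 \<le> X" by (simp add: X_def)
  have XJ: "X \<le> J + (p - 1) * E"
    using Jp_localised_monotone[OF p2 AB, of "\<eta> x" "\<eta> y"] by (simp add: X_def J_def E_def m_def mult_ac)
  have "indicator C x * indicator C y * (2 powr (1 - p) / \<Lambda> * (\<bar>w x - w y\<bar> powr p / n)) \<le> X * (1 / (\<Lambda> * n))"
    using \<eta>(1) n \<Lambda>1 by (auto simp: X_def indicator_def)
  also have "\<dots> \<le> X * (1 / k)" using kb X0 by (intro mult_left_mono) auto
  also have "\<dots> \<le> (J + (p - 1) * E) * (1 / k)" using XJ k by (intro mult_right_mono) auto
  also have "\<dots> = J / k + (p - 1) * E * (1 / k)" by (simp add: distrib_right add_divide_distrib)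
  also have "(p - 1) * E * (1 / k) \<le> (p - 1) * (T * R * G) * (\<Lambda> / n)"
    using p2 EG E0 kb k G0 TR by (intro mult_mono) auto
  also have "(p - 1) * (T * R * G) * (\<Lambda> / n) = T * R * ((p - 1) * \<Lambda>) * (G / n)" by simp
  also have "G / n = 2 powr p * (\<bar>A\<bar> powr p + \<bar>B\<bar> powr p) / n + (\<omega> x + \<omega> y) * (\<bar>\<eta> x - \<eta> y\<bar> powr p / n)"
    by (simp add: G_def add_divide_distrib)
  finally show ?thesis by (simp add: J_def A_def B_def n_def k_def)
qed simp

text \<open>The part with \<omega> x is integrated in y first, where the kernel of \<eta> has a
  uniform bound; symmetry of the kernel and Tonelli's theorem turn the part with \<omega> y into the
  same integral.\<close>

lemma energy_error_integral:
  fixes \<eta> \<omega> :: "'a \<Rightarrow> real"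
  assumes [measurable]: "v \<in> borel_measurable borel" "\<eta> \<in> borel_measurable borel" "\<omega> \<in> borel_measurable borel"
    and \<omega>: "\<And>x. 0 \<le> \<omega> x" "(\<integral>\<^sup>+x. ennreal (\<omega> x) \<partial>lborel) \<le> ennreal W" "0 \<le> W"
    and \<kappa>: "0 \<le> C\<^sub>\<kappa>" "\<And>x. (\<integral>\<^sup>+y. ennreal (\<bar>\<eta> x - \<eta> y\<bar> powr p / norm (x - y) powr (real DIM('a) + s * p)) \<partial>lborel) \<le> ennreal C\<^sub>\<kappa>"
    and g: "gagliardo_int s p UNIV v = ennreal g" "gagliardo_int s p UNIV u = ennreal g" "0 \<le> g"
  shows "(\<integral>\<^sup>+z. ennreal (2 powr p * (\<bar>v (fst z) - v (snd z)\<bar> powr p + \<bar>u (fst z) - u (snd z)\<bar> powr p) / norm (fst z - snd z) powr (real DIM('a) + s * p)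
        + (\<omega> (fst z) + \<omega> (snd z)) * (\<bar>\<eta> (fst z) - \<eta> (snd z)\<bar> powr p / norm (fst z - snd z) powr (real DIM('a) + s * p))) \<partial>lborel)
      \<le> ennreal (2 powr p * (2 * g) + 2 * (W * C\<^sub>\<kappa>))" (is "(\<integral>\<^sup>+z. ennreal (?G z) \<partial>lborel) \<le> _")
proof -
  define k where "k x y = \<bar>\<eta> x - \<eta> y\<bar> powr p / norm (x - y) powr (real DIM('a) + s * p)" for x y
  have k0: "0 \<le> k x y" for x y by (simp add: k_def)
  have [measurable]: "case_prod k \<in> borel_measurable (borel \<Otimes>\<^sub>M borel)" unfolding k_def[abs_def] by measurable
  have ks: "k x y = k y x" for x y by (simp add: k_def abs_minus_commute norm_minus_commute)
  define q where "q v x y = \<bar>v x - v y\<bar> powr p / norm (x - y) powr (real DIM('a) + s * p)" for v :: "'a \<Rightarrow> real" and x y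
  have q0: "0 \<le> q v x y" for v x y by (simp add: q_def)
  have [measurable]: "case_prod (q v) \<in> borel_measurable (borel \<Otimes>\<^sub>M borel)" if [measurable]: "v \<in> borel_measurable borel" for v
    unfolding q_def[abs_def] by measurable
  have m: "(\<lambda>z. ennreal (?G z)) \<in> borel_measurable borel"
    unfolding borel_prod[symmetric] by measurable
  have one: "(\<integral>\<^sup>+x. \<integral>\<^sup>+y. ennreal (\<omega> x) * ennreal (k x y) \<partial>lborel \<partial>lborel) \<le> ennreal (W * C\<^sub>\<kappa>)"
  proof -
    have "(\<integral>\<^sup>+x. \<integral>\<^sup>+y. ennreal (\<omega> x) * ennreal (k x y) \<partial>lborel \<partial>lborel) = (\<integral>\<^sup>+x. ennreal (\<omega> x) * (\<integral>\<^sup>+y. ennreal (k x y) \<partial>lborel) \<partial>lborel)"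
      by (simp add: nn_integral_cmult)
    also have "\<dots> \<le> (\<integral>\<^sup>+x. ennreal (\<omega> x) * ennreal C\<^sub>\<kappa> \<partial>lborel)"
      unfolding k_def by (intro nn_integral_mono mult_left_mono \<kappa>) auto
    also have "\<dots> = (\<integral>\<^sup>+x. ennreal (\<omega> x) \<partial>lborel) * ennreal C\<^sub>\<kappa>" by (simp add: nn_integral_multc)
    also have "\<dots> \<le> ennreal W * ennreal C\<^sub>\<kappa>" by (intro mult_right_mono \<omega>) auto
    finally show ?thesis using \<omega> by (simp add: ennreal_mult')
  qed
  have two: "(\<integral>\<^sup>+x. \<integral>\<^sup>+y. ennreal (\<omega> y) * ennreal (k x y) \<partial>lborel \<partial>lborel) \<le> ennreal (W * C\<^sub>\<kappa>)"
  proof -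
    have "(\<integral>\<^sup>+x. \<integral>\<^sup>+y. ennreal (\<omega> y) * ennreal (k x y) \<partial>lborel \<partial>lborel) = (\<integral>\<^sup>+y. \<integral>\<^sup>+x. ennreal (\<omega> y) * ennreal (k x y) \<partial>lborel \<partial>lborel)"
      by (rule lborel_pair.Fubini') measurable
    also have "\<dots> = (\<integral>\<^sup>+x. \<integral>\<^sup>+y. ennreal (\<omega> x) * ennreal (k x y) \<partial>lborel \<partial>lborel)"
      using ks by simp
    also note one
    finally show ?thesis .
  qed
  have "(\<integral>\<^sup>+z. ennreal (?G z) \<partial>lborel) = (\<integral>\<^sup>+x. \<integral>\<^sup>+y. ennreal (?G (x, y)) \<partial>lborel \<partial>lborel)"
    by (rule nn_integral_lborel_pair[OF m])
  also have "\<dots> = (\<integral>\<^sup>+x. \<integral>\<^sup>+y. (ennreal (2 powr p) * (ennreal (q v x y) + ennreal (q u x y))) + (ennreal (\<omega> x) * ennreal (k x y) + ennreal (\<omega> y) * ennreal (k x y)) \<partial>lborel \<partial>lborel)"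
  proof (intro nn_integral_cong)
    fix x y
    have "?G (x, y) = 2 powr p * (q v x y + q u x y) + (\<omega> x * k x y + \<omega> y * k x y)"
      by (simp add: q_def k_def add_divide_distrib ring_distribs)
    then show "ennreal (?G (x, y)) = (ennreal (2 powr p) * (ennreal (q v x y) + ennreal (q u x y))) + (ennreal (\<omega> x) * ennreal (k x y) + ennreal (\<omega> y) * ennreal (k x y))"
      using \<omega>(1)[of x] \<omega>(1)[of y] k0[of x y] q0
      by (simp only: ennreal_mult' ennreal_plus add_nonneg_nonneg mult_nonneg_nonneg powr_ge_zero)
  qed
  also have "\<dots> = ennreal (2 powr p) * (gagliardo_int s p UNIV v + gagliardo_int s p UNIV u) +
     ((\<integral>\<^sup>+x. \<integral>\<^sup>+y. ennreal (\<omega> x) * ennreal (k x y) \<partial>lborel \<partial>lborel) + (\<integral>\<^sup>+x. \<integral>\<^sup>+y. ennreal (\<omega> y) * ennreal (k x y) \<partial>lborel \<partial>lborel))"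
    unfolding gagliardo_int_def q_def[symmetric] by (simp add: nn_integral_cmult nn_integral_add)
  also have "\<dots> \<le> ennreal (2 powr p) * (ennreal g + ennreal g) + (ennreal (W * C\<^sub>\<kappa>) + ennreal (W * C\<^sub>\<kappa>))"
    using g by (intro add_mono one two) auto
  also have "\<dots> = ennreal (2 powr p * (g + g) + (W * C\<^sub>\<kappa> + W * C\<^sub>\<kappa>))"
    using g \<omega> \<kappa> by (simp only: ennreal_mult' ennreal_plus add_nonneg_nonneg mult_nonneg_nonneg powr_ge_zero)
  finally show ?thesis by (simp only: mult_2)
qed

text \<open>Every ingredient is normalised by T = |h|^t or R = |h|^s so that its integral is bounded
  independently of h. The prefactor T R, common to the datum and to the commutator, is then the
  whole dependence on h.\<close>

lemma energy_estimate:
  assumes t: "nikolskii t" "0 \<le> t" and C: "compact C" "C \<subseteq> \<Omega>"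
  shows "\<exists>A\<ge>0. \<exists>r>0. \<forall>h. norm h < r \<longrightarrow> gagliardo_int s p C (\<lambda>x. u (x + h) - u x) \<le> ennreal (A * norm h powr (s + t))"
proof (cases "C = {}")
  \<comment> \<open>The cut-off is built from the distance to C and requires a point of C.\<close>
  case True
  then show ?thesis by (intro exI[of _ 0] conjI exI[of _ 1]) (auto simp: gagliardo_int_def)
next
  case False
  obtain \<eta> S L r1 where r1: "0 < r1" and S: "compact S" "\<And>x h. x \<in> S \<Longrightarrow> norm h \<le> r1 \<Longrightarrow> x + h \<in> \<Omega>"
    and \<eta>c: "continuous_on UNIV \<eta>" and \<eta>: "\<And>x. 0 \<le> \<eta> x" "\<And>x. \<eta> x \<le> 1" "\<And>x. x \<in> C \<Longrightarrow> \<eta> x = (1::real)"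
    "\<And>x. x \<notin> S \<Longrightarrow> \<eta> x = 0" and L: "0 \<le> L" "\<And>x y. \<bar>\<eta> x - \<eta> y\<bar> \<le> L * norm (x - y)"
    by (rule compact_cutoff[OF C False open_\<Omega>]) (rule that)
  have [measurable]: "\<eta> \<in> borel_measurable borel" using \<eta>c by (rule borel_measurable_continuous_onI)
  have [measurable]: "S \<in> sets borel" using S(1) by (simp add: borel_compact)
  have [measurable]: "C \<in> sets borel" using C(1) by (simp add: borel_compact)
  have S\<Omega>: "S \<subseteq> \<Omega>" using S(2)[of _ 0] r1 by auto
  have p1: "1 \<le> p" using p2 by simp
  obtain At where At: "0 \<le> At" "\<And>h. translation_int p S u h \<le> ennreal (At * norm h powr (t * p))"
    using t(1) S(1) S\<Omega> unfolding nikolskii_def by blast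
  obtain As where As: "0 \<le> As" "\<And>h. translation_int p UNIV u h \<le> ennreal (As * norm h powr (s * p))"
    using global_translation_int by blast
  obtain AF r2 where AF: "0 \<le> AF" "0 < r2" "\<And>h. norm h < r2 \<Longrightarrow> translation_int p' S F h \<le> ennreal (AF * norm h powr (s * p'))"
    using F_translation_int[OF S(1) S\<Omega>] by blast
  obtain Ck where Ck: "0 \<le> Ck" "\<And>x. (\<integral>\<^sup>+y. ennreal (\<bar>\<eta> x - \<eta> y\<bar> powr p / norm (x - y) powr (real DIM('a) + s * p)) \<partial>lborel) \<le> ennreal Ck"
    using kernel_cutoff_bound[OF \<open>\<eta> \<in> borel_measurable borel\<close> \<eta>(1,2) L(2,1) s0 s1 p1] by blast
  obtain g where g: "gagliardo_int s p UNIV u = ennreal g" "0 \<le> g" using u_gagliardo_int by (cases "gagliardo_int s p UNIV u") auto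
  \<comment> \<open>The bound of \<open>energy_error_integral\<close>: the energies of u and of its
    translate, and the two weighted kernel integrals, \<omega> having integral at most At +
    As.\<close>
  define Et where "Et = 2 powr p * (2 * g) + 2 * ((At + As) * Ck)"
  have Et: "0 \<le> Et" using g At As Ck by (simp add: Et_def)
  define c0 where "c0 = 2 powr (1 - p) / \<Lambda>"
  have c0: "0 < c0" using \<Lambda>1 by (simp add: c0_def)
  \<comment> \<open>The datum contributes AF + At and the commutator (p - 1) \<Lambda> Et; both are
    divided by the coercivity constant c0.\<close>
  define A where "A = 1 / c0 * (AF + At + (p - 1) * \<Lambda> * Et)"
  have A0: "0 \<le> A" using c0 AF At Et p2 \<Lambda>1 by (simp add: A_def)
  have main: "gagliardo_int s p C (\<lambda>x. u (x + h) - u x) \<le> ennreal (A * norm h powr (s + t))" if h: "norm h < min r1 r2" for h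
  proof (cases "h = 0")
    case True
    then show ?thesis by (simp add: gagliardo_int_def)
  next
    case False
    define T where "T = norm h powr t"
    define R where "R = norm h powr s"
    have TR: "0 < T" "0 < R" using False by (auto simp: T_def R_def)
    have Tp: "norm h powr (t * p) = T powr p" "norm h powr (s * p) = R powr p" "norm h powr (s * p') = R powr p'" "norm h powr (s + t) = T * R"
      by (simp_all add: T_def R_def powr_powr powr_add)
    define w where "w x = u (x + h) - u x" for x
    have [measurable]: "w \<in> borel_measurable borel" unfolding w_def[abs_def] by measurable
    define \<phi> where "\<phi> x = w x * (\<eta> x)\<^sup>2" for x
    have [measurable]: "\<phi> \<in> borel_measurable borel" unfolding \<phi>_def[abs_def] by measurable
    have lw: "Lp_int p UNIV w \<le> ennreal (As * R powr p)"
      using As(2)[of h] by (simp add: translation_int_eq_Lp_int w_def[abs_def] Tp)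
    then have lwf: "Lp_int p UNIV w < \<infinity>" by (auto simp: less_top[symmetric] top_unique)
    have gw: "gagliardo_int s p UNIV w < \<infinity>"
      unfolding w_def[abs_def] using u_gagliardo_int gagliardo_int_translate[of u s p h] p2 by (intro gagliardo_int_diff_finite) auto
    have \<eta>2: "0 \<le> (\<eta> x)\<^sup>2" "(\<eta> x)\<^sup>2 \<le> 1" for x using \<eta>(1,2)[of x] by (auto simp: power_le_one)
    have \<phi>w: "\<bar>\<phi> x\<bar> \<le> \<bar>w x\<bar>" for x
      using \<eta>2[of x] by (simp add: \<phi>_def abs_mult mult_left_le)
    have l\<phi>: "Lp_int p UNIV \<phi> < \<infinity>"
    proof -
      have "Lp_int p UNIV \<phi> \<le> Lp_int p UNIV w"
        unfolding Lp_int_def using \<phi>w p2 by (intro nn_integral_mono mult_left_mono ennreal_leI powr_mono2) auto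
      then show ?thesis using lwf by (rule le_less_trans)
    qed
    have g\<phi>: "gagliardo_int s p UNIV \<phi> < \<infinity>"
      unfolding \<phi>_def[abs_def]
    proof (rule gagliardo_int_mult_cutoff_finite[OF _ _ \<eta>2 _ _ s0 s1 p1 lwf gw])
      show "\<bar>(\<eta> x)\<^sup>2 - (\<eta> y)\<^sup>2\<bar> \<le> 2 * L * norm (x - y)" for x y
      proof -
        have "\<bar>(\<eta> x)\<^sup>2 - (\<eta> y)\<^sup>2\<bar> = \<bar>\<eta> x - \<eta> y\<bar> * (\<eta> x + \<eta> y)"
          using \<eta>(1)[of x] \<eta>(1)[of y] by (simp add: power2_eq_square square_diff_square_factored abs_mult)
        also have "\<dots> \<le> (L * norm (x - y)) * 2"
          using \<eta>(1,2)[of x] \<eta>(1,2)[of y] L by (intro mult_mono) auto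
        finally show ?thesis by simp
      qed
    qed (use L in auto)
    have h1: "norm h \<le> r1" using h by simp
    have \<phi>S: "\<phi> x = 0" if "x \<notin> S" for x using \<eta>(4)[OF that] by (simp add: \<phi>_def)
    note eq = translated_difference_equation[OF \<open>\<phi> \<in> borel_measurable borel\<close> S(1) \<phi>S S\<Omega> S(2)[OF _ h1] l\<phi> g\<phi>]
    define Z where "Z = (LINT x|lborel. (F (x + h) - F x) * \<phi> x)"
    have ZD: "Z = (LINT z|lborel. (Jp p (u (fst z + h) - u (snd z + h)) - Jp p (u (fst z) - u (snd z)))
            / K (fst z - snd z) * (\<phi> (fst z) - \<phi> (snd z)))"
      unfolding Z_def by (rule eq(2)[symmetric])
    have "ennreal \<bar>Z\<bar> \<le> (\<integral>\<^sup>+x. ennreal (norm ((F (x + h) - F x) * \<phi> x)) \<partial>lborel)"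
      unfolding Z_def using integral_norm_bound_ennreal[OF eq(3)] by simp
    also have "\<dots> \<le> (\<integral>\<^sup>+x. ennreal (T * R) * (ennreal (1 / R powr p') * (indicator S x * ennreal (\<bar>F (x + h) - F x\<bar> powr p'))
        + ennreal (1 / T powr p) * (indicator S x * ennreal (\<bar>w x\<bar> powr p))) \<partial>lborel)"
    proof (rule nn_integral_mono)
      fix x
      show "ennreal (norm ((F (x + h) - F x) * \<phi> x)) \<le> ennreal (T * R) * (ennreal (1 / R powr p') * (indicator S x * ennreal (\<bar>F (x + h) - F x\<bar> powr p'))
        + ennreal (1 / T powr p) * (indicator S x * ennreal (\<bar>w x\<bar> powr p)))"
      proof (cases "x \<in> S")
        case True
        have "norm ((F (x + h) - F x) * \<phi> x) \<le> \<bar>F (x + h) - F x\<bar> * \<bar>w x\<bar>"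
          using \<phi>w[of x] by (simp add: abs_mult mult_left_mono)
        \<comment> \<open>Scaling before Young's inequality balances the two terms: on S the
          difference of F has size R and that of u has size T.\<close>
        also have "\<dots> = (T * R) * ((\<bar>F (x + h) - F x\<bar> / R) * (\<bar>w x\<bar> / T))" using TR by simp
        also have "\<dots> \<le> (T * R) * ((\<bar>F (x + h) - F x\<bar> / R) powr p' + (\<bar>w x\<bar> / T) powr p)"
          using TR p2 by (intro mult_left_mono product_le_conjugate) auto
        also have "\<dots> = (T * R) * (1 / R powr p' * \<bar>F (x + h) - F x\<bar> powr p' + 1 / T powr p * \<bar>w x\<bar> powr p)"
          using TR by (simp add: powr_divide)
        finally have "ennreal (norm ((F (x + h) - F x) * \<phi> x)) \<le> ennreal \<dots>" by (rule ennreal_leI)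
        also have "\<dots> = ennreal (T * R) * (ennreal (1 / R powr p') * ennreal (\<bar>F (x + h) - F x\<bar> powr p')
            + ennreal (1 / T powr p) * ennreal (\<bar>w x\<bar> powr p))"
          using TR by (simp only: ennreal_mult' ennreal_plus add_nonneg_nonneg mult_nonneg_nonneg powr_ge_zero less_imp_le divide_nonneg_nonneg zero_le_one)
        finally show ?thesis using True by simp
      qed (simp add: \<phi>S)
    qed
    also have "\<dots> = ennreal (T * R) * (ennreal (1 / R powr p') * translation_int p' S F h + ennreal (1 / T powr p) * translation_int p S u h)"
      unfolding translation_int_def w_def by (simp add: nn_integral_cmult nn_integral_add)
    also have "\<dots> \<le> ennreal (T * R) * (ennreal (1 / R powr p') * ennreal (AF * R powr p') + ennreal (1 / T powr p) * ennreal (At * T powr p))"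
      using At(2)[of h, unfolded Tp] AF(3)[of h, unfolded Tp] h by (intro mult_left_mono add_mono) auto
    also have "\<dots> = ennreal (T * R * (AF + At))"
      using TR AF(1) At(1) by (simp add: ennreal_mult'[symmetric] ennreal_plus[symmetric] del: ennreal_plus)
    finally have Z: "\<bar>Z\<bar> \<le> T * R * (AF + At)"
      using TR AF(1) At(1) by (subst (asm) ennreal_le_iff) auto
    define \<omega> where "\<omega> x = \<bar>w x\<bar> powr p * (indicator S x / T powr p + 1 / R powr p)" for x
    have [measurable]: "\<omega> \<in> borel_measurable borel" unfolding \<omega>_def[abs_def] by measurable
    have \<omega>0: "0 \<le> \<omega> x" for x using TR by (simp add: \<omega>_def)
    have \<omega>I: "(\<integral>\<^sup>+x. ennreal (\<omega> x) \<partial>lborel) \<le> ennreal (At + As)"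
    proof -
      have "(\<integral>\<^sup>+x. ennreal (\<omega> x) \<partial>lborel) = (\<integral>\<^sup>+x. ennreal (1 / T powr p) * (indicator S x * ennreal (\<bar>w x\<bar> powr p)) + ennreal (1 / R powr p) * ennreal (\<bar>w x\<bar> powr p) \<partial>lborel)"
      proof (intro nn_integral_cong)
        fix x
        have "\<omega> x = 1 / T powr p * (indicator S x * \<bar>w x\<bar> powr p) + 1 / R powr p * \<bar>w x\<bar> powr p"
          by (simp add: \<omega>_def ring_distribs)
        then show "ennreal (\<omega> x) = ennreal (1 / T powr p) * (indicator S x * ennreal (\<bar>w x\<bar> powr p)) + ennreal (1 / R powr p) * ennreal (\<bar>w x\<bar> powr p)"
          using TR by (simp add: ennreal_mult' [symmetric] ennreal_plus[symmetric] indicator_def del: ennreal_plus)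
      qed
      also have "\<dots> = ennreal (1 / T powr p) * translation_int p S u h + ennreal (1 / R powr p) * Lp_int p UNIV w"
        unfolding translation_int_def Lp_int_def w_def by (simp add: nn_integral_cmult nn_integral_add)
      also have "\<dots> \<le> ennreal (1 / T powr p) * ennreal (At * T powr p) + ennreal (1 / R powr p) * ennreal (As * R powr p)"
        using At(2)[of h] lw by (intro add_mono mult_left_mono) (auto simp: Tp)
      also have "\<dots> = ennreal (At + As)"
        using TR At(1) As(1) by (simp add: ennreal_mult'[symmetric] ennreal_plus[symmetric] del: ennreal_plus)
      finally show ?thesis .
    qed
    define G where "G z = 2 powr p * (\<bar>u (fst z + h) - u (snd z + h)\<bar> powr p + \<bar>u (fst z) - u (snd z)\<bar> powr p) / norm (fst z - snd z) powr (real DIM('a) + s * p)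
        + (\<omega> (fst z) + \<omega> (snd z)) * (\<bar>\<eta> (fst z) - \<eta> (snd z)\<bar> powr p / norm (fst z - snd z) powr (real DIM('a) + s * p))" for z
    have Gm[measurable]: "G \<in> borel_measurable borel"
      unfolding G_def[abs_def] borel_prod[symmetric] by measurable
    have G0: "0 \<le> G z" for z using \<omega>0 by (simp add: G_def)
    have GI: "(\<integral>\<^sup>+z. ennreal (G z) \<partial>lborel) \<le> ennreal Et"
      unfolding G_def Et_def using energy_error_integral[of "\<lambda>x. u (x + h)" \<eta> \<omega> "At + As" Ck g] \<omega>0 \<omega>I At(1) As(1) Ck g gagliardo_int_translate[of u s p h]
      by auto
    define c1 where "c1 = T * R * ((p - 1) * \<Lambda>)"
    have c1: "0 \<le> c1" using TR p2 \<Lambda>1 by (simp add: c1_def)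
    have c1GI: "(\<integral>\<^sup>+z. ennreal (c1 * G z) \<partial>lborel) \<le> ennreal (c1 * Et)"
      using c1 G0 GI by (simp add: ennreal_mult' nn_integral_cmult mult_left_mono)
    define H where "H z = indicator C (fst z) * indicator C (snd z) * (c0 * (\<bar>w (fst z) - w (snd z)\<bar> powr p / norm (fst z - snd z) powr (real DIM('a) + s * p)))" for z
    \<comment> \<open>The equation enters here: the integral of the signed part is Z, which the
      datum bounds.\<close>
    have "(\<integral>\<^sup>+z. ennreal (H z) \<partial>lborel) \<le> ennreal (Z + c1 * Et)"
      unfolding ZD
    proof (rule nn_integral_le_integral_plus[OF eq(1) _ _ c1GI])
      show "(\<lambda>z. c1 * G z) \<in> borel_measurable lborel" using Gm by simp
      show "0 \<le> c1 * G z" for z using c1 G0 by simp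
      show "0 \<le> H z" for z using c0 by (simp add: H_def)
      show "H z \<le> (Jp p (u (fst z + h) - u (snd z + h)) - Jp p (u (fst z) - u (snd z))) / K (fst z - snd z) * (\<phi> (fst z) - \<phi> (snd z)) + c1 * G z" for z
        using energy_pointwise[OF \<eta>(3,4) TR, where x = "fst z" and y = "snd z" and h = h]
        unfolding H_def c0_def \<phi>_def c1_def G_def \<omega>_def w_def by simp
    qed (use c1 Et in auto)
    also have "\<dots> \<le> ennreal (T * R * (AF + At) + c1 * Et)"
      using Z by (intro ennreal_leI) auto
    also have "T * R * (AF + At) + c1 * Et = c0 * (A * norm h powr (s + t))"
      using c0 by (simp add: Tp A_def c1_def ring_distribs)
    also have "(\<integral>\<^sup>+z. ennreal (H z) \<partial>lborel) = ennreal c0 * gagliardo_int s p C w"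
    proof -
      have Hm: "(\<lambda>z. ennreal (H z)) \<in> borel_measurable borel"
        unfolding H_def[abs_def] borel_prod[symmetric] by measurable
      have "(\<integral>\<^sup>+z. ennreal (H z) \<partial>lborel) = (\<integral>\<^sup>+x. \<integral>\<^sup>+y. ennreal (H (x, y)) \<partial>lborel \<partial>lborel)"
        by (rule nn_integral_lborel_pair[OF Hm])
      also have "\<dots> = (\<integral>\<^sup>+x. \<integral>\<^sup>+y. ennreal c0 * (indicator C x * indicator C y * ennreal (\<bar>w x - w y\<bar> powr p / norm (x - y) powr (real DIM('a) + s * p))) \<partial>lborel \<partial>lborel)"
        using c0 by (intro nn_integral_cong) (auto simp: H_def indicator_def ennreal_mult'[symmetric])
      also have "\<dots> = ennreal c0 * gagliardo_int s p C w"
        unfolding gagliardo_int_def by (simp add: nn_integral_cmult)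
      finally show ?thesis .
    qed
    finally have "ennreal c0 * gagliardo_int s p C w \<le> ennreal (c0 * (A * norm h powr (s + t)))" .
    then have "ennreal (1 / c0) * (ennreal c0 * gagliardo_int s p C w) \<le> ennreal (1 / c0) * ennreal (c0 * (A * norm h powr (s + t)))"
      by (intro mult_left_mono) auto
    then show ?thesis
      using c0 A0 by (simp add: mult.assoc[symmetric] ennreal_mult'[symmetric] w_def[abs_def])
  qed
  show ?thesis
    using A0 main r1 AF(2) by (intro exI[of _ A] conjI exI[of _ "min r1 r2"]) auto
qed

end

section \<open>Improvement of differentiability\<close>

text \<open>A given h is doubled until it reaches the scale r, where the trivial bound B is good
  enough. The hypothesis \<theta> 2^\<beta> < 1 lets one doubling step turn a bound with constant M
  into one with constant l M + B1 \<le> M, so the constant survives any number of steps.\<close>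

lemma dyadic_absorption:
  fixes a :: "'a::real_normed_vector \<Rightarrow> ennreal"
  assumes a0: "a 0 = 0" and B: "0 \<le> B" "\<And>h. a h \<le> ennreal B" and r: "0 < r"
    and step: "\<And>h. norm h < r \<Longrightarrow> a h \<le> ennreal \<theta> * a (2 *\<^sub>R h) + ennreal (B1 * norm h powr \<beta>)"
    and \<theta>: "0 \<le> \<theta>" "\<theta> * 2 powr \<beta> < 1" and B1: "0 \<le> B1" and \<beta>: "0 \<le> \<beta>"
  shows "\<exists>M\<ge>0. \<forall>h. a h \<le> ennreal (M * norm h powr \<beta>)"
proof -
  define l where "l = \<theta> * 2 powr \<beta>"
  have l: "0 \<le> l" "l < 1" using \<theta> by (auto simp: l_def)
  \<comment> \<open>The first summand settles |h| \<ge> r; the second is the fixed point of M -> l M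
    + B1.\<close>
  define M where "M = B / r powr \<beta> + B1 / (1 - l)"
  have M0: "0 \<le> M" using B B1 l by (simp add: M_def)
  have Ml: "l * M + B1 \<le> M"
  proof -
    have "B1 = (1 - l) * (B1 / (1 - l))" using l by simp
    also have "\<dots> \<le> (1 - l) * M" using l B by (intro mult_left_mono) (auto simp: M_def)
    finally show ?thesis by (simp add: algebra_simps)
  qed
  have large: "a h \<le> ennreal (M * norm h powr \<beta>)" if "r \<le> norm h" for h
  proof -
    have "B = B / r powr \<beta> * r powr \<beta>" using r by simp
    also have "\<dots> \<le> M * norm h powr \<beta>"
      using B r that \<beta> l B1 M0 by (intro mult_mono powr_mono2) (auto simp: M_def)
    finally have "ennreal B \<le> ennreal (M * norm h powr \<beta>)" by (rule ennreal_leI)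
    then show ?thesis using B(2)[of h] by simp
  qed
  have main: "r / 2 ^ n \<le> norm h \<Longrightarrow> a h \<le> ennreal (M * norm h powr \<beta>)" for n h
  proof (induction n arbitrary: h)
    case 0
    then show ?case using large by simp
  next
    case (Suc n)
    show ?case
    proof (cases "r \<le> norm h")
      case False
      have "r / 2 ^ n \<le> norm (2 *\<^sub>R h)" using Suc.prems by (simp add: field_simps)
      note IH = Suc.IH[OF this]
      have "a h \<le> ennreal \<theta> * a (2 *\<^sub>R h) + ennreal (B1 * norm h powr \<beta>)" using False step by simp
      also have "\<dots> \<le> ennreal \<theta> * ennreal (M * norm (2 *\<^sub>R h) powr \<beta>) + ennreal (B1 * norm h powr \<beta>)"
        by (intro add_mono mult_left_mono IH) auto
      also have "\<dots> = ennreal ((l * M + B1) * norm h powr \<beta>)"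
        using \<theta> M0 B1 by (simp add: l_def powr_mult ennreal_mult'[symmetric] ennreal_plus[symmetric] algebra_simps del: ennreal_plus)
      also have "\<dots> \<le> ennreal (M * norm h powr \<beta>)"
        using Ml by (intro ennreal_leI mult_right_mono) auto
      finally show ?thesis .
    qed (rule large)
  qed
  have "a h \<le> ennreal (M * norm h powr \<beta>)" for h
  proof (cases "h = 0")
    case False
    obtain n where "(1/2)^n < norm h / r"
      using False r real_arch_pow_inv[of "norm h / r" "1/2"] by auto
    then have "r / 2 ^ n \<le> norm h" using r by (simp add: field_simps)
    then show ?thesis by (rule main)
  qed (simp add: a0)
  then show ?thesis using M0 by blast
qed

text \<open>Near the diagonal, Tonelli's theorem integrates the translation bound against |h|^(-N -
  \<tau> q), and the result converges at 0 because \<tau> < \<gamma>: here the passage from the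
  Nikol'skii to the fractional Sobolev scale costs an arbitrarily small amount. Away from the
  diagonal, L^q integrability over a set of finite measure suffices.\<close>

lemma gagliardo_int_finite_of_translation_int:
  fixes v :: "'a::euclidean_space \<Rightarrow> real"
  assumes [measurable]: "v \<in> borel_measurable borel" "E \<in> sets borel" and E: "emeasure lborel E < \<infinity>"
    and lp: "Lp_int q E v < \<infinity>" and r: "0 < r" and A: "0 \<le> A"
    and translation_int: "\<And>h. norm h < r \<Longrightarrow> translation_int q E v h \<le> ennreal (A * norm h powr (\<gamma> * q))"
    and \<tau>: "0 \<le> \<tau>" "\<tau> < \<gamma>" and q: "1 \<le> q"
  shows "gagliardo_int \<tau> q E v < \<infinity>"
proof -
  let ?e = "real DIM('a) + \<tau> * q"
  have e: "0 \<le> ?e" using \<tau> q by simp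
  have [measurable]: "indicator (ball (0::'a) r) \<in> borel_measurable borel"
    by (intro borel_measurable_indicator) simp
  define f where "f x h = indicator E x * ennreal (\<bar>v (x + h) - v x\<bar> powr q)" for x h
  have [measurable]: "case_prod f \<in> borel_measurable (borel \<Otimes>\<^sub>M borel)" unfolding f_def[abs_def] by measurable
  \<comment> \<open>The condition that y lies in E is dropped, so that integrating in x for fixed
    increment gives a translation integral over E.\<close>
  define N where "N x y = indicator (ball 0 r) (y - x) * ennreal (1 / norm (y - x) powr ?e) * f x (y - x)" for x y
  define c where "c = 2 powr q / r powr ?e"
  have c0: "0 \<le> c" by (simp add: c_def)
  define P where "P x y = ennreal c * (indicator E x * indicator E y * (ennreal (\<bar>v x\<bar> powr q) + ennreal (\<bar>v y\<bar> powr q)))" for x y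
  have [measurable]: "case_prod N \<in> borel_measurable (borel \<Otimes>\<^sub>M borel)" "case_prod P \<in> borel_measurable (borel \<Otimes>\<^sub>M borel)"
    unfolding N_def[abs_def] P_def[abs_def] by measurable
  have near: "(\<integral>\<^sup>+x. \<integral>\<^sup>+y. N x y \<partial>lborel \<partial>lborel) < \<infinity>"
  proof -
    have "(\<integral>\<^sup>+x. \<integral>\<^sup>+y. N x y \<partial>lborel \<partial>lborel) = (\<integral>\<^sup>+x. \<integral>\<^sup>+h. indicator (ball 0 r) h * ennreal (1 / norm h powr ?e) * f x h \<partial>lborel \<partial>lborel)"
    proof (rule nn_integral_cong)
      fix x
      show "(\<integral>\<^sup>+y. N x y \<partial>lborel) = (\<integral>\<^sup>+h. indicator (ball 0 r) h * ennreal (1 / norm h powr ?e) * f x h \<partial>lborel)"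
        using nn_integral_lborel_translate[of "\<lambda>h. indicator (ball 0 r) h * ennreal (1 / norm h powr ?e) * f x h" "- x"]
        by (simp add: N_def)
    qed
    also have "\<dots> = (\<integral>\<^sup>+h. \<integral>\<^sup>+x. indicator (ball 0 r) h * ennreal (1 / norm h powr ?e) * f x h \<partial>lborel \<partial>lborel)"
      by (rule lborel_pair.Fubini'[symmetric]) measurable
    also have "\<dots> = (\<integral>\<^sup>+h. indicator (ball 0 r) h * ennreal (1 / norm h powr ?e) * translation_int q E v h \<partial>lborel)"
      unfolding translation_int_def f_def by (simp add: nn_integral_cmult)
    also have "\<dots> \<le> (\<integral>\<^sup>+h. ennreal A * (indicator (ball 0 r) h * ennreal (norm h powr ((\<gamma> - \<tau>) * q - real DIM('a)))) \<partial>(lborel :: 'a measure))"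
    proof (rule nn_integral_mono)
      fix h :: 'a
      show "indicator (ball 0 r) h * ennreal (1 / norm h powr ?e) * translation_int q E v h \<le>
        ennreal A * (indicator (ball 0 r) h * ennreal (norm h powr ((\<gamma> - \<tau>) * q - real DIM('a))))"
      proof (cases "norm h < r")
        case True
        have "ennreal (1 / norm h powr ?e) * translation_int q E v h \<le> ennreal (1 / norm h powr ?e) * ennreal (A * norm h powr (\<gamma> * q))"
          by (intro mult_left_mono translation_int True) simp
        also have "\<dots> = ennreal (A * (norm h powr (\<gamma> * q) / norm h powr ?e))"
          using A by (simp add: ennreal_mult'[symmetric])
        also have "norm h powr (\<gamma> * q) / norm h powr ?e = norm h powr ((\<gamma> - \<tau>) * q - real DIM('a))"
          by (simp add: powr_diff[symmetric] algebra_simps)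
        finally show ?thesis using True A by (simp add: ennreal_mult')
      qed simp
    qed
    also have "\<dots> = ennreal A * (\<integral>\<^sup>+h. indicator (ball 0 r) h * ennreal (norm h powr ((\<gamma> - \<tau>) * q - real DIM('a))) \<partial>(lborel :: 'a measure))"
      by (rule nn_integral_cmult) measurable
    also have "\<dots> < \<infinity>"
      using radial_integral_near_finite[of "(\<gamma> - \<tau>) * q" r, where 'a='a] \<tau> q r by (simp add: ennreal_mult_less_top)
    finally show ?thesis .
  qed
  have far: "(\<integral>\<^sup>+x. \<integral>\<^sup>+y. P x y \<partial>lborel \<partial>lborel) < \<infinity>"
  proof -
    have "(\<integral>\<^sup>+x. \<integral>\<^sup>+y. P x y \<partial>lborel \<partial>lborel) = (\<integral>\<^sup>+x. \<integral>\<^sup>+y. ennreal c * ((indicator E x * ennreal (\<bar>v x\<bar> powr q)) * indicator E y + indicator E x * (indicator E y * ennreal (\<bar>v y\<bar> powr q))) \<partial>lborel \<partial>lborel)"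
      by (simp add: P_def ring_distribs mult_ac)
    also have "\<dots> = ennreal c * (Lp_int q E v * emeasure lborel E + emeasure lborel E * Lp_int q E v)"
      unfolding Lp_int_def by (simp add: nn_integral_cmult nn_integral_add nn_integral_multc)
    also have "\<dots> < \<infinity>" using E lp by (simp add: ennreal_mult_less_top)
    finally show ?thesis .
  qed
  have "gagliardo_int \<tau> q E v \<le> (\<integral>\<^sup>+x. \<integral>\<^sup>+y. N x y + P x y \<partial>lborel \<partial>lborel)"
    unfolding gagliardo_int_def
  proof (intro nn_integral_mono)
    fix x y
    show "indicator E x * indicator E y * ennreal (\<bar>v x - v y\<bar> powr q / norm (x - y) powr ?e) \<le> N x y + P x y"
    proof (cases "x \<in> E \<and> y \<in> E")
      case True
      show ?thesis
      proof (cases "norm (y - x) < r")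
        case near: True
        have "N x y = ennreal (\<bar>v x - v y\<bar> powr q / norm (x - y) powr ?e)"
          using True near by (simp add: N_def f_def ennreal_mult'[symmetric] abs_minus_commute norm_minus_commute)
        then show ?thesis using True by simp
      next
        case far: False
        have "\<bar>v x - v y\<bar> powr q / norm (x - y) powr ?e \<le> (2 powr q * (\<bar>v x\<bar> powr q + \<bar>v y\<bar> powr q)) / r powr ?e"
          using far r e q by (intro frac_le powr_abs_diff_le powr_mono2) (auto simp: norm_minus_commute)
        then have "ennreal (\<bar>v x - v y\<bar> powr q / norm (x - y) powr ?e) \<le> ennreal (c * (\<bar>v x\<bar> powr q + \<bar>v y\<bar> powr q))"
          by (intro ennreal_leI) (simp add: c_def)
        also have "\<dots> = P x y" using True c0 by (simp add: P_def ennreal_mult')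
        finally show ?thesis using True by (simp add: add_increasing)
      qed
    qed auto
  qed
  also have "\<dots> = (\<integral>\<^sup>+x. \<integral>\<^sup>+y. N x y \<partial>lborel \<partial>lborel) + (\<integral>\<^sup>+x. \<integral>\<^sup>+y. P x y \<partial>lborel \<partial>lborel)"
    by (simp add: nn_integral_add)
  also have "\<dots> < \<infinity>" using near far by simp
  finally show ?thesis .
qed

context borel_solution
begin

text \<open>The energy of the first difference on a slightly larger compact set controls its
  translations: h contributes the power s + t of the energy estimate, k the power s p of the
  seminorm.\<close>

lemma second_difference_estimate:
  assumes t: "nikolskii t" "0 \<le> t" and C: "compact C" "C \<subseteq> \<Omega>"
  obtains A r where "0 \<le> A" "0 < r"
    "\<And>h k. norm h < r \<Longrightarrow> norm k < r \<Longrightarrow>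
      translation_int p C (\<lambda>x. u (x + h) - u x) k \<le> ennreal (A * norm k powr (s * p) * norm h powr (s + t))"
proof -
  obtain d D where d: "0 < d" and cD: "compact D" and D\<Omega>: "D \<subseteq> \<Omega>"
    and D: "\<And>x v. x \<in> C \<Longrightarrow> norm v \<le> d \<Longrightarrow> x + v \<in> D"
    by (rule compact_neighbourhood[OF C open_\<Omega>]) (rule that)
  obtain A r where A: "0 \<le> A" "0 < r" "\<And>h. norm h < r \<Longrightarrow> gagliardo_int s p D (\<lambda>x. u (x + h) - u x) \<le> ennreal (A * norm h powr (s + t))"
    using energy_estimate[OF t cD D\<Omega>] by blast
  let ?c = "translation_const TYPE('a) s p"
  have c: "0 < ?c" by (rule translation_const_pos)
  show ?thesis
  proof (rule that[of "?c * A" "min r d"])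
    show "0 \<le> ?c * A" "0 < min r d" using c A d by auto
    fix h k :: 'a assume h: "norm h < min r d" and k: "norm k < min r d"
    have "translation_int p C (\<lambda>x. u (x + h) - u x) k \<le> ennreal (?c * norm k powr (s * p)) * gagliardo_int s p D (\<lambda>x. u (x + h) - u x)"
    proof (rule translation_int_le_gagliardo_int)
      show "x + v \<in> D" if "x \<in> C" "norm v \<le> norm k" for x v
        using that k by (intro D) auto
    qed (use s0 p2 C(1) cD in \<open>auto simp: borel_compact\<close>)
    also have "\<dots> \<le> ennreal (?c * norm k powr (s * p)) * ennreal (A * norm h powr (s + t))"
      using h by (intro mult_left_mono A(3)) auto
    also have "\<dots> = ennreal (?c * A * norm k powr (s * p) * norm h powr (s + t))"
      using c A by (simp add: ennreal_mult'[symmetric] mult_ac)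
    finally show "translation_int p C (\<lambda>x. u (x + h) - u x) k \<le> ennreal (?c * A * norm k powr (s * p) * norm h powr (s + t))" .
  qed
qed

text \<open>This trivial bound starts the doubling argument at large scales; its constant does not
  depend on C.\<close>

lemma translation_int_bounded: "\<exists>B\<ge>0. \<forall>C\<in>sets borel. \<forall>h. translation_int p C u h \<le> ennreal B"
proof -
  obtain l where l: "Lp_int p UNIV u = ennreal l" "0 \<le> l" using u_fin by (cases "Lp_int p UNIV u") auto
  have "translation_int p C u h \<le> ennreal (2 powr p * (l + l))" for C h
  proof -
    have "translation_int p C u h \<le> translation_int p UNIV u h" by (rule translation_int_mono_set) simp
    also have "\<dots> \<le> ennreal (2 powr p) * (Lp_int p UNIV (\<lambda>x. u (x + h)) + Lp_int p UNIV u)"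
      unfolding translation_int_eq_Lp_int using p2 by (intro Lp_int_diff_le) auto
    also have "\<dots> = ennreal (2 powr p * (l + l))"
      using l by (simp add: Lp_int_translate ennreal_mult'[symmetric] ennreal_plus[symmetric] del: ennreal_plus)
    finally show ?thesis .
  qed
  then show ?thesis using l by (intro exI[of _ "2 powr p * (l + l)"]) auto
qed

text \<open>Marchaud's inequality: $2\delta_h u=\delta_{2h}u-\delta_h\delta_h u$.\<close>

lemma nikolskii_improve:
  assumes t: "nikolskii t" "0 \<le> t" and t': "0 \<le> t'" "t' < 1" "t' \<le> s + (s + t) / p"
  shows "nikolskii t'"
  unfolding nikolskii_def
proof (intro allI impI)
  fix C assume C: "compact C" "C \<subseteq> \<Omega>"
  have [measurable]: "C \<in> sets borel" using C(1) by (simp add: borel_compact)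
  obtain A r where A: "0 \<le> A" "0 < r"
    "\<And>h k. norm h < r \<Longrightarrow> norm k < r \<Longrightarrow>
      translation_int p C (\<lambda>x. u (x + h) - u x) k \<le> ennreal (A * norm k powr (s * p) * norm h powr (s + t))"
    using second_difference_estimate[OF t C] by blast
  obtain B where B: "0 \<le> B" "\<And>h. translation_int p C u h \<le> ennreal B" using translation_int_bounded by auto
  \<comment> \<open>With this l the factor gained in one doubling is l^(1-p) 2^(-p) 2^(t' p) =
    l^(1-p) l^p = l, which is below 1 exactly because t' < 1.\<close>
  define l where "l = 2 powr (t' - 1)"
  have l: "0 < l" "l < 1" using t' powr_less_mono[of "t' - 1" 0 2] by (auto simp: l_def)
  define \<theta> where "\<theta> = l powr (1 - p) * (1 / 2) powr p"
  define c where "c = (1 - l) powr (1 - p) * (1 / 2) powr p"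
  have half: "(1 / 2) powr p = 2 powr (- p)" by (simp add: powr_divide powr_minus_divide)
  have \<theta>l: "\<theta> * 2 powr (t' * p) = l"
    by (simp add: \<theta>_def l_def half powr_powr powr_add[symmetric] algebra_simps)
  show "\<exists>M\<ge>0. \<forall>h. translation_int p C u h \<le> ennreal (M * norm h powr (t' * p))"
  proof (rule dyadic_absorption)
    show "translation_int p C u 0 = 0" using p2 by (simp add: translation_int_def)
    show "0 \<le> B" "\<And>h. translation_int p C u h \<le> ennreal B" by (fact B)+
    show "0 < min r 1" using A by simp
    show "0 \<le> \<theta>" by (simp add: \<theta>_def)
    show "\<theta> * 2 powr (t' * p) < 1" using \<theta>l l by simp
    show "0 \<le> c * A" using A by (simp add: c_def)
    show "0 \<le> t' * p" using t' p2 by simp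
    fix h :: 'a assume h: "norm h < min r 1"
    let ?w = "\<lambda>x. u (x + h) - u x"
    have "translation_int p C u h = Lp_int p C (\<lambda>x. (1 / 2) * (u (x + 2 *\<^sub>R h) - u x) + (- (1 / 2)) * (?w (x + h) - ?w x))"
    proof -
      have "?w x = (1 / 2) * (u (x + 2 *\<^sub>R h) - u x) + (- (1 / 2)) * (?w (x + h) - ?w x)" for x
      proof -
        have "x + h + h = x + 2 *\<^sub>R h" by (simp add: scaleR_2 add.assoc)
        moreover have "a - b = (1 / 2) * (c - b) + (- (1 / 2)) * ((c - a) - (a - b))" for a b c :: real
          by (simp add: field_simps)
        ultimately show ?thesis by metis
      qed
      then show ?thesis unfolding translation_int_eq_Lp_int by (rule arg_cong[where f = "Lp_int p C", OF ext])
    qed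
    also have "\<dots> \<le> ennreal (l powr (1 - p)) * Lp_int p C (\<lambda>x. (1 / 2) * (u (x + 2 *\<^sub>R h) - u x))
        + ennreal ((1 - l) powr (1 - p)) * Lp_int p C (\<lambda>x. (- (1 / 2)) * (?w (x + h) - ?w x))"
      using p2 by (intro Lp_int_add_weighted l) auto
    also have "Lp_int p C (\<lambda>x. (1 / 2) * (u (x + 2 *\<^sub>R h) - u x)) = ennreal (\<bar>1 / 2\<bar> powr p) * translation_int p C u (2 *\<^sub>R h)"
      unfolding translation_int_eq_Lp_int by (rule Lp_int_cmult) measurable
    also have "Lp_int p C (\<lambda>x. (- (1 / 2)) * (?w (x + h) - ?w x)) = ennreal (\<bar>- (1 / 2)\<bar> powr p) * translation_int p C ?w h"
      unfolding translation_int_eq_Lp_int by (rule Lp_int_cmult) measurable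
    also have "ennreal (l powr (1 - p)) * (ennreal (\<bar>1 / 2\<bar> powr p) * translation_int p C u (2 *\<^sub>R h))
        + ennreal ((1 - l) powr (1 - p)) * (ennreal (\<bar>- (1 / 2)\<bar> powr p) * translation_int p C ?w h)
        = ennreal \<theta> * translation_int p C u (2 *\<^sub>R h) + ennreal c * translation_int p C ?w h"
      by (simp add: \<theta>_def c_def ennreal_mult' mult.assoc)
    also have "\<dots> \<le> ennreal \<theta> * translation_int p C u (2 *\<^sub>R h) + ennreal c * ennreal (A * norm h powr (s * p) * norm h powr (s + t))"
      using h by (intro add_left_mono mult_left_mono A(3)) auto
    also have "\<dots> \<le> ennreal \<theta> * translation_int p C u (2 *\<^sub>R h) + ennreal (c * A * norm h powr (t' * p))"
    proof (intro add_left_mono)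
      \<comment> \<open>Passing to the smaller exponent requires |h| \<le> 1, hence the radius
        \<open>min r 1\<close>.\<close>
      have "t' * p \<le> s * p + (s + t)" using t' p2 by (simp add: field_simps)
      then have "norm h powr (s * p) * norm h powr (s + t) \<le> norm h powr (t' * p)"
        using h by (simp add: powr_add[symmetric]) (intro powr_mono', auto)
      then have "c * A * (norm h powr (s * p) * norm h powr (s + t)) \<le> c * A * norm h powr (t' * p)"
        using A by (intro mult_left_mono) (auto simp: c_def)
      then have "ennreal (c * A * (norm h powr (s * p) * norm h powr (s + t))) \<le> ennreal (c * A * norm h powr (t' * p))"
        by (rule ennreal_leI)
      then show "ennreal c * ennreal (A * norm h powr (s * p) * norm h powr (s + t)) \<le> ennreal (c * A * norm h powr (t' * p))"
        using A by (simp add: c_def ennreal_mult'[symmetric] mult_ac)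
    qed
    finally show "translation_int p C u h \<le> ennreal \<theta> * translation_int p C u (2 *\<^sub>R h) + ennreal (c * A * norm h powr (t' * p))" .
  qed
qed

text \<open>The exponent $s\,\frac{p+1}{p-1}$ is the fixed point of $t\mapsto s+\frac{s+t}{p}$.\<close>

lemma nikolskii_below:
  assumes T: "0 \<le> T" "T < 1" "T < s * ((p + 1) / (p - 1))"
  shows "nikolskii T"
proof (cases "T \<le> s")
  \<comment> \<open>Here an improvement step is used to lower the exponent, as
    \<open>nikolskii_improve\<close> accepts any smaller nonnegative t'.\<close>
  case True
  have "0 \<le> (s + s) / p" using s0 p2 by simp
  then have "T \<le> s + (s + s) / p" using True by linarith
  then show ?thesis using s0 T by (intro nikolskii_improve[OF nikolskii_s]) auto
next
  case False
  define f where "f = s * ((p + 1) / (p - 1))"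
  \<comment> \<open>The gain s + (s + t)/p - t equals (f - t)(1 - 1/p). It decreases to 0 as t
    approaches f, but for t \<le> T it is at least d, so finitely many steps suffice.\<close>
  define d where "d = (f - T) * (1 - 1 / p)"
  have d: "0 < d" using T p2 by (auto simp: d_def f_def)
  have fp: "f * (1 - 1 / p) = s + s / p" using p2 by (simp add: f_def field_simps)
  have step: "t + d \<le> s + (s + t) / p" if "t \<le> T" for t
  proof -
    have "(f - T) * (1 - 1 / p) \<le> (f - t) * (1 - 1 / p)" using that p2 by (intro mult_right_mono) auto
    also have "\<dots> = (s + s / p) - t * (1 - 1 / p)" unfolding fp[symmetric] by (simp add: left_diff_distrib)
    also have "\<dots> = s + (s + t) / p - t" by (simp add: right_diff_distrib add_divide_distrib)
    finally show ?thesis by (simp add: d_def)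
  qed
  have all: "nikolskii (min T (s + real n * d))" for n
  proof (induction n)
    case 0
    then show ?case using nikolskii_s False by (simp add: min_def)
  next
    case (Suc n)
    have "min T (s + real (Suc n) * d) \<le> min T (s + real n * d) + d" using d by (auto simp: min_def algebra_simps)
    also have "\<dots> \<le> s + (s + min T (s + real n * d)) / p" by (rule step) simp
    finally have "min T (s + real (Suc n) * d) \<le> s + (s + min T (s + real n * d)) / p" .
    moreover have "0 \<le> s + real m * d" for m using s0 d by simp
    ultimately show ?case using T by (intro nikolskii_improve[OF Suc]) (auto simp del: of_nat_Suc)
  qed
  obtain n :: nat where "(T - s) / d \<le> real n" using real_arch_simple by blast
  then have "T \<le> s + real n * d" using d by (simp add: field_simps)
  then show ?thesis using all[of n] by (simp add: min_absorb1)
qed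

end

section \<open>The gradient\<close>

text \<open>The decay is shared out: with q = b^2, the sum of b^(-k) times the p-th powers of the
  increments still has finite integral, hence is finite almost everywhere. There the increments are
  at most a constant times b^(k/p), which is summable.\<close>

lemma AE_convergent_of_geometric:
  fixes D :: "nat \<Rightarrow> 'a::euclidean_space \<Rightarrow> real"
  assumes [measurable]: "\<And>k. D k \<in> borel_measurable borel" "C \<in> sets borel"
    and q: "0 < q" "q < 1" and p: "0 < p" and A: "0 \<le> A"
    and le: "\<And>k. Lp_int p C (\<lambda>x. D (Suc k) x - D k x) \<le> ennreal (A * q ^ k)"
  shows "AE x in lborel. x \<in> C \<longrightarrow> convergent (\<lambda>k. D k x)"
proof -
  define b where "b = sqrt q"
  have b: "0 < b" "b < 1" "q = b * b" using q by (auto simp: b_def)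
  define f where "f k x = ennreal ((1 / b) ^ k) * (indicator C x * ennreal (\<bar>D (Suc k) x - D k x\<bar> powr p))" for k x
  have [measurable]: "f k \<in> borel_measurable borel" for k unfolding f_def[abs_def] by measurable
  have "(\<integral>\<^sup>+x. (\<Sum>k. f k x) \<partial>lborel) = (\<Sum>k. \<integral>\<^sup>+x. f k x \<partial>lborel)"
    by (rule nn_integral_suminf) measurable
  also have "\<dots> \<le> (\<Sum>k. ennreal (A * b ^ k))"
  proof (intro suminf_le)
    fix k
    have "(\<integral>\<^sup>+x. f k x \<partial>lborel) = ennreal ((1 / b) ^ k) * Lp_int p C (\<lambda>x. D (Suc k) x - D k x)"
      unfolding f_def Lp_int_def by (simp add: nn_integral_cmult)
    also have "\<dots> \<le> ennreal ((1 / b) ^ k) * ennreal (A * q ^ k)"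
      by (intro mult_left_mono le) auto
    also have "\<dots> = ennreal (A * b ^ k)"
      using A b by (simp add: ennreal_mult'[symmetric] power_mult_distrib power_divide)
    finally show "(\<integral>\<^sup>+x. f k x \<partial>lborel) \<le> ennreal (A * b ^ k)" .
  qed auto
  also have "\<dots> = ennreal (\<Sum>k. A * b ^ k)"
    using A b by (intro suminf_ennreal2) (auto intro!: summable_mult summable_geometric)
  finally have "(\<integral>\<^sup>+x. (\<Sum>k. f k x) \<partial>lborel) \<noteq> \<infinity>" by (auto simp: top_unique)
  then have "AE x in lborel. (\<Sum>k. f k x) \<noteq> \<infinity>"
    by (intro nn_integral_noteq_infinite) measurable
  then show ?thesis
  proof eventually_elim
    case (elim x)
    show ?case
    proof
      assume x: "x \<in> C"
      obtain M where M: "(\<Sum>k. f k x) = ennreal M" "0 \<le> M" using elim by (cases "\<Sum>k. f k x") auto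
      define E where "E k = D (Suc k) x - D k x" for k
      have Ele: "\<bar>E k\<bar> \<le> M powr (1 / p) * (b powr (1 / p)) ^ k" for k
      proof -
        have "f k x \<le> (\<Sum>k. f k x)"
          using sum_le_suminf[of "\<lambda>k. f k x" "{k}"] by simp
        then have "ennreal ((1 / b) ^ k * \<bar>E k\<bar> powr p) \<le> ennreal M"
          using x M b by (simp add: f_def E_def ennreal_mult'[symmetric])
        then have "(1 / b) ^ k * \<bar>E k\<bar> powr p \<le> M" using M by (subst (asm) ennreal_le_iff) auto
        then have "\<bar>E k\<bar> powr p \<le> M * b ^ k" using b by (simp add: power_divide field_simps)
        then have "(\<bar>E k\<bar> powr p) powr (1 / p) \<le> (M * b ^ k) powr (1 / p)" using p by (intro powr_mono2) auto
        also have "(\<bar>E k\<bar> powr p) powr (1 / p) = \<bar>E k\<bar>" using p by (simp add: powr_powr)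
        also have "(M * b ^ k) powr (1 / p) = M powr (1 / p) * (b powr (1 / p)) ^ k"
          using b M by (simp add: powr_mult powr_powr powr_realpow[symmetric] mult.commute)
        finally show ?thesis .
      qed
      have "b powr (1 / p) < 1" using b p powr_less_mono2[of "1 / p" b 1] by simp
      then have "summable (\<lambda>k. M powr (1 / p) * (b powr (1 / p)) ^ k)"
        by (intro summable_mult summable_geometric) simp
      then have "summable E"
        by (rule summable_comparison_test'[where N = 0]) (use Ele in simp)
      then have "convergent (\<lambda>n. \<Sum>k<n. E k)" by (simp add: summable_iff_convergent)
      then have "convergent (\<lambda>n. D 0 x + (\<Sum>k<n. E k))" by (rule convergent_add[OF convergent_const])
      moreover have "D 0 x + (\<Sum>k<n. E k) = D n x" for n
        unfolding E_def by (simp add: sum_lessThan_telescope[of "\<lambda>k. D k x"])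
      ultimately show "convergent (\<lambda>k. D k x)" by simp
    qed
  qed
qed

text \<open>Adding the increments one at a time with the constant 2^p could destroy the decay.
  Peeling off the first increment with \<open>Lp_int_add_weighted\<close> costs l^(1-p) on the
  remainder, which starts at k + 1 and is smaller by the factor q; so l only has to satisfy l^(1-p)
  q < 1.\<close>

lemma Lp_int_cauchy_of_geometric:
  fixes D :: "nat \<Rightarrow> 'a::euclidean_space \<Rightarrow> real"
  assumes [measurable]: "\<And>k. D k \<in> borel_measurable borel" "C \<in> sets borel"
    and q: "0 < q" "q < 1" and p: "1 \<le> p" and A: "0 \<le> A"
    and le: "\<And>k. Lp_int p C (\<lambda>x. D (Suc k) x - D k x) \<le> ennreal (A * q ^ k)"
  obtains A' where "0 \<le> A'" "\<And>k n. Lp_int p C (\<lambda>x. D (k + n) x - D k x) \<le> ennreal (A' * q ^ k)"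
proof -
  \<comment> \<open>With this choice l^(1-p) q is q raised to the positive exponent 1 -
    (p-1)/(2p).\<close>
  define l where "l = q powr (1 / (2 * p))"
  have l: "0 < l" "l < 1" using q p powr_less_mono2[of "1 / (2 * p)" q 1] by (auto simp: l_def)
  define \<rho> where "\<rho> = l powr (1 - p) * q"
  have "\<rho> = q powr (1 / (2 * p) * (1 - p) + 1)"
    using q by (simp add: \<rho>_def l_def powr_powr powr_add)
  also have "\<dots> < 1"
  proof -
    have "0 < 1 / (2 * p) * (1 - p) + 1" using p by (simp add: field_simps)
    then show ?thesis using q powr_less_mono2[of _ q 1] by simp
  qed
  finally have \<rho>: "\<rho> < 1" .
  define c where "c = (1 - l) powr (1 - p)"
  \<comment> \<open>Solves \<rho> A' + c A = A', so that the induction reproduces its own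
    constant.\<close>
  define A' where "A' = c * A / (1 - \<rho>)"
  have A': "0 \<le> A'" "\<rho> * A' + c * A = A'"
    using \<rho> A by (auto simp: A'_def c_def field_simps)
  have "Lp_int p C (\<lambda>x. D (k + n) x - D k x) \<le> ennreal (A' * q ^ k)" for n k
  proof (induction n arbitrary: k)
    case 0
    then show ?case using p by (simp add: Lp_int_def)
  next
    case (Suc n)
    have "Lp_int p C (\<lambda>x. D (k + Suc n) x - D k x) = Lp_int p C (\<lambda>x. (D (Suc k + n) x - D (Suc k) x) + (D (Suc k) x - D k x))"
      by simp
    also have "\<dots> \<le> ennreal (l powr (1 - p)) * Lp_int p C (\<lambda>x. D (Suc k + n) x - D (Suc k) x) + ennreal c * Lp_int p C (\<lambda>x. D (Suc k) x - D k x)"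
      unfolding c_def by (intro Lp_int_add_weighted l p) measurable
    also have "\<dots> \<le> ennreal (l powr (1 - p)) * ennreal (A' * q ^ Suc k) + ennreal c * ennreal (A * q ^ k)"
      by (intro add_mono mult_left_mono Suc.IH le) auto
    also have "\<dots> = ennreal ((\<rho> * A' + c * A) * q ^ k)"
      using A'(1) A q by (simp add: \<rho>_def c_def ennreal_mult'[symmetric] ennreal_plus[symmetric] algebra_simps del: ennreal_plus)
    finally show ?case by (simp add: A')
  qed
  then show ?thesis using that A' by blast
qed

text \<open>Fatou's lemma in n: a Cauchy bound uniform in n passes to the almost everywhere
  limit.\<close>

lemma Lp_int_lim_of_geometric:
  fixes D :: "nat \<Rightarrow> 'a::euclidean_space \<Rightarrow> real"
  assumes [measurable]: "\<And>k. D k \<in> borel_measurable borel" "C \<in> sets borel"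
    and p: "0 < p"
    and conv: "AE x in lborel. x \<in> C \<longrightarrow> convergent (\<lambda>k. D k x)"
    and le: "\<And>n. Lp_int p C (\<lambda>x. D (k + n) x - D k x) \<le> ennreal B"
  shows "Lp_int p C (\<lambda>x. lim (\<lambda>k. D k x) - D k x) \<le> ennreal B"
proof -
  have "Lp_int p C (\<lambda>x. lim (\<lambda>k. D k x) - D k x) =
     (\<integral>\<^sup>+x. liminf (\<lambda>n. indicator C x * ennreal (\<bar>D (k + n) x - D k x\<bar> powr p)) \<partial>lborel)"
    unfolding Lp_int_def
  proof (rule nn_integral_cong_AE)
    show "AE x in lborel. indicator C x * ennreal (\<bar>lim (\<lambda>k. D k x) - D k x\<bar> powr p) =
       liminf (\<lambda>n. indicator C x * ennreal (\<bar>D (k + n) x - D k x\<bar> powr p))"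
      using conv
    proof eventually_elim
      case (elim x)
      show ?case
      proof (cases "x \<in> C")
        case True
        then have "(\<lambda>k. D k x) \<longlonglongrightarrow> lim (\<lambda>k. D k x)" using elim by (simp add: convergent_LIMSEQ_iff)
        then have "(\<lambda>n. D (k + n) x) \<longlonglongrightarrow> lim (\<lambda>k. D k x)"
          using LIMSEQ_ignore_initial_segment[of "\<lambda>k. D k x" _ k] by (simp add: add.commute)
        then have "(\<lambda>n. \<bar>D (k + n) x - D k x\<bar> powr p) \<longlonglongrightarrow> \<bar>lim (\<lambda>k. D k x) - D k x\<bar> powr p"
          using p by (intro tendsto_powr' tendsto_intros) auto
        then have "(\<lambda>n. ennreal (\<bar>D (k + n) x - D k x\<bar> powr p)) \<longlonglongrightarrow> ennreal (\<bar>lim (\<lambda>k. D k x) - D k x\<bar> powr p)"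
          by (rule tendsto_ennrealI)
        from lim_imp_Liminf[OF sequentially_bot this] show ?thesis using True by simp
      qed (simp add: Liminf_const)
    qed
  qed
  also have "\<dots> \<le> liminf (\<lambda>n. Lp_int p C (\<lambda>x. D (k + n) x - D k x))"
    unfolding Lp_int_def by (rule nn_integral_liminf) measurable
  also have "\<dots> \<le> liminf (\<lambda>n. ennreal B)"
    by (intro Liminf_mono always_eventually allI le)
  also have "\<dots> = ennreal B" by (simp add: Liminf_const)
  finally show ?thesis .
qed

lemma emeasure_compact_less_top: "compact C \<Longrightarrow> emeasure lborel (C :: 'a::euclidean_space set) < \<infinity>"
  using emeasure_bounded_finite[OF compact_imp_bounded] by (simp add: less_top)

lemma smooth_cs_test_function: "\<phi> \<in> test_functions \<Omega> \<Longrightarrow> smooth_cs \<phi>"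
  unfolding test_functions_def smooth_cs_def by blast

text \<open>Halving the step makes consecutive quotients differ by 2^k times a second difference
  with both increments equal to the new step, and it is second differences that the equation
  controls beyond order 1.\<close>

definition dyadic_quotient :: "('a::euclidean_space \<Rightarrow> real) \<Rightarrow> 'a \<Rightarrow> nat \<Rightarrow> 'a \<Rightarrow> real" where
  "dyadic_quotient u i k x = 2 ^ k * (u (x + (1 / 2 ^ k) *\<^sub>R i) - u x)"

text \<open>\<open>lim\<close> is meaningless on the null set of \<open>\<Omega>\<close> where the quotients diverge, and possibly off \<open>\<Omega>\<close>.\<close>

definition dyadic_derivative :: "('a::euclidean_space \<Rightarrow> real) \<Rightarrow> 'a \<Rightarrow> 'a \<Rightarrow> real" where
  "dyadic_derivative u i x = lim (\<lambda>k. dyadic_quotient u i k x)"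

lemma measurable_dyadic_quotient [measurable]:
  assumes [measurable]: "u \<in> borel_measurable borel"
  shows "dyadic_quotient u i k \<in> borel_measurable borel"
  unfolding dyadic_quotient_def[abs_def] by measurable

lemma measurable_dyadic_derivative [measurable]:
  assumes [measurable]: "u \<in> borel_measurable borel"
  shows "dyadic_derivative u i \<in> borel_measurable borel"
  unfolding dyadic_derivative_def[abs_def] by measurable

lemma dyadic_quotient_Suc_diff:
  "dyadic_quotient u i (Suc k) x - dyadic_quotient u i k x =
    - (2 ^ k) * ((u (x + (1 / 2 ^ Suc k) *\<^sub>R i + (1 / 2 ^ Suc k) *\<^sub>R i) - u (x + (1 / 2 ^ Suc k) *\<^sub>R i)) - (u (x + (1 / 2 ^ Suc k) *\<^sub>R i) - u x))"
proof -
  have "(1 / 2 ^ Suc k) *\<^sub>R i + (1 / 2 ^ Suc k) *\<^sub>R i = (1 / 2 ^ k) *\<^sub>R i"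
    by (simp add: scaleR_add_left[symmetric])
  then show ?thesis by (simp add: dyadic_quotient_def add.assoc algebra_simps)
qed

context borel_solution
begin

lemma Lp_int_dyadic_quotient_finite:
  assumes [measurable]: "C \<in> sets borel"
  shows "Lp_int p C (dyadic_quotient u i k) < \<infinity>"
proof -
  obtain B where "\<forall>C\<in>sets borel. \<forall>h. translation_int p C u h \<le> ennreal B" using translation_int_bounded by blast
  then have "translation_int p C u ((1 / 2 ^ k) *\<^sub>R i) \<le> ennreal B" by simp
  then have "translation_int p C u ((1 / 2 ^ k) *\<^sub>R i) < \<infinity>" by (rule le_less_trans) simp
  then show ?thesis
    unfolding dyadic_quotient_def[abs_def] by (subst Lp_int_cmult) (auto simp: translation_int_eq_Lp_int ennreal_mult_less_top)
qed

lemma dyadic_quotient_translation_int: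
  assumes [measurable]: "C \<in> sets borel"
  shows "translation_int p C (dyadic_quotient u i k) h = ennreal ((2 ^ k) powr p) * translation_int p C (\<lambda>x. u (x + (1 / 2 ^ k) *\<^sub>R i) - u x) h"
  unfolding translation_int_eq_Lp_int dyadic_quotient_def right_diff_distrib[symmetric] by (subst Lp_int_cmult) auto

text \<open>At steps of size 2^(-k) the second difference has p-th power of order 2^(-k(s p + s +
  t)), and the factor 2^(k p) from the quotients leaves q^k. Thus q < 1 says that the total order of
  the second difference exceeds 1.\<close>

lemma dyadic_quotient_geometric:
  assumes t: "nikolskii t" "0 \<le> t" and C: "compact C" "C \<subseteq> \<Omega>" and i: "i \<in> Basis"
  defines "q \<equiv> 2 powr (- (s * p + s + t - p))"
  shows "\<exists>A\<ge>0. \<exists>k0. \<forall>k\<ge>k0. Lp_int p C (\<lambda>x. dyadic_quotient u i (Suc k) x - dyadic_quotient u i k x) \<le> ennreal (A * q ^ k)"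
proof -
  obtain A r where A: "0 \<le> A" "0 < r"
    "\<And>h k. norm h < r \<Longrightarrow> norm k < r \<Longrightarrow>
      translation_int p C (\<lambda>x. u (x + h) - u x) k \<le> ennreal (A * norm k powr (s * p) * norm h powr (s + t))"
    using second_difference_estimate[OF t C] by blast
  have [measurable]: "C \<in> sets borel" using C(1) by (simp add: borel_compact)
  obtain k0 where k0: "(1 / 2) ^ k0 < r" using A(2) real_arch_pow_inv[of r "1 / 2"] by auto
  have "Lp_int p C (\<lambda>x. dyadic_quotient u i (Suc k) x - dyadic_quotient u i k x) \<le> ennreal (A * q ^ k)" if k: "k0 \<le> k" for k
  proof -
    define h where "h = (1 / 2 ^ Suc k) *\<^sub>R i"
    have nh: "norm h = 1 / 2 ^ Suc k" using i by (simp add: h_def)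
    have "1 / 2 ^ Suc k \<le> (1 / 2 :: real) ^ k0" using k power_decreasing[of k0 "Suc k" "1/2::real"] by (simp add: power_divide)
    then have hr: "norm h < r" using k0 nh by simp
    have "Lp_int p C (\<lambda>x. dyadic_quotient u i (Suc k) x - dyadic_quotient u i k x) = ennreal ((2 ^ k) powr p) * translation_int p C (\<lambda>x. u (x + h) - u x) h"
      unfolding translation_int_eq_Lp_int dyadic_quotient_Suc_diff h_def[symmetric] by (subst Lp_int_cmult) auto
    also have "\<dots> \<le> ennreal ((2 ^ k) powr p) * ennreal (A * norm h powr (s * p) * norm h powr (s + t))"
      by (intro mult_left_mono A hr) auto
    also have "\<dots> = ennreal (A * ((2 ^ k) powr p * norm h powr (s * p + s + t)))"
      using A by (simp add: ennreal_mult'[symmetric] powr_add mult_ac)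
    also have "\<dots> \<le> ennreal (A * q ^ k)"
    proof (intro ennreal_leI mult_left_mono A)
      have "norm h powr (s * p + s + t) \<le> (1 / 2 ^ k) powr (s * p + s + t)"
        unfolding nh using s0 p2 t(2) by (intro powr_mono2) (auto simp: field_simps)
      then have "(2 ^ k) powr p * norm h powr (s * p + s + t) \<le> (2 ^ k) powr p * (1 / 2 ^ k) powr (s * p + s + t)"
        by (intro mult_left_mono) auto
      also have "\<dots> = (2 ^ k) powr (- (s * p + s + t - p))"
        by (simp add: powr_divide powr_diff powr_minus_divide)
      also have "\<dots> = q ^ k"
        by (simp add: q_def powr_realpow[symmetric] powr_powr mult.commute)
      finally show "(2 ^ k) powr p * norm h powr (s * p + s + t) \<le> q ^ k" .
    qed
    finally show ?thesis .
  qed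
  then show ?thesis using A(1) by blast
qed

lemma dyadic_quotient_converges:
  assumes t: "nikolskii t" "0 \<le> t" and \<sigma>: "p < s * p + s + t" and C: "compact C" "C \<subseteq> \<Omega>" and i: "i \<in> Basis"
  defines "q \<equiv> 2 powr (- (s * p + s + t - p))"
  shows "AE x in lborel. x \<in> C \<longrightarrow> (\<lambda>k. dyadic_quotient u i k x) \<longlonglongrightarrow> dyadic_derivative u i x"
    and "\<exists>A\<ge>0. \<exists>k0. \<forall>k\<ge>k0. Lp_int p C (\<lambda>x. dyadic_derivative u i x - dyadic_quotient u i k x) \<le> ennreal (A * q ^ k)"
proof -
  have [measurable]: "C \<in> sets borel" using C(1) by (simp add: borel_compact)
  have q: "0 < q" "q < 1" using \<sigma> powr_less_mono[of "- (s * p + s + t - p)" 0 2] by (auto simp: q_def)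
  have p1: "1 \<le> p" "0 < p" using p2 by auto
  obtain A k0 where A: "0 \<le> A" "\<And>k. k0 \<le> k \<Longrightarrow> Lp_int p C (\<lambda>x. dyadic_quotient u i (Suc k) x - dyadic_quotient u i k x) \<le> ennreal (A * q ^ k)"
    using dyadic_quotient_geometric[OF t C i] unfolding q_def by blast
  \<comment> \<open>Shifted by k0, so that the geometric bound holds from index 0.\<close>
  define D where "D k = dyadic_quotient u i (k + k0)" for k
  have [measurable]: "D k \<in> borel_measurable borel" for k unfolding D_def by measurable
  have Dle: "Lp_int p C (\<lambda>x. D (Suc k) x - D k x) \<le> ennreal ((A * q ^ k0) * q ^ k)" for k
    using A(2)[of "k + k0"] by (simp add: D_def power_add mult_ac)
  have A0: "0 \<le> A * q ^ k0" using A q by simp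
  have conv: "AE x in lborel. x \<in> C \<longrightarrow> convergent (\<lambda>k. D k x)"
    by (rule AE_convergent_of_geometric[OF _ _ q p1(2) A0 Dle]) measurable
  have cD: "convergent (\<lambda>k. D k x) \<longleftrightarrow> convergent (\<lambda>k. dyadic_quotient u i k x)" for x
    unfolding D_def by (rule convergent_ignore_initial_segment)
  show "AE x in lborel. x \<in> C \<longrightarrow> (\<lambda>k. dyadic_quotient u i k x) \<longlonglongrightarrow> dyadic_derivative u i x"
    using conv by eventually_elim (simp add: cD dyadic_derivative_def convergent_LIMSEQ_iff)
  obtain A' where A': "0 \<le> A'" "\<And>k n. Lp_int p C (\<lambda>x. D (k + n) x - D k x) \<le> ennreal (A' * q ^ k)"
  proof (rule Lp_int_cauchy_of_geometric[OF _ _ q p1(1) A0 Dle])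
    show "D k \<in> borel_measurable borel" for k by measurable
    show "C \<in> sets borel" by measurable
  qed (rule that)
  have limD: "Lp_int p C (\<lambda>x. lim (\<lambda>k. D k x) - D k x) \<le> ennreal (A' * q ^ k)" for k
    by (rule Lp_int_lim_of_geometric[OF _ _ p1(2) conv A'(2)]) measurable
  \<comment> \<open>The shift by k0 does not change the limit where there is one; elsewhere nothing
    relates the two values of \<open>lim\<close>.\<close>
  have "AE x in lborel. x \<in> C \<longrightarrow> lim (\<lambda>k. D k x) = dyadic_derivative u i x"
    using conv
  proof eventually_elim
    case (elim x)
    show ?case
    proof
      assume "x \<in> C"
      then have "(\<lambda>k. dyadic_quotient u i k x) \<longlonglongrightarrow> dyadic_derivative u i x"
        using elim by (simp add: cD dyadic_derivative_def convergent_LIMSEQ_iff)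
      then have "(\<lambda>k. D k x) \<longlonglongrightarrow> dyadic_derivative u i x" unfolding D_def by (rule LIMSEQ_ignore_initial_segment)
      then show "lim (\<lambda>k. D k x) = dyadic_derivative u i x" by (rule limI)
    qed
  qed
  then have eq: "Lp_int p C (\<lambda>x. dyadic_derivative u i x - D k x) = Lp_int p C (\<lambda>x. lim (\<lambda>k. D k x) - D k x)" for k
    unfolding Lp_int_def by (intro nn_integral_cong_AE, elim eventually_mono) auto
  have "Lp_int p C (\<lambda>x. dyadic_derivative u i x - dyadic_quotient u i k x) \<le> ennreal (A' / q ^ k0 * q ^ k)" if "k0 \<le> k" for k
  proof -
    have "Lp_int p C (\<lambda>x. dyadic_derivative u i x - D (k - k0) x) \<le> ennreal (A' * q ^ (k - k0))" unfolding eq by (rule limD)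
    moreover have "A' * q ^ (k - k0) = A' / q ^ k0 * q ^ k" using q that by (simp add: power_diff)
    ultimately show ?thesis using that by (simp add: D_def)
  qed
  then show "\<exists>A\<ge>0. \<exists>k0. \<forall>k\<ge>k0. Lp_int p C (\<lambda>x. dyadic_derivative u i x - dyadic_quotient u i k x) \<le> ennreal (A * q ^ k)"
    using A' q by (intro exI[of _ "A' / q ^ k0"]) auto
qed

lemma Lp_int_dyadic_derivative_finite:
  assumes t: "nikolskii t" "0 \<le> t" and \<sigma>: "p < s * p + s + t" and C: "compact C" "C \<subseteq> \<Omega>" and i: "i \<in> Basis"
  shows "Lp_int p C (dyadic_derivative u i) < \<infinity>"
proof -
  have [measurable]: "C \<in> sets borel" using C(1) by (simp add: borel_compact)
  obtain A k where "Lp_int p C (\<lambda>x. dyadic_derivative u i x - dyadic_quotient u i k x) \<le> ennreal A"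
    using dyadic_quotient_converges(2)[OF t \<sigma> C i] by blast
  then have fin: "Lp_int p C (\<lambda>x. dyadic_derivative u i x - dyadic_quotient u i k x) < \<infinity>" by (auto simp: less_top[symmetric] top_unique)
  have "Lp_int p C (dyadic_derivative u i) = Lp_int p C (\<lambda>x. (dyadic_derivative u i x - dyadic_quotient u i k x) + dyadic_quotient u i k x)" by simp
  also have "\<dots> \<le> ennreal (2 powr p) * (Lp_int p C (\<lambda>x. dyadic_derivative u i x - dyadic_quotient u i k x) + Lp_int p C (dyadic_quotient u i k))"
    using p2 by (intro Lp_int_add_le) auto
  also have "\<dots> < \<infinity>" using fin Lp_int_dyadic_quotient_finite[of C i k] by (simp add: ennreal_mult_less_top)
  finally show ?thesis .
qed

text \<open>The step of the difference quotient is chosen comparable to \<open>norm h\<close>.\<close>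

lemma translation_int_dyadic_derivative_le:
  assumes t: "nikolskii t" "0 \<le> t" "t < 1" and \<sigma>: "p < s * p + s + t" and C: "compact C" "C \<subseteq> \<Omega>" and i: "i \<in> Basis"
  shows "\<exists>A\<ge>0. \<exists>r>0. \<forall>h. norm h < r \<longrightarrow> translation_int p C (dyadic_derivative u i) h \<le> ennreal (A * norm h powr (s * p + s + t - p))"
proof -
  define \<sigma>' where "\<sigma>' = s * p + s + t - p"
  have \<sigma>'0: "0 < \<sigma>'" using \<sigma> by (simp add: \<sigma>'_def)
  define q where "q = 2 powr (- \<sigma>')"
  have [measurable]: "C \<in> sets borel" using C(1) by (simp add: borel_compact)
  obtain d C' where d: "0 < d" and cC': "compact C'" and C'\<Omega>: "C' \<subseteq> \<Omega>"
    and CC': "\<And>x h. x \<in> C \<Longrightarrow> norm h \<le> d \<Longrightarrow> x + h \<in> C'"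
    by (rule compact_neighbourhood[OF C open_\<Omega>]) (rule that)
  have [measurable]: "C' \<in> sets borel" using cC' by (simp add: borel_compact)
  have sub: "C \<subseteq> C'" using CC'[of _ 0] d(1) by auto
  obtain A1 k0 where A1: "0 \<le> A1" "\<And>k. k0 \<le> k \<Longrightarrow> Lp_int p C' (\<lambda>x. dyadic_derivative u i x - dyadic_quotient u i k x) \<le> ennreal (A1 * q ^ k)"
    using dyadic_quotient_converges(2)[OF t(1,2) \<sigma> cC' C'\<Omega> i] unfolding q_def \<sigma>'_def by blast
  obtain A2 r where A2: "0 \<le> A2" "0 < r"
    "\<And>h k. norm h < r \<Longrightarrow> norm k < r \<Longrightarrow>
      translation_int p C (\<lambda>x. u (x + h) - u x) k \<le> ennreal (A2 * norm k powr (s * p) * norm h powr (s + t))"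
    using second_difference_estimate[OF t(1,2) C] by blast
  \<comment> \<open>d keeps C + h inside C'; r / 2 ensures 2^(-k) \<le> 2|h| < r; 1 / 2^k0 ensures
    that the chosen k is at least k0.\<close>
  define r' where "r' = min (min d (r / 2)) (1 / 2 ^ k0)"
  have r': "0 < r'" "r' \<le> d" "r' \<le> r / 2" "r' \<le> 1 / 2 ^ k0" using d A2 by (auto simp: r'_def)
  define A where "A = 2 powr p * (2 powr p * (2 * (A1 * 2 powr \<sigma>')) + A2)"
  have A: "0 \<le> A" using A1 A2 by (simp add: A_def)
  have "translation_int p C (dyadic_derivative u i) h \<le> ennreal (A * norm h powr \<sigma>')" if h: "norm h < r'" for h
  proof (cases "h = 0")
    case True
    then show ?thesis using p2 by (simp add: translation_int_def)
  next
    case False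
    have "0 < norm h" "norm h < 1 / 2 ^ k0" using False less_le_trans[OF h r'(4)] by auto
    then obtain j where j: "1 / 2 ^ k0 / 2 ^ Suc j \<le> norm h" "norm h < 1 / 2 ^ k0 / 2 ^ j" by (rule dyadic_scale)
    define k where "k = k0 + j"
    have k: "k0 \<le> k" by (simp add: k_def)
    have k1: "norm h \<le> 1 / 2 ^ k" using j(2) by (simp add: k_def power_add mult.commute)
    have k2: "1 / 2 ^ k \<le> 2 * norm h" using j(1) by (simp add: k_def power_add field_simps)
    let ?g = "\<lambda>x. dyadic_derivative u i x - dyadic_quotient u i k x"
    \<comment> \<open>Replacing the derivative by the quotient of step 2^(-k) costs q^k = 2^(-k
      \<sigma>'), which is of order |h|^\<sigma>' by the choice of k.\<close>
    have g1: "Lp_int p C ?g \<le> ennreal (A1 * 2 powr \<sigma>' * norm h powr \<sigma>')" and g2: "Lp_int p C (\<lambda>x. ?g (x + h)) \<le> ennreal (A1 * 2 powr \<sigma>' * norm h powr \<sigma>')"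
    proof -
      have "q ^ k = (1 / 2 ^ k) powr \<sigma>'"
        by (simp add: q_def powr_realpow[symmetric] powr_powr powr_divide powr_minus_divide mult.commute)
      also have "\<dots> \<le> (2 * norm h) powr \<sigma>'" using k2 \<sigma>'0 by (intro powr_mono2) auto
      also have "\<dots> = 2 powr \<sigma>' * norm h powr \<sigma>'" by (simp add: powr_mult)
      finally have "A1 * q ^ k \<le> A1 * (2 powr \<sigma>' * norm h powr \<sigma>')" using A1 by (intro mult_left_mono) auto
      then have le: "Lp_int p C' ?g \<le> ennreal (A1 * 2 powr \<sigma>' * norm h powr \<sigma>')"
        using A1(2)[OF k] by (auto intro: order_trans ennreal_leI simp: mult.assoc)
      have "Lp_int p C ?g \<le> Lp_int p C' ?g"
        using sub by (rule Lp_int_mono_set)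
      then show "Lp_int p C ?g \<le> ennreal (A1 * 2 powr \<sigma>' * norm h powr \<sigma>')" using le by simp
      have "Lp_int p C (\<lambda>x. ?g (x + h)) \<le> (\<integral>\<^sup>+x. indicator C' (x + h) * ennreal (\<bar>?g (x + h)\<bar> powr p) \<partial>lborel)"
        unfolding Lp_int_def using CC' h r' by (intro nn_integral_mono) (auto simp: indicator_def)
      also have "\<dots> = Lp_int p C' ?g"
        unfolding Lp_int_def using nn_integral_lborel_translate[of "\<lambda>x. indicator C' x * ennreal (\<bar>?g x\<bar> powr p)" h] by simp
      finally show "Lp_int p C (\<lambda>x. ?g (x + h)) \<le> ennreal (A1 * 2 powr \<sigma>' * norm h powr \<sigma>')" using le by simp
    qed
    have g3: "translation_int p C (dyadic_quotient u i k) h \<le> ennreal (A2 * norm h powr \<sigma>')"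
    proof -
      have nk: "norm ((1 / 2 ^ k) *\<^sub>R i) = 1 / 2 ^ k" using i by simp
      have "1 / 2 ^ k < r" using k2 h r' by simp
      then have "translation_int p C (\<lambda>x. u (x + (1 / 2 ^ k) *\<^sub>R i) - u x) h \<le> ennreal (A2 * norm h powr (s * p) * (1 / 2 ^ k) powr (s + t))"
        using A2(3)[of "(1 / 2 ^ k) *\<^sub>R i" h] nk h r' A2(2) by simp
      then have "translation_int p C (dyadic_quotient u i k) h \<le> ennreal ((2 ^ k) powr p) * ennreal (A2 * norm h powr (s * p) * (1 / 2 ^ k) powr (s + t))"
        by (simp add: dyadic_quotient_translation_int mult_left_mono)
      also have "\<dots> = ennreal (A2 * (norm h powr (s * p) * ((2 ^ k) powr p * (1 / 2 ^ k) powr (s + t))))"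
        using A2 by (simp add: ennreal_mult'[symmetric] mult_ac)
      also have "\<dots> \<le> ennreal (A2 * norm h powr \<sigma>')"
      proof (intro ennreal_leI mult_left_mono A2)
        have "(2 ^ k) powr p * (1 / 2 ^ k) powr (s + t) = (1 / 2 ^ k) powr (s + t - p)"
          by (simp add: powr_divide powr_diff)
        \<comment> \<open>The exponent s + t - p is negative, because s < 1, t < 1 and p \<ge> 2, so
          the bound needed is |h| \<le> 2^(-k).\<close>
        also have "\<dots> \<le> norm h powr (s + t - p)"
          using k1 False s1 t p2 by (intro powr_mono2') auto
        finally have "norm h powr (s * p) * ((2 ^ k) powr p * (1 / 2 ^ k) powr (s + t)) \<le> norm h powr (s * p) * norm h powr (s + t - p)"
          by (intro mult_left_mono) auto
        also have "\<dots> = norm h powr \<sigma>'" by (simp add: powr_add[symmetric] \<sigma>'_def algebra_simps)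
        finally show "norm h powr (s * p) * ((2 ^ k) powr p * (1 / 2 ^ k) powr (s + t)) \<le> norm h powr \<sigma>'" .
      qed
      finally show ?thesis .
    qed
    have "translation_int p C (dyadic_derivative u i) h = Lp_int p C (\<lambda>x. (?g (x + h) - ?g x) + (dyadic_quotient u i k (x + h) - dyadic_quotient u i k x))"
      by (simp add: translation_int_eq_Lp_int)
    also have "\<dots> \<le> ennreal (2 powr p) * (Lp_int p C (\<lambda>x. ?g (x + h) - ?g x) + translation_int p C (dyadic_quotient u i k) h)"
      unfolding translation_int_eq_Lp_int using p2 by (intro Lp_int_add_le) auto
    also have "\<dots> \<le> ennreal (2 powr p) * (ennreal (2 powr p) * (Lp_int p C (\<lambda>x. ?g (x + h)) + Lp_int p C ?g) + translation_int p C (dyadic_quotient u i k) h)"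
      using p2 by (intro mult_left_mono add_mono Lp_int_diff_le) auto
    also have "\<dots> \<le> ennreal (2 powr p) * (ennreal (2 powr p) * (ennreal (A1 * 2 powr \<sigma>' * norm h powr \<sigma>') + ennreal (A1 * 2 powr \<sigma>' * norm h powr \<sigma>')) + ennreal (A2 * norm h powr \<sigma>'))"
      by (intro mult_left_mono add_mono g1 g2 g3) auto
    also have "\<dots> = ennreal (2 powr p * (2 powr p * (A1 * 2 powr \<sigma>' * norm h powr \<sigma>' + A1 * 2 powr \<sigma>' * norm h powr \<sigma>') + A2 * norm h powr \<sigma>'))"
      using A1 A2 by (simp only: ennreal_mult' ennreal_plus add_nonneg_nonneg mult_nonneg_nonneg powr_ge_zero)
    also have "2 powr p * (2 powr p * (A1 * 2 powr \<sigma>' * norm h powr \<sigma>' + A1 * 2 powr \<sigma>' * norm h powr \<sigma>') + A2 * norm h powr \<sigma>') = A * norm h powr \<sigma>'"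
      by (simp add: A_def algebra_simps)
    finally show ?thesis .
  qed
  then show ?thesis using A r'(1) unfolding \<sigma>'_def by blast
qed

text \<open>Summation by parts at a fixed step, then a limit on both sides. The quotients of \<phi>
  are bounded by the mean value theorem and vanish off a fixed compact set, so dominated convergence
  applies against u; the quotients of u converge in L^p on the support of \<phi>.\<close>

lemma dyadic_derivative_integration_by_parts:
  assumes t: "nikolskii t" "0 \<le> t" and \<sigma>: "p < s * p + s + t" and \<phi>: "\<phi> \<in> test_functions \<Omega>" and i: "i \<in> Basis"
  shows "(LINT x|lborel. u x * frechet_derivative \<phi> (at x) i) = - (LINT x|lborel. dyadic_derivative u i x * \<phi> x)"
proof -
  obtain S where S: "compact S" "S \<subseteq> \<Omega>" "\<And>x. x \<notin> S \<Longrightarrow> \<phi> x = 0" using \<phi> unfolding test_functions_def by blast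
  have sm: "smooth_cs \<phi>" using \<phi> by (rule smooth_cs_test_function)
  define D\<phi> where "D\<phi> x = frechet_derivative \<phi> (at x)" for x
  have D\<phi>: "(\<phi> has_derivative D\<phi> x) (at x)" for x unfolding D\<phi>_def by (rule smooth_cs_has_derivative[OF sm])
  have [measurable]: "S \<in> sets borel" using S(1) by (simp add: borel_compact)
  have [measurable]: "\<phi> \<in> borel_measurable borel" by (rule smooth_cs_measurable[OF sm])
  have smi: "smooth_cs (\<lambda>x. D\<phi> x i)" unfolding D\<phi>_def by (rule smooth_cs_deriv[OF sm])
  have [measurable]: "(\<lambda>x. D\<phi> x i) \<in> borel_measurable borel" by (rule smooth_cs_measurable[OF smi])
  obtain B where B: "0 \<le> B" "\<And>x. \<bar>\<phi> x\<bar> \<le> B" using smooth_cs_bounded[OF sm] by blast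
  obtain B' where B': "0 \<le> B'" "\<And>x. \<bar>D\<phi> x i\<bar> \<le> B'" using smooth_cs_bounded[OF smi] by blast
  have p1: "1 \<le> p" using p2 by simp
  \<comment> \<open>The steps 1 / 2^k are at most 1, so this unit neighbourhood contains the
    supports of all quotients of \<phi>.\<close>
  define S' where "S' = {x + y | x y. x \<in> S \<and> y \<in> cball 0 1}"
  have cS': "compact S'" unfolding S'_def by (intro compact_sums S(1) compact_cball)
  have [measurable]: "S' \<in> sets borel" using cS' by (simp add: borel_compact)
  have SS': "x + y \<in> S'" if "x \<in> S" "norm y \<le> 1" for x y
    unfolding S'_def using that by (intro CollectI exI[of _ x] exI[of _ y]) auto
  have loc_int: "integrable lborel (\<lambda>x. indicator T x * v x)"
    if [measurable]: "v \<in> borel_measurable borel" "T \<in> sets borel" and T: "compact T" and fin: "Lp_int p T v < \<infinity>" for T :: "'a set" and v :: "'a \<Rightarrow> real"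
  proof (rule integrable_of_Lp_int[OF _ compact_imp_bounded[OF T] _ p1])
    have "Lp_int p UNIV (\<lambda>x. indicator T x * v x) = Lp_int p T v"
      unfolding Lp_int_def using p2 by (intro nn_integral_cong) (auto simp: indicator_def)
    then show "Lp_int p UNIV (\<lambda>x. indicator T x * v x) < \<infinity>" using fin by simp
  qed (auto simp: indicator_def)
  \<comment> \<open>Moving the shift from u to \<phi> turns the forward quotient into a backward
    one, whose limit is minus the derivative; this is the minus sign in the claim.\<close>
  define k\<phi> where "k\<phi> k x = 2 ^ k * (\<phi> (x + - ((1 / 2 ^ k) *\<^sub>R i)) - \<phi> x)" for k x
  have k\<phi>_le: "\<bar>k\<phi> k x\<bar> \<le> B'" for k x
  proof -
    obtain t where t: "\<phi> (x + - ((1 / 2 ^ k) *\<^sub>R i)) - \<phi> x = D\<phi> (x + t *\<^sub>R (- ((1 / 2 ^ k) *\<^sub>R i))) (- ((1 / 2 ^ k) *\<^sub>R i))"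
      using mvt_line[OF D\<phi>, where z = x and h = "- ((1 / 2 ^ k) *\<^sub>R i)"] by metis
    have lin: "linear (D\<phi> z)" for z using D\<phi> has_derivative_linear by blast
    have "k\<phi> k x = - D\<phi> (x + t *\<^sub>R (- ((1 / 2 ^ k) *\<^sub>R i))) i"
      unfolding k\<phi>_def t by (simp add: linear_neg[OF lin] linear_cmul[OF lin])
    then show ?thesis using B'(2) by simp
  qed
  have k\<phi>_supp: "k\<phi> k x = 0" if x: "x \<notin> S'" for k x
  proof -
    have "x \<notin> S" using SS'[of x 0] x by auto
    moreover have "x + - ((1 / 2 ^ k) *\<^sub>R i) \<notin> S"
    proof
      assume "x + - ((1 / 2 ^ k) *\<^sub>R i) \<in> S"
      from SS'[OF this, of "(1 / 2 ^ k) *\<^sub>R i"] have "x \<in> S'" using i by simp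
      then show False using x by simp
    qed
    ultimately show ?thesis using S(3) by (simp add: k\<phi>_def)
  qed
  have [measurable]: "k\<phi> k \<in> borel_measurable borel" for k unfolding k\<phi>_def[abs_def] by measurable
  have k\<phi>_lim: "(\<lambda>k. k\<phi> k x) \<longlonglongrightarrow> - D\<phi> x i" for x
  proof -
    have lin: "linear (D\<phi> x)" using D\<phi> has_derivative_linear by blast
    have "((\<lambda>t. \<phi> (x + t *\<^sub>R i)) has_derivative (\<lambda>v. D\<phi> x (v *\<^sub>R i))) (at 0)"
    proof -
      have "((\<lambda>t. x + t *\<^sub>R i) has_derivative (\<lambda>v. v *\<^sub>R i)) (at 0)" by (auto intro!: derivative_eq_intros)
      moreover have "(\<phi> has_derivative D\<phi> x) (at (x + 0 *\<^sub>R i))" using D\<phi> by simp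
      ultimately show ?thesis by (rule has_derivative_compose)
    qed
    then have "((\<lambda>t. \<phi> (x + t *\<^sub>R i)) has_real_derivative D\<phi> x i) (at 0)"
      by (simp add: has_field_derivative_def linear_cmul[OF lin] mult.commute[of _ "D\<phi> x i"] mult_commute_abs)
    then have der: "((\<lambda>t. (\<phi> (x + t *\<^sub>R i) - \<phi> x) / t) \<longlongrightarrow> D\<phi> x i) (at 0)"
      by (simp add: DERIV_def)
    have "(\<lambda>k. - ((1 / 2 :: real) ^ k)) \<longlonglongrightarrow> - 0" by (intro tendsto_minus LIMSEQ_power_zero) simp
    then have "filterlim (\<lambda>k. - ((1 / 2 :: real) ^ k)) (at 0) sequentially"
      by (simp add: filterlim_at)
    from filterlim_compose[OF der this]
    have "(\<lambda>k. (\<phi> (x + - ((1 / 2) ^ k) *\<^sub>R i) - \<phi> x) / - ((1 / 2) ^ k)) \<longlonglongrightarrow> D\<phi> x i" .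
    then have "(\<lambda>k. - ((\<phi> (x + - ((1 / 2) ^ k) *\<^sub>R i) - \<phi> x) / - ((1 / 2) ^ k))) \<longlonglongrightarrow> - D\<phi> x i" by (rule tendsto_minus)
    moreover have "- ((\<phi> (x + - ((1 / 2) ^ k) *\<^sub>R i) - \<phi> x) / - ((1 / 2) ^ k)) = k\<phi> k x" for k
      by (simp add: k\<phi>_def power_divide mult.commute)
    ultimately show ?thesis by simp
  qed
  have parts: "(LINT x|lborel. dyadic_quotient u i k x * \<phi> x) = (LINT x|lborel. u x * k\<phi> k x)" for k
  proof -
    let ?h = "(1 / 2 ^ k) *\<^sub>R i"
    have int: "integrable lborel (\<lambda>x. v x * \<phi> x)" if [measurable]: "v \<in> borel_measurable borel" and "Lp_int p UNIV v < \<infinity>" for v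
    proof -
      have "Lp_int p S v \<le> Lp_int p UNIV v" by (rule Lp_int_mono_set) simp
      then have "integrable lborel (\<lambda>x. (indicator S x * v x) * \<phi> x)"
        using that by (intro integrable_mult_bdd[OF loc_int _ B(2)] S(1)) (auto intro: le_less_trans)
      moreover have "(indicator S x * v x) * \<phi> x = v x * \<phi> x" for x using S(3)[of x] by (auto simp: indicator_def)
      ultimately show ?thesis by simp
    qed
    have i1: "integrable lborel (\<lambda>x. u x * \<phi> x)" by (intro int u_fin) measurable
    have i2: "integrable lborel (\<lambda>x. u (x + ?h) * \<phi> x)"
      using u_fin by (intro int) (auto simp: Lp_int_translate)
    have tr: "(LINT x|lborel. u (x + ?h) * \<phi> x) = (LINT x|lborel. u x * \<phi> (x + - ?h))"
      using integral_lborel_translate[of "\<lambda>x. u x * \<phi> (x + - ?h)" ?h] by simp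
    have i3: "integrable lborel (\<lambda>x. u x * \<phi> (x + - ?h))"
    proof -
      have "(\<integral>\<^sup>+x. ennreal (norm (u x * \<phi> (x + - ?h))) \<partial>lborel) = (\<integral>\<^sup>+x. ennreal (norm (u (x + ?h) * \<phi> x)) \<partial>lborel)"
        using nn_integral_lborel_translate[of "\<lambda>x. ennreal (norm (u x * \<phi> (x + - ?h)))" ?h] by simp
      also have "\<dots> < \<infinity>" using i2 by (simp add: integrable_iff_bounded)
      finally show ?thesis by (intro integrableI_bounded) auto
    qed
    have "(LINT x|lborel. dyadic_quotient u i k x * \<phi> x) = (LINT x|lborel. 2 ^ k * (u (x + ?h) * \<phi> x - u x * \<phi> x))"
      by (simp add: dyadic_quotient_def left_diff_distrib mult.assoc)
    also have "\<dots> = 2 ^ k * ((LINT x|lborel. u x * \<phi> (x + - ?h)) - (LINT x|lborel. u x * \<phi> x))"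
      using i1 i2 by (simp add: tr Bochner_Integration.integral_diff)
    also have "\<dots> = (LINT x|lborel. 2 ^ k * (u x * \<phi> (x + - ?h) - u x * \<phi> x))"
      using i1 i3 by (simp add: Bochner_Integration.integral_diff)
    also have "\<dots> = (LINT x|lborel. u x * k\<phi> k x)"
      by (intro Bochner_Integration.integral_cong) (auto simp: k\<phi>_def algebra_simps)
    finally show ?thesis .
  qed
  have lim1: "(\<lambda>k. LINT x|lborel. u x * k\<phi> k x) \<longlonglongrightarrow> (LINT x|lborel. u x * (- D\<phi> x i))"
  proof (rule integral_dominated_convergence)
    have "Lp_int p S' u \<le> Lp_int p UNIV u" by (rule Lp_int_mono_set) simp
    then have "integrable lborel (\<lambda>x. indicator S' x * u x)"
      using u_fin by (intro loc_int cS') (auto intro: le_less_trans)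
    then have "integrable lborel (\<lambda>x. \<bar>indicator S' x * u x\<bar> * B')" by simp
    then show "integrable lborel (\<lambda>x. \<bar>indicator S' x * u x\<bar> * B')" .
    show "AE x in lborel. norm (u x * k\<phi> k x) \<le> \<bar>indicator S' x * u x\<bar> * B'" for k
    proof (intro AE_I2)
      fix x
      show "norm (u x * k\<phi> k x) \<le> \<bar>indicator S' x * u x\<bar> * B'"
        using k\<phi>_le[of k x] k\<phi>_supp[of x k] by (cases "x \<in> S'") (auto simp: abs_mult mult_left_mono)
    qed
    show "AE x in lborel. (\<lambda>k. u x * k\<phi> k x) \<longlonglongrightarrow> u x * (- D\<phi> x i)"
      by (intro AE_I2 tendsto_mult tendsto_const k\<phi>_lim)
  qed measurable
  have lim2: "(\<lambda>k. LINT x|lborel. dyadic_quotient u i k x * \<phi> x) \<longlonglongrightarrow> (LINT x|lborel. dyadic_derivative u i x * \<phi> x)"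
  proof -
    define q where "q = 2 powr (- (s * p + s + t - p))"
    have q: "0 < q" "q < 1" using \<sigma> powr_less_mono[of "- (s * p + s + t - p)" 0 2] by (auto simp: q_def)
    obtain A k0 where A: "0 \<le> A" "\<And>k. k0 \<le> k \<Longrightarrow> Lp_int p S (\<lambda>x. dyadic_derivative u i x - dyadic_quotient u i k x) \<le> ennreal (A * q ^ k)"
      using dyadic_quotient_converges(2)[OF t \<sigma> S(1,2) i] unfolding q_def by blast
    define V where "V = measure lborel S"
    have V: "0 \<le> V" "emeasure lborel S = ennreal V"
      using emeasure_compact_less_top[OF S(1)] by (auto simp: V_def emeasure_eq_ennreal_measure less_top[symmetric])
    have idyd: "integrable lborel (\<lambda>x. dyadic_derivative u i x * \<phi> x)" and idyq: "integrable lborel (\<lambda>x. dyadic_quotient u i k x * \<phi> x)" for k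
    proof -
      have g: "integrable lborel (\<lambda>x. v x * \<phi> x)" if [measurable]: "v \<in> borel_measurable borel" and "Lp_int p S v < \<infinity>" for v
      proof -
        have "integrable lborel (\<lambda>x. (indicator S x * v x) * \<phi> x)"
          using that by (intro integrable_mult_bdd[OF loc_int _ B(2)] S(1)) auto
        moreover have "(indicator S x * v x) * \<phi> x = v x * \<phi> x" for x using S(3)[of x] by (auto simp: indicator_def)
        ultimately show ?thesis by simp
      qed
      show "integrable lborel (\<lambda>x. dyadic_derivative u i x * \<phi> x)" by (intro g Lp_int_dyadic_derivative_finite[OF t \<sigma> S(1,2) i]) measurable
      show "integrable lborel (\<lambda>x. dyadic_quotient u i k x * \<phi> x)" by (intro g Lp_int_dyadic_quotient_finite; measurable)
    qed
    \<comment> \<open>On S, \<open>le_truncation\<close> trades the L^p bound for an L^1 bound with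
      a free parameter: first d is made small, then k large.\<close>
    have est: "\<bar>(LINT x|lborel. dyadic_derivative u i x * \<phi> x) - (LINT x|lborel. dyadic_quotient u i k x * \<phi> x)\<bar> \<le> B * (d * V + d powr (1 - p) * (A * q ^ k))"
      if k: "k0 \<le> k" and d: "0 < d" for k d
    proof -
      let ?g = "\<lambda>x. dyadic_derivative u i x - dyadic_quotient u i k x"
      have ig: "integrable lborel (\<lambda>x. ?g x * \<phi> x)" unfolding left_diff_distrib using idyd idyq by simp
      have "(LINT x|lborel. dyadic_derivative u i x * \<phi> x) - (LINT x|lborel. dyadic_quotient u i k x * \<phi> x) = (LINT x|lborel. ?g x * \<phi> x)"
        unfolding left_diff_distrib using idyd idyq by simp
      then have "ennreal \<bar>(LINT x|lborel. dyadic_derivative u i x * \<phi> x) - (LINT x|lborel. dyadic_quotient u i k x * \<phi> x)\<bar> \<le> (\<integral>\<^sup>+x. ennreal (norm (?g x * \<phi> x)) \<partial>lborel)"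
        using integral_norm_bound_ennreal[OF ig] by simp
      also have "\<dots> \<le> (\<integral>\<^sup>+x. ennreal B * (ennreal d * indicator S x + ennreal (d powr (1 - p)) * (indicator S x * ennreal (\<bar>?g x\<bar> powr p))) \<partial>lborel)"
      proof (rule nn_integral_mono)
        fix x
        show "ennreal (norm (?g x * \<phi> x)) \<le> ennreal B * (ennreal d * indicator S x + ennreal (d powr (1 - p)) * (indicator S x * ennreal (\<bar>?g x\<bar> powr p)))"
        proof (cases "x \<in> S")
          case True
          have "\<bar>?g x\<bar> * \<bar>\<phi> x\<bar> \<le> (d + d powr (1 - p) * \<bar>?g x\<bar> powr p) * B"
            using B d p1 by (intro mult_mono le_truncation) auto
          then have "ennreal (norm (?g x * \<phi> x)) \<le> ennreal (B * (d + d powr (1 - p) * \<bar>?g x\<bar> powr p))"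
            by (intro ennreal_leI) (simp add: abs_mult mult.commute)
          also have "\<dots> = ennreal B * (ennreal d + ennreal (d powr (1 - p)) * ennreal (\<bar>?g x\<bar> powr p))"
            using B d by (simp add: ennreal_mult')
          finally show ?thesis using True by simp
        qed (simp add: S(3))
      qed
      also have "\<dots> = ennreal B * (ennreal d * emeasure lborel S + ennreal (d powr (1 - p)) * Lp_int p S ?g)"
        unfolding Lp_int_def by (simp add: nn_integral_cmult nn_integral_add nn_integral_cmult_indicator)
      also have "\<dots> \<le> ennreal B * (ennreal d * ennreal V + ennreal (d powr (1 - p)) * ennreal (A * q ^ k))"
        using V by (intro mult_left_mono add_mono A k) auto
      also have "\<dots> = ennreal (B * (d * V + d powr (1 - p) * (A * q ^ k)))"
        using B d V A q by (simp add: ennreal_mult'[symmetric] ennreal_plus[symmetric] del: ennreal_plus)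
      finally show ?thesis using B d V A q by (subst (asm) ennreal_le_iff) auto
    qed
    show ?thesis
    proof (rule LIMSEQ_I)
      fix \<epsilon> :: real assume \<epsilon>: "0 < \<epsilon>"
      \<comment> \<open>Makes B d V at most half of \<epsilon>; the added 1 covers B V = 0.\<close>
      define d where "d = \<epsilon> / (2 * (B * V + 1))"
      have BV: "0 \<le> B * V" using B V by simp
      have d: "0 < d" using \<epsilon> BV by (simp add: d_def add_nonneg_pos)
      have "(\<lambda>k. B * d powr (1 - p) * A * q ^ k) \<longlonglongrightarrow> B * d powr (1 - p) * A * 0"
        using q by (intro tendsto_mult tendsto_const LIMSEQ_power_zero) simp
      then have "\<forall>\<^sub>F k in sequentially. B * d powr (1 - p) * A * q ^ k < \<epsilon> / 2"
        using \<epsilon> by (intro order_tendstoD(2)) auto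
      then obtain k1 where k1: "\<And>k. k1 \<le> k \<Longrightarrow> B * d powr (1 - p) * A * q ^ k < \<epsilon> / 2"
        unfolding eventually_sequentially by blast
      have "B * d * V \<le> \<epsilon> / 2"
      proof -
        have "B * d * V = (B * V) * d" by simp
        also have "\<dots> \<le> (B * V + 1) * d" using d by (intro mult_right_mono) auto
        also have "\<dots> = \<epsilon> / 2"
        proof -
          have cancel: "X * (\<epsilon> / (2 * X)) = \<epsilon> / 2" if "0 < X" for X :: real using that by simp
          show ?thesis unfolding d_def using BV by (intro cancel) simp
        qed
        finally show ?thesis .
      qed
      then have "norm ((LINT x|lborel. dyadic_quotient u i k x * \<phi> x) - (LINT x|lborel. dyadic_derivative u i x * \<phi> x)) < \<epsilon>" if "max k0 k1 \<le> k" for k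
        using est[of k d] k1[of k] that d by (simp add: abs_minus_commute algebra_simps)
      then show "\<exists>no. \<forall>k\<ge>no. norm ((LINT x|lborel. dyadic_quotient u i k x * \<phi> x) - (LINT x|lborel. dyadic_derivative u i x * \<phi> x)) < \<epsilon>"
        by blast
    qed
  qed
  have "(LINT x|lborel. dyadic_derivative u i x * \<phi> x) = (LINT x|lborel. u x * (- D\<phi> x i))"
    using lim1 lim2 unfolding parts by (rule LIMSEQ_unique[rotated])
  then show ?thesis by (simp add: D\<phi>_def)
qed

end

section \<open>The main result\<close>

lemma norm_powr_le_sum_Basis:
  fixes v :: "'a::euclidean_space"
  assumes "0 \<le> q"
  shows "norm v powr q \<le> real DIM('a) powr q * (\<Sum>i\<in>Basis. \<bar>v \<bullet> i\<bar> powr q)"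
proof -
  define m where "m = Max ((\<lambda>i. \<bar>v \<bullet> i\<bar>) ` Basis)"
  have m: "\<bar>v \<bullet> i\<bar> \<le> m" if "i \<in> Basis" for i using that by (simp add: m_def)
  have "m \<in> (\<lambda>i. \<bar>v \<bullet> i\<bar>) ` Basis" unfolding m_def by (rule Max_in) auto
  then obtain j where j: "j \<in> Basis" "m = \<bar>v \<bullet> j\<bar>" by blast
  have "norm v \<le> (\<Sum>i\<in>Basis. \<bar>v \<bullet> i\<bar>)" by (rule norm_le_l1)
  also have "\<dots> \<le> (\<Sum>i\<in>(Basis::'a set). m)" by (intro sum_mono m)
  also have "\<dots> = real DIM('a) * m" by simp
  finally have "norm v powr q \<le> (real DIM('a) * m) powr q" using assms by (intro powr_mono2) auto
  also have "\<dots> = real DIM('a) powr q * \<bar>v \<bullet> j\<bar> powr q" by (simp add: j powr_mult)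
  also have "\<bar>v \<bullet> j\<bar> powr q \<le> (\<Sum>i\<in>Basis. \<bar>v \<bullet> i\<bar> powr q)"
    by (rule member_le_sum) (use j in auto)
  then have "real DIM('a) powr q * \<bar>v \<bullet> j\<bar> powr q \<le> real DIM('a) powr q * (\<Sum>i\<in>Basis. \<bar>v \<bullet> i\<bar> powr q)"
    by (intro mult_left_mono) auto
  finally show ?thesis .
qed

text \<open>The estimates above are for scalar functions; this and the analogous statement for the
  seminorm carry them over to gradients.\<close>

lemma Lp_norm_finite_of_components:
  fixes G :: "'a::euclidean_space \<Rightarrow> 'b::euclidean_space"
  assumes [measurable]: "G \<in> borel_measurable borel" "E \<in> sets borel" and q: "0 \<le> q"
    and fin: "\<And>i. i \<in> Basis \<Longrightarrow> Lp_int q E (\<lambda>x. G x \<bullet> i) < \<infinity>"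
  shows "Lp_norm q E G < \<infinity>"
proof -
  have "(\<integral>\<^sup>+x. ennreal (norm (G x) powr q) \<partial>lebesgue_on E) = (\<integral>\<^sup>+x. indicator E x * ennreal (norm (G x) powr q) \<partial>lborel)"
    by (rule nn_integral_lebesgue_on) measurable
  also have "\<dots> \<le> (\<integral>\<^sup>+x. ennreal (real DIM('b) powr q) * (\<Sum>i\<in>Basis. indicator E x * ennreal (\<bar>G x \<bullet> i\<bar> powr q)) \<partial>lborel)"
  proof (rule nn_integral_mono)
    fix x
    have "ennreal (norm (G x) powr q) \<le> ennreal (real DIM('b) powr q * (\<Sum>i\<in>Basis. \<bar>G x \<bullet> i\<bar> powr q))"
      by (intro ennreal_leI norm_powr_le_sum_Basis q)
    also have "\<dots> = ennreal (real DIM('b) powr q) * (\<Sum>i\<in>Basis. ennreal (\<bar>G x \<bullet> i\<bar> powr q))"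
      by (simp add: ennreal_mult')
    finally show "indicator E x * ennreal (norm (G x) powr q) \<le> ennreal (real DIM('b) powr q) * (\<Sum>i\<in>Basis. indicator E x * ennreal (\<bar>G x \<bullet> i\<bar> powr q))"
      by (auto simp: indicator_def)
  qed
  also have "\<dots> = ennreal (real DIM('b) powr q) * (\<integral>\<^sup>+x. (\<Sum>i\<in>Basis. indicator E x * ennreal (\<bar>G x \<bullet> i\<bar> powr q)) \<partial>lborel)"
    by (rule nn_integral_cmult) measurable
  also have "(\<integral>\<^sup>+x. (\<Sum>i\<in>Basis. indicator E x * ennreal (\<bar>G x \<bullet> i\<bar> powr q)) \<partial>lborel) = (\<Sum>i\<in>Basis. Lp_int q E (\<lambda>x. G x \<bullet> i))"
    unfolding Lp_int_def by (rule nn_integral_sum) measurable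
  also have "ennreal (real DIM('b) powr q) * (\<Sum>i\<in>Basis. Lp_int q E (\<lambda>x. G x \<bullet> i)) < \<infinity>" using fin by (simp add: ennreal_mult_less_top)
  finally show ?thesis unfolding Lp_norm_def ennreal_pow_less_top .
qed

lemma gagliardo_finite_of_components:
  fixes G :: "'a::euclidean_space \<Rightarrow> 'b::euclidean_space"
  assumes [measurable]: "G \<in> borel_measurable borel" "E \<in> sets borel" and q: "0 \<le> q"
    and fin: "\<And>i. i \<in> Basis \<Longrightarrow> gagliardo_int \<tau> q E (\<lambda>x. G x \<bullet> i) < \<infinity>"
  shows "gagliardo \<tau> q E G < \<infinity>"
proof -
  let ?e = "real DIM('a) + \<tau> * q"
  have "(\<integral>\<^sup>+(x, y). ennreal (norm (G x - G y) powr q / norm (x - y) powr ?e) \<partial>lebesgue_on (E \<times> E)) =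
    (\<integral>\<^sup>+x. \<integral>\<^sup>+y. indicator E x * indicator E y * ennreal (norm (G x - G y) powr q / norm (x - y) powr ?e) \<partial>lborel \<partial>lborel)"
    by (rule nn_integral_gagliardo) measurable
  also have "\<dots> \<le> (\<integral>\<^sup>+x. \<integral>\<^sup>+y. ennreal (real DIM('b) powr q) * (\<Sum>i\<in>Basis. indicator E x * indicator E y * ennreal (\<bar>G x \<bullet> i - G y \<bullet> i\<bar> powr q / norm (x - y) powr ?e)) \<partial>lborel \<partial>lborel)"
  proof (intro nn_integral_mono)
    fix x y
    have "norm (G x - G y) powr q / norm (x - y) powr ?e \<le> (real DIM('b) powr q * (\<Sum>i\<in>Basis. \<bar>(G x - G y) \<bullet> i\<bar> powr q)) / norm (x - y) powr ?e"
      by (intro divide_right_mono norm_powr_le_sum_Basis q) auto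
    also have "\<dots> = real DIM('b) powr q * (\<Sum>i\<in>Basis. \<bar>G x \<bullet> i - G y \<bullet> i\<bar> powr q / norm (x - y) powr ?e)"
      by (simp add: sum_divide_distrib[symmetric] inner_diff_left)
    finally have "ennreal (norm (G x - G y) powr q / norm (x - y) powr ?e) \<le> ennreal \<dots>" by (rule ennreal_leI)
    also have "\<dots> = ennreal (real DIM('b) powr q) * (\<Sum>i\<in>Basis. ennreal (\<bar>G x \<bullet> i - G y \<bullet> i\<bar> powr q / norm (x - y) powr ?e))"
      by (simp add: ennreal_mult')
    finally show "indicator E x * indicator E y * ennreal (norm (G x - G y) powr q / norm (x - y) powr ?e) \<le>
      ennreal (real DIM('b) powr q) * (\<Sum>i\<in>Basis. indicator E x * indicator E y * ennreal (\<bar>G x \<bullet> i - G y \<bullet> i\<bar> powr q / norm (x - y) powr ?e))"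
      by (auto simp: indicator_def)
  qed
  also have "\<dots> = ennreal (real DIM('b) powr q) * (\<Sum>i\<in>Basis. gagliardo_int \<tau> q E (\<lambda>x. G x \<bullet> i))"
    unfolding gagliardo_int_def by (simp add: nn_integral_cmult nn_integral_sum)
  also have "\<dots> < \<infinity>" using fin by (simp add: ennreal_mult_less_top)
  finally show ?thesis unfolding gagliardo_def ennreal_pow_less_top .
qed

section \<open>Lebesgue integrals evaluated on Borel representatives\<close>

lemma LINT_lebesgue_eq:
  fixes f g :: "'a::euclidean_space \<Rightarrow> real"
  assumes [measurable]: "g \<in> borel_measurable borel" and ae: "AE x in lborel. f x = g x"
  shows "(LINT x|lebesgue. f x) = (LINT x|lborel. g x)"
proof -
  have gm: "g \<in> borel_measurable lebesgue" by (simp add: measurable_completion)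
  have ae': "AE x in lebesgue. f x = g x" using ae by (rule AE_completion)
  then have "AE x in lebesgue. g x = f x" by eventually_elim simp
  \<comment> \<open>Completeness of Lebesgue measure passes measurability from g to f.\<close>
  then have "f \<in> borel_measurable lebesgue" by (rule borel_measurable_AE[OF gm])
  then have "(LINT x|lebesgue. f x) = (LINT x|lebesgue. g x)" using gm ae' by (rule integral_cong_AE)
  also have "\<dots> = (LINT x|lborel. g x)" by (rule integral_completion) simp
  finally show ?thesis .
qed

lemma LINT_lebesgue_on_eq:
  fixes f g :: "'a::euclidean_space \<Rightarrow> real"
  assumes g: "g \<in> borel_measurable borel" and E: "E \<in> sets borel"
    and ae: "AE x in lborel. x \<in> E \<longrightarrow> f x = g x" and out: "\<And>x. x \<notin> E \<Longrightarrow> g x = 0"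
  shows "(LINT x|lebesgue_on E. f x) = (LINT x|lborel. g x)"
proof -
  have "(LINT x|lebesgue_on E. f x) = (LINT x|lebesgue. indicator E x *\<^sub>R f x)"
    using E by (intro integral_restrict_space) simp
  also have "\<dots> = (LINT x|lborel. g x)"
  proof (rule LINT_lebesgue_eq[OF g])
    show "AE x in lborel. indicator E x *\<^sub>R f x = g x"
      using ae by eventually_elim (use out in \<open>auto simp: indicator_def\<close>)
  qed
  finally show ?thesis .
qed

text \<open>Each slice of the preimage of N under (x, y) -> x - y is a reflected translate of N, so
  Tonelli's theorem makes the preimage null. It serves the kernel, which is evaluated at differences
  and agrees with a Borel function only off a null set.\<close>

lemma AE_lborel_diff:
  fixes P :: "'a::euclidean_space \<Rightarrow> bool"
  assumes "AE x in lborel. P x"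
  shows "AE z in lborel. P (fst z - snd (z :: 'a \<times> 'a))"
proof -
  obtain N :: "'a set" where N: "N \<in> null_sets lborel" "{x. \<not> P x} \<subseteq> N"
    using assms by (auto elim!: AE_E simp: null_sets_def)
  have [measurable]: "N \<in> sets borel" using N(1) by auto
  have m: "(\<lambda>z. indicator N (fst z - snd z) :: ennreal) \<in> borel_measurable (borel :: ('a \<times> 'a) measure)"
    unfolding borel_prod[symmetric] by measurable
  have "(\<integral>\<^sup>+z. indicator N (fst z - snd z) \<partial>(lborel :: ('a \<times> 'a) measure)) = (\<integral>\<^sup>+x. \<integral>\<^sup>+y. indicator N (x - y) \<partial>lborel \<partial>lborel)"
    using nn_integral_lborel_pair[OF m] by simp
  also have "\<dots> = (\<integral>\<^sup>+x. emeasure lborel N \<partial>(lborel :: 'a measure))"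
    by (intro nn_integral_cong) (simp add: nn_integral_lborel_reflect[of "indicator N"])
  also have "\<dots> = 0" using N(1) by auto
  finally have "AE z in lborel. indicator N (fst z - snd (z :: 'a \<times> 'a)) = (0::ennreal)"
    using m by (subst (asm) nn_integral_0_iff_AE) auto
  then show ?thesis
    by eventually_elim (use N(2) in \<open>auto simp: indicator_def split: if_splits\<close>)
qed

text \<open>A test function of E is one of \<Omega>, and it vanishes off E together with its
  derivatives, so the integrals over E and \<Omega> agree.\<close>

lemma weak_gradient_subset:
  assumes wg: "weak_gradient \<Omega> u G" and E: "open E" "open \<Omega>" "E \<subseteq> \<Omega>"
  shows "weak_gradient E u G"
proof -
  have loc: "\<And>v X. v \<in> loc_space X \<Omega> \<Longrightarrow> v \<in> loc_space X E" using E(3) by (auto simp: loc_space_def)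
  have restr: "(LINT x|lebesgue_on E. v x) = (LINT x|lebesgue_on \<Omega>. v x)" if v: "\<And>x. x \<notin> E \<Longrightarrow> v x = 0" for v :: "'a \<Rightarrow> real"
  proof -
    have "(LINT x|lebesgue_on E. v x) = (LINT x|lebesgue. indicator E x *\<^sub>R v x)"
      using E(1) by (intro integral_restrict_space) simp
    also have "\<dots> = (LINT x|lebesgue. indicator \<Omega> x *\<^sub>R v x)"
      using v E(3) by (intro Bochner_Integration.integral_cong) (auto simp: indicator_def)
    also have "\<dots> = (LINT x|lebesgue_on \<Omega>. v x)"
      using E(2) by (intro integral_restrict_space[symmetric]) simp
    finally show ?thesis .
  qed
  show ?thesis
    unfolding weak_gradient_def
  proof (intro conjI ballI)
    fix \<phi> :: "'a \<Rightarrow> real" and i :: 'a assume \<phi>: "\<phi> \<in> test_functions E" and i: "i \<in> Basis"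
    obtain S where S: "compact S" "S \<subseteq> E" "\<And>x. x \<notin> S \<Longrightarrow> \<phi> x = 0" using \<phi> unfolding test_functions_def by blast
    have "\<phi> \<in> test_functions \<Omega>" using \<phi> E(3) unfolding test_functions_def by blast
    then have eq: "(LINT x|lebesgue_on \<Omega>. u x * frechet_derivative \<phi> (at x) i) = - (LINT x|lebesgue_on \<Omega>. (G x \<bullet> i) * \<phi> x)"
      using wg i unfolding weak_gradient_def by blast
    have "frechet_derivative \<phi> (at x) i = 0" if "x \<notin> E" for x
      using S that by (intro frechet_derivative_outside_support[OF compact_imp_closed[OF S(1)]]) auto
    then have "(LINT x|lebesgue_on E. u x * frechet_derivative \<phi> (at x) i) = (LINT x|lebesgue_on \<Omega>. u x * frechet_derivative \<phi> (at x) i)"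
      by (intro restr) simp
    moreover have "\<phi> x = 0" if "x \<notin> E" for x using S that by auto
    then have "(LINT x|lebesgue_on E. (G x \<bullet> i) * \<phi> x) = (LINT x|lebesgue_on \<Omega>. (G x \<bullet> i) * \<phi> x)"
      by (intro restr) simp
    ultimately show "(LINT x|lebesgue_on E. u x * frechet_derivative \<phi> (at x) i) = - (LINT x|lebesgue_on E. (G x \<bullet> i) * \<phi> x)"
      using eq by simp
  qed (use wg loc in \<open>auto simp: weak_gradient_def\<close>)
qed

lemma Lp_int_1_finite:
  assumes [measurable]: "v \<in> borel_measurable borel" "E \<in> sets borel" and E: "emeasure lborel E < \<infinity>" and p: "1 \<le> p"
    and fin: "Lp_int p E v < \<infinity>"
  shows "Lp_int 1 E v < \<infinity>"
proof -
  have "Lp_int 1 E v \<le> (\<integral>\<^sup>+x. indicator E x + indicator E x * ennreal (\<bar>v x\<bar> powr p) \<partial>lborel)"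
    unfolding Lp_int_def
  proof (rule nn_integral_mono)
    fix x
    have "\<bar>v x\<bar> \<le> 1 + \<bar>v x\<bar> powr p" using le_truncation[of "\<bar>v x\<bar>" 1 p] p by simp
    then have "ennreal \<bar>v x\<bar> \<le> ennreal (1 + \<bar>v x\<bar> powr p)" by (rule ennreal_leI)
    then show "indicator E x * ennreal (\<bar>v x\<bar> powr 1) \<le> indicator E x + indicator E x * ennreal (\<bar>v x\<bar> powr p)"
      by (simp add: indicator_def)
  qed
  also have "\<dots> = emeasure lborel E + Lp_int p E v"
    unfolding Lp_int_def by (simp add: nn_integral_add)
  also have "\<dots> < \<infinity>" using E fin by simp
  finally show ?thesis .
qed

lemma borel_measurable_lebesgue_on:
  assumes "f \<in> borel_measurable lebesgue"
  shows "f \<in> borel_measurable (lebesgue_on E)"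
  using assms by (rule measurable_restrict_space1)

context borel_solution
begin

lemma gagliardo_int_finite_local:
  assumes E: "open E" "compact (closure E)" "closure E \<subseteq> \<Omega>"
    and \<tau>: "0 \<le> \<tau>" "\<tau> < 1" "\<tau> < s * ((p + 1) / (p - 1))"
  shows "gagliardo_int \<tau> p E u < \<infinity>"
proof -
  \<comment> \<open>An exponent strictly in between provides the room consumed by the passage from
    translations to the seminorm.\<close>
  obtain T where T: "\<tau> < T" "T < 1" "T < s * ((p + 1) / (p - 1))"
    using dense[of \<tau> "min 1 (s * ((p + 1) / (p - 1)))"] \<tau>(2,3) by auto
  then have "nikolskii T" using \<tau> by (intro nikolskii_below) auto
  then obtain A where A: "0 \<le> A" "\<And>h. translation_int p (closure E) u h \<le> ennreal (A * norm h powr (T * p))"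
    using E(2,3) unfolding nikolskii_def by blast
  show ?thesis
  proof (rule gagliardo_int_finite_of_translation_int[where \<gamma> = T and r = 1 and A = A])
    show "emeasure lborel E < \<infinity>"
      using emeasure_mono[OF closure_subset[of E], of lborel] emeasure_compact_less_top[OF E(2)] by (auto intro: le_less_trans)
    have "Lp_int p E u \<le> Lp_int p UNIV u" by (rule Lp_int_mono_set) simp
    then show "Lp_int p E u < \<infinity>" using u_fin by (rule le_less_trans)
    show "translation_int p E u h \<le> ennreal (A * norm h powr (T * p))" for h
      using translation_int_mono_set[OF closure_subset[of E], of p u h] A(2)[of h] by simp
  qed (use E T \<tau> A p2 in auto)
qed

text \<open>m is the value of t for which (s p + s + t - p)/p equals \<tau>, so every t above m will
  do, and the upper bound on \<tau> says precisely that m < 1. Since m may be negative, the midpoint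
  of m and 1 is cut off at 0. The condition on s brings all t < 1 within reach of
  \<open>nikolskii_below\<close>.\<close>

lemma gradient_exponent:
  assumes "(p - 1) / (p + 1) < s" "\<tau> < s * ((p + 1) / p) - (p - 1) / p" "0 \<le> \<tau>"
  obtains t where "nikolskii t" "0 \<le> t" "t < 1" "p < s * p + s + t" "\<tau> < (s * p + s + t - p) / p"
proof -
  define m where "m = \<tau> * p + p - s * p - s"
  have "\<tau> * p < (s * ((p + 1) / p) - (p - 1) / p) * p" using assms(2) p2 by (intro mult_strict_right_mono) auto
  also have "\<dots> = s * (p + 1) - (p - 1)" using p2 by (simp add: field_simps)
  finally have m1: "m < 1" by (simp add: m_def algebra_simps)
  define t where "t = max 0 ((m + 1) / 2)"
  have t: "0 \<le> t" "t < 1" "m < t" using m1 by (auto simp: t_def less_max_iff_disj)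
  have "1 < s * ((p + 1) / (p - 1))" using assms(1) p2 by (simp add: field_simps)
  then have "nikolskii t" using t by (intro nikolskii_below) auto
  moreover have "\<tau> < (s * p + s + t - p) / p" using t(3) p2 by (simp add: m_def field_simps)
  moreover have "p < s * p + s + t"
  proof -
    have "0 \<le> \<tau> * p" using assms(3) p2 by simp
    then show ?thesis using t(3) by (simp add: m_def)
  qed
  ultimately show ?thesis using that t by blast
qed

lemma gagliardo_int_dyadic_derivative_finite_local:
  assumes E: "open E" "compact (closure E)" "closure E \<subseteq> \<Omega>" and i: "i \<in> Basis"
    and s: "(p - 1) / (p + 1) < s" and \<tau>: "0 \<le> \<tau>" "\<tau> < s * ((p + 1) / p) - (p - 1) / p"
  shows "Lp_int p E (dyadic_derivative u i) < \<infinity>" "gagliardo_int \<tau> p E (dyadic_derivative u i) < \<infinity>"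
proof -
  obtain t where t: "nikolskii t" "0 \<le> t" "t < 1" "p < s * p + s + t" "\<tau> < (s * p + s + t - p) / p"
    using gradient_exponent[OF s \<tau>(2,1)] by blast
  have "Lp_int p E (dyadic_derivative u i) \<le> Lp_int p (closure E) (dyadic_derivative u i)"
    using closure_subset[of E] by (rule Lp_int_mono_set)
  then show l: "Lp_int p E (dyadic_derivative u i) < \<infinity>" using Lp_int_dyadic_derivative_finite[OF t(1,2,4) E(2,3) i] by (rule le_less_trans)
  obtain A r where A: "0 \<le> A" "0 < r" "\<And>h. norm h < r \<Longrightarrow> translation_int p (closure E) (dyadic_derivative u i) h \<le> ennreal (A * norm h powr (s * p + s + t - p))"
    using translation_int_dyadic_derivative_le[OF t(1-4) E(2,3) i] by blast
  show "gagliardo_int \<tau> p E (dyadic_derivative u i) < \<infinity>"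
  proof (rule gagliardo_int_finite_of_translation_int[where \<gamma> = "(s * p + s + t - p) / p" and r = r and A = A])
    show "emeasure lborel E < \<infinity>"
      using emeasure_mono[OF closure_subset[of E], of lborel] emeasure_compact_less_top[OF E(2)] by (auto intro: le_less_trans)
    show "translation_int p E (dyadic_derivative u i) h \<le> ennreal (A * norm h powr ((s * p + s + t - p) / p * p))" if "norm h < r" for h
      using translation_int_mono_set[OF closure_subset[of E], of p "dyadic_derivative u i" h] A(3)[OF that] p2 by simp
  qed (use E t \<tau> A p2 l in auto)
qed

text \<open>The field G can be fixed before \<tau>: \<open>dyadic_derivative\<close> does not
  involve the exponent t with which its properties are proved, so different t serve for different
  \<tau>. Here v is the original solution and u the Borel representative for which the estimates
  hold.\<close>

lemma regularity:
  fixes v :: "'a \<Rightarrow> real"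
  assumes v: "v \<in> borel_measurable lebesgue" and vu: "AE x in lborel. v x = u x"
  shows "(s \<le> (p - 1) / (p + 1) \<longrightarrow>
            (\<forall>\<tau>. s \<le> \<tau> \<and> \<tau> < s * ((p + 1) / (p - 1)) \<longrightarrow>
               v \<in> loc_space (frac_sobolev \<tau> p) \<Omega>)) \<and>
         (s > (p - 1) / (p + 1) \<longrightarrow>
            v \<in> loc_space (sobolev1 p) \<Omega> \<and>
            (\<exists>G. weak_gradient \<Omega> v G \<and>
              (\<forall>\<tau>. 0 < \<tau> \<and> \<tau> < s * ((p + 1) / p) - (p - 1) / p \<longrightarrow>
                 G \<in> loc_space (frac_sobolev \<tau> p) \<Omega>)))"
proof -
  have p1: "1 \<le> p" using p2 by simp
  have vE: "AE x in lborel. x \<in> E \<longrightarrow> v x = u x" for E using vu by eventually_elim simp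
  have Efin: "emeasure lborel E < \<infinity>" if "compact (closure E)" for E :: "'a set"
    using emeasure_mono[OF closure_subset[of E], of lborel] emeasure_compact_less_top[OF that] by (auto intro: le_less_trans)
  have lpu: "Lp_int p E u < \<infinity>" for E
  proof -
    have "Lp_int p E u \<le> Lp_int p UNIV u" by (rule Lp_int_mono_set) simp
    then show ?thesis using u_fin by (rule le_less_trans)
  qed
  have vLp: "v \<in> Lp_space p E" if [measurable]: "E \<in> sets borel" for E
    using lpu[of E] v vE[of E] by (simp add: Lp_space_def borel_measurable_lebesgue_on Lp_norm_eq[of u E v] ennreal_pow_less_top del: infinity_ennreal_def)
  have vL1: "v \<in> Lp_space 1 E" if E: "open E" "compact (closure E)" for E
    using Lp_int_1_finite[OF u_borel _ Efin[OF E(2)] p1 lpu] E(1) v vE[of E]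
    by (simp add: Lp_space_def borel_measurable_lebesgue_on Lp_norm_eq[of u E v] ennreal_pow_less_top del: infinity_ennreal_def)
  have part1: "v \<in> loc_space (frac_sobolev \<tau> p) \<Omega>" if s: "s \<le> (p - 1) / (p + 1)" and \<tau>: "s \<le> \<tau>" "\<tau> < s * ((p + 1) / (p - 1))" for \<tau>
    unfolding loc_space_def frac_sobolev_def
  proof (intro CollectI allI impI conjI)
    fix E :: "'a set" assume E: "open E \<and> compact (closure E) \<and> closure E \<subseteq> \<Omega>"
    show "v \<in> Lp_space p E" using E by (intro vLp) simp
    \<comment> \<open>The threshold on s says that the limiting exponent does not exceed 1, so
      \<tau> < 1 is automatic.\<close>
    have "s * ((p + 1) / (p - 1)) \<le> 1" using s p2 by (simp add: field_simps)
    then have "gagliardo_int \<tau> p E u < \<infinity>" using E \<tau> s0 by (intro gagliardo_int_finite_local) auto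
    then show "gagliardo \<tau> p E v < \<infinity>"
      using E vE[of E] by (subst gagliardo_eq[of u E v]) (simp_all add: ennreal_pow_less_top del: infinity_ennreal_def)
  qed
  define G where "G x = (\<Sum>i\<in>Basis. dyadic_derivative u i x *\<^sub>R i)" for x
  have Gi: "G x \<bullet> i = dyadic_derivative u i x" if "i \<in> Basis" for x i
    using that by (simp add: G_def inner_sum_left inner_Basis if_distrib sum.delta' cong: if_cong)
  have Gm[measurable]: "G \<in> borel_measurable borel" unfolding G_def[abs_def] by measurable
  have Gml: "G \<in> borel_measurable (lebesgue_on E)" for E
    by (intro borel_measurable_lebesgue_on measurable_completion) simp
  have part2: "v \<in> loc_space (sobolev1 p) \<Omega> \<and> (\<exists>G. weak_gradient \<Omega> v G \<and>
      (\<forall>\<tau>. 0 < \<tau> \<and> \<tau> < s * ((p + 1) / p) - (p - 1) / p \<longrightarrow> G \<in> loc_space (frac_sobolev \<tau> p) \<Omega>))"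
    if s: "(p - 1) / (p + 1) < s"
  proof -
    \<comment> \<open>Thus \<tau> = 0 is admissible in \<open>gradient_exponent\<close>; it supplies
      the L^p bounds and the integration by parts, which concern no particular \<tau>.\<close>
    have "0 < (s * (p + 1) - (p - 1)) / p" using s p2 by (simp add: pos_divide_less_eq)
    then have e0: "0 < s * ((p + 1) / p) - (p - 1) / p" by (simp add: diff_divide_distrib)
    have GLp: "G \<in> Lp_space p E" if E: "open E" "compact (closure E)" "closure E \<subseteq> \<Omega>" for E
      unfolding Lp_space_def
    proof (intro CollectI conjI Gml Lp_norm_finite_of_components Gm)
      show "Lp_int p E (\<lambda>x. G x \<bullet> i) < \<infinity>" if "i \<in> Basis" for i
        using gagliardo_int_dyadic_derivative_finite_local(1)[OF E that s order_refl e0] that by (simp add: Gi)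
    qed (use E p2 in auto)
    have GL1: "G \<in> Lp_space 1 E" if E: "open E" "compact (closure E)" "closure E \<subseteq> \<Omega>" for E
      unfolding Lp_space_def
    proof (intro CollectI conjI Gml Lp_norm_finite_of_components Gm)
      show "Lp_int 1 E (\<lambda>x. G x \<bullet> i) < \<infinity>" if i: "i \<in> Basis" for i
        using gagliardo_int_dyadic_derivative_finite_local(1)[OF E i s order_refl e0] E(1) i by (intro Lp_int_1_finite[OF _ _ Efin[OF E(2)] p1]) (auto simp: Gi)
    qed (use E in auto)
    have wg: "weak_gradient \<Omega> v G"
      unfolding weak_gradient_def
    proof (intro conjI ballI)
      show "v \<in> loc_space (Lp_space 1) \<Omega>" "G \<in> loc_space (Lp_space 1) \<Omega>"
        using vL1 GL1 by (auto simp: loc_space_def)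
      fix \<phi> :: "'a \<Rightarrow> real" and i :: 'a assume \<phi>: "\<phi> \<in> test_functions \<Omega>" and i: "i \<in> Basis"
      obtain S where S: "compact S" "S \<subseteq> \<Omega>" "\<And>x. x \<notin> S \<Longrightarrow> \<phi> x = 0" using \<phi> unfolding test_functions_def by blast
      have sm: "smooth_cs \<phi>" using \<phi> by (rule smooth_cs_test_function)
      have [measurable]: "\<phi> \<in> borel_measurable borel" by (rule smooth_cs_measurable[OF sm])
      have [measurable]: "(\<lambda>x. frechet_derivative \<phi> (at x) i) \<in> borel_measurable borel"
        by (rule smooth_cs_measurable[OF smooth_cs_deriv[OF sm]])
      have d0: "frechet_derivative \<phi> (at x) i = 0" if "x \<notin> \<Omega>" for x
        using S that by (intro frechet_derivative_outside_support[OF compact_imp_closed[OF S(1)]]) auto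
      have [measurable]: "\<Omega> \<in> sets borel" using open_\<Omega> by simp
      obtain t where t: "nikolskii t" "0 \<le> t" "p < s * p + s + t"
        using gradient_exponent[OF s e0 order_refl] by blast
      have "(LINT x|lebesgue_on \<Omega>. v x * frechet_derivative \<phi> (at x) i) = (LINT x|lborel. u x * frechet_derivative \<phi> (at x) i)"
      proof (rule LINT_lebesgue_on_eq)
        show "AE x in lborel. x \<in> \<Omega> \<longrightarrow> v x * frechet_derivative \<phi> (at x) i = u x * frechet_derivative \<phi> (at x) i"
          using vu by eventually_elim simp
      qed (use d0 in auto)
      also have "\<dots> = - (LINT x|lborel. dyadic_derivative u i x * \<phi> x)" by (rule dyadic_derivative_integration_by_parts[OF t \<phi> i])
      also have "(LINT x|lborel. dyadic_derivative u i x * \<phi> x) = (LINT x|lebesgue_on \<Omega>. (G x \<bullet> i) * \<phi> x)"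
      proof (rule LINT_lebesgue_on_eq[symmetric])
        show "dyadic_derivative u i x * \<phi> x = 0" if "x \<notin> \<Omega>" for x using S that by auto
      qed (auto simp: Gi[OF i])
      finally show "(LINT x|lebesgue_on \<Omega>. v x * frechet_derivative \<phi> (at x) i) = - (LINT x|lebesgue_on \<Omega>. (G x \<bullet> i) * \<phi> x)" .
    qed
    have "v \<in> loc_space (sobolev1 p) \<Omega>"
      unfolding loc_space_def sobolev1_def
    proof (intro CollectI allI impI conjI)
      fix E :: "'a set" assume E: "open E \<and> compact (closure E) \<and> closure E \<subseteq> \<Omega>"
      show "v \<in> Lp_space p E" using E by (intro vLp) simp
      have "E \<subseteq> \<Omega>" using E closure_subset[of E] by blast
      then have "weak_gradient E v G" using E by (intro weak_gradient_subset[OF wg _ open_\<Omega>]) auto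
      then show "\<exists>G\<in>Lp_space p E. weak_gradient E v G" using GLp[of E] E by blast
    qed
    moreover have "G \<in> loc_space (frac_sobolev \<tau> p) \<Omega>" if \<tau>: "0 < \<tau>" "\<tau> < s * ((p + 1) / p) - (p - 1) / p" for \<tau>
      unfolding loc_space_def frac_sobolev_def
    proof (intro CollectI allI impI conjI)
      fix E :: "'a set" assume E: "open E \<and> compact (closure E) \<and> closure E \<subseteq> \<Omega>"
      then show "G \<in> Lp_space p E" by (intro GLp) auto
      show "gagliardo \<tau> p E G < \<infinity>"
      proof (rule gagliardo_finite_of_components)
        show "gagliardo_int \<tau> p E (\<lambda>x. G x \<bullet> i) < \<infinity>" if i: "i \<in> Basis" for i
          using gagliardo_int_dyadic_derivative_finite_local(2)[of E i \<tau>] E i s \<tau> by (simp add: Gi)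
      qed (use E p2 in auto)
    qed
    ultimately show ?thesis using wg by blast
  qed
  show ?thesis using part1 part2 by blast
qed

end

theorem corollary1p9:
  fixes p s \<Lambda> :: real
    and \<Omega> :: "'a::euclidean_space set"
    and K f g u :: "'a \<Rightarrow> real"
  assumes "p \<ge> 2" and "0 < s" and "s < 1" and "\<Lambda> \<ge> 1"
    and "open \<Omega>" and "bounded \<Omega>"
    and "K \<in> borel_measurable lebesgue" and "\<And>z. K z \<ge> 0"
    and "\<And>z. 1 / \<Lambda> * norm z powr (real DIM('a) + s * p) \<le> K z"
    and "\<And>z. K z \<le> \<Lambda> * norm z powr (real DIM('a) + s * p)"
    and "f \<in> frac_sobolev s (p / (p - 1)) \<Omega>"
    and "g \<in> frac_sobolev s p UNIV"
    and "dirichlet_solution s p K \<Omega> f g u"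
  shows "(s \<le> (p - 1) / (p + 1) \<longrightarrow>
            (\<forall>\<tau>. s \<le> \<tau> \<and> \<tau> < s * ((p + 1) / (p - 1)) \<longrightarrow>
               u \<in> loc_space (frac_sobolev \<tau> p) \<Omega>)) \<and>
         (s > (p - 1) / (p + 1) \<longrightarrow>
            u \<in> loc_space (sobolev1 p) \<Omega> \<and>
            (\<exists>G. weak_gradient \<Omega> u G \<and>
              (\<forall>\<tau>. 0 < \<tau> \<and> \<tau> < s * ((p + 1) / p) - (p - 1) / p \<longrightarrow>
                 G \<in> loc_space (frac_sobolev \<tau> p) \<Omega>)))"
proof -
  let ?e = "real DIM('a) + s * p" and ?p' = "p / (p - 1)"
  have p': "1 \<le> ?p'" using assms(1) by (simp add: field_simps)
  have um: "u \<in> borel_measurable lebesgue" and uLp: "Lp_norm p UNIV u < \<infinity>" and ug: "gagliardo s p UNIV u < \<infinity>"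
    using assms(13) by (simp_all add: dirichlet_solution_def frac_sobolev_def Lp_space_def lebesgue_on_UNIV_eq)
  have fm: "f \<in> borel_measurable (lebesgue_on \<Omega>)" and fLp: "Lp_norm ?p' \<Omega> f < \<infinity>" and fg: "gagliardo s ?p' \<Omega> f < \<infinity>"
    using assms(11) by (simp_all add: frac_sobolev_def Lp_space_def)
  have [measurable]: "\<Omega> \<in> sets borel" using assms(5) by simp
  obtain v where v[measurable]: "v \<in> borel_measurable borel" and uv: "AE x in lborel. u x = v x"
    using completion_ex_borel_measurable_real[OF um] by auto
  obtain K1 where K1[measurable]: "K1 \<in> borel_measurable borel" and KK1: "AE x in lborel. K x = K1 x"
    using completion_ex_borel_measurable_real[OF assms(7)] by auto
  \<comment> \<open>clamped, as \<open>K1\<close> satisfies the bounds on \<open>K\<close> only almost everywhere\<close>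
  define k where "k z = max (1 / \<Lambda> * norm z powr ?e) (min (\<Lambda> * norm z powr ?e) (K1 z))" for z
  have [measurable]: "k \<in> borel_measurable borel" unfolding k_def[abs_def] by measurable
  have Kk: "AE x in lborel. K x = k x"
    using KK1
  proof eventually_elim
    case (elim x)
    then show ?case using assms(9)[of x] assms(10)[of x] by (simp add: k_def)
  qed
  \<comment> \<open>The clamped kernel stays below its upper bound because the lower bound does not
    exceed it.\<close>
  have "1 / \<Lambda> \<le> 1" using assms(4) by simp
  then have "1 / \<Lambda> \<le> \<Lambda>" using assms(4) by linarith
  then have k_upper: "k z \<le> \<Lambda> * norm z powr ?e" for z
    unfolding k_def by (intro max.boundedI mult_right_mono) auto
  have fm': "(\<lambda>x. if x \<in> \<Omega> then f x else 0) \<in> borel_measurable lebesgue"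
    using fm by (subst borel_measurable_if) auto
  obtain F1 where F1[measurable]: "F1 \<in> borel_measurable borel" and fF1: "AE x in lborel. (if x \<in> \<Omega> then f x else 0) = F1 x"
    using completion_ex_borel_measurable_real[OF fm'] by auto
  \<comment> \<open>F1 vanishes off \<Omega> only almost everywhere; the indicator makes this hold
    everywhere.\<close>
  define F where "F x = indicator \<Omega> x * F1 x" for x
  have [measurable]: "F \<in> borel_measurable borel" unfolding F_def[abs_def] by measurable
  have fF: "AE x in lborel. x \<in> \<Omega> \<longrightarrow> f x = F x"
    using fF1 by eventually_elim (auto simp: F_def)
  have F_out: "F x = 0" if "x \<notin> \<Omega>" for x using that by (simp add: F_def)
  interpret borel_solution p s \<Lambda> \<Omega> k F v
  proof
    show "1 / \<Lambda> * norm z powr ?e \<le> k z" for z by (simp add: k_def)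
    have lF: "Lp_int ?p' \<Omega> F < \<infinity>"
      using fLp fF by (simp add: Lp_norm_eq[of F \<Omega> f] ennreal_pow_less_top del: infinity_ennreal_def)
    have "Lp_int ?p' UNIV F = Lp_int ?p' \<Omega> F"
      unfolding Lp_int_def using p' F_out by (intro nn_integral_cong) (auto simp: indicator_def)
    then show "Lp_int ?p' UNIV F < \<infinity>" using lF by simp
    have gF: "gagliardo_int s ?p' \<Omega> F < \<infinity>"
      using fg fF by (simp add: gagliardo_eq[of F \<Omega> f] ennreal_pow_less_top del: infinity_ennreal_def)
    then obtain G where G: "gagliardo_int s ?p' \<Omega> F = ennreal G" "0 \<le> G" by (cases "gagliardo_int s ?p' \<Omega> F") auto
    fix C assume C: "compact C" "C \<subseteq> \<Omega>"
    \<comment> \<open>For |h| < d the |h|-neighbourhood of C stays in \<Omega>, so the seminorm over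
      \<Omega> alone controls the translations of the extended datum on C.\<close>
    obtain d D where d: "0 < d" and D: "D \<subseteq> \<Omega>" "\<And>x v. x \<in> C \<Longrightarrow> norm v \<le> d \<Longrightarrow> x + v \<in> D"
      by (rule compact_neighbourhood[OF C assms(5)]) (rule that)
    let ?c = "translation_const TYPE('a) s ?p'"
    have "translation_int ?p' C F h \<le> ennreal ((?c * G) * norm h powr (s * ?p'))" if h: "norm h < d" for h
    proof -
      have "translation_int ?p' C F h \<le> ennreal (?c * norm h powr (s * ?p')) * gagliardo_int s ?p' \<Omega> F"
      proof (rule translation_int_le_gagliardo_int)
        show "x + w \<in> \<Omega>" if "x \<in> C" "norm w \<le> norm h" for x w
          using D(2)[OF that(1), of w] that(2) h D(1) by auto
      qed (use assms p' C(1) in \<open>auto simp: borel_compact\<close>)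
      also have "\<dots> = ennreal ((?c * G) * norm h powr (s * ?p'))"
        using G translation_const_pos[where 'a='a, of s ?p'] by (simp add: ennreal_mult'[symmetric] mult_ac)
      finally show ?thesis .
    qed
    then show "\<exists>A\<ge>0. \<exists>r>0. \<forall>h. norm h < r \<longrightarrow> translation_int ?p' C F h \<le> ennreal (A * norm h powr (s * ?p'))"
      using d(1) G(2) translation_const_pos[where 'a='a, of s ?p'] by (intro exI[of _ "?c * G"] conjI exI[of _ d]) auto
  next
    show "Lp_int p UNIV v < \<infinity>"
      using uLp uv by (simp add: Lp_norm_eq[of v UNIV u] ennreal_pow_less_top del: infinity_ennreal_def)
    show "gagliardo_int s p UNIV v < \<infinity>"
      using ug uv by (simp add: gagliardo_eq[of v UNIV u] ennreal_pow_less_top del: infinity_ennreal_def)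
  next
    fix \<phi> :: "'a \<Rightarrow> real" assume [measurable]: "\<phi> \<in> borel_measurable borel" and \<phi>: "\<phi> \<in> frac_sobolev0 s p \<Omega>"
    have m: "(\<lambda>z. Jp p (v (fst z) - v (snd z)) / k (fst z - snd z) * (\<phi> (fst z) - \<phi> (snd z))) \<in> borel_measurable borel"
      unfolding borel_prod[symmetric] by measurable
    have "(LINT (x, y)|lebesgue. \<bar>u x - u y\<bar> powr (p - 2) * (u x - u y) / K (x - y) * (\<phi> x - \<phi> y)) =
       (LINT z|lborel. Jp p (v (fst z) - v (snd z)) / k (fst z - snd z) * (\<phi> (fst z) - \<phi> (snd z)))"
    proof (rule LINT_lebesgue_eq[OF m])
      \<comment> \<open>The solution is replaced at both points of the pair, the kernel at their
        difference; the test function is already Borel.\<close>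
      show "AE z in lborel. (case z of (x, y) \<Rightarrow> \<bar>u x - u y\<bar> powr (p - 2) * (u x - u y) / K (x - y) * (\<phi> x - \<phi> y)) =
        Jp p (v (fst z) - v (snd z)) / k (fst z - snd z) * (\<phi> (fst z) - \<phi> (snd z))"
        using AE_lborel_pair[OF uv] AE_lborel_diff[OF Kk]
        by eventually_elim (auto simp: Jp_def split: prod.splits)
    qed
    moreover have "(LINT x|lebesgue_on \<Omega>. f x * \<phi> x) = (LINT x|lborel. F x * \<phi> x)"
    proof (rule LINT_lebesgue_on_eq)
      show "AE x in lborel. x \<in> \<Omega> \<longrightarrow> f x * \<phi> x = F x * \<phi> x"
        using fF by eventually_elim simp
    qed (use F_out in auto)
    ultimately show "(LINT z|lborel. Jp p (v (fst z) - v (snd z)) / k (fst z - snd z) * (\<phi> (fst z) - \<phi> (snd z))) = (LINT x|lborel. F x * \<phi> x)"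
      using assms(13) \<phi> by (simp add: dirichlet_solution_def)
  qed (use assms k_upper in auto)
  show ?thesis by (rule regularity[OF um uv])
qed

end
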